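(* Consider the following network with the Vickrey queuing model. Nodes: $a,b,c,x,y,z,q$. Edges (free-flow time $\tau$, capacity $\nu$): $e_1=(a,b)$ with $\tau=1,\nu=1$; $e_2=(b,c)$ with $\tau=1,\nu=1$; $e_3=(c,x)$ with $\tau=\varepsilon,\nu=1$; $e_7=(y,z)$ with $\tau=1,\nu=6$; $e_5=(z,q)$ with $\tau=2-\varepsilon,\nu=2$; $e_4=(q,b)$ with $\tau=\varepsilon,\nu=2$; $e_6=(b,z)$ with $\tau=4,\nu=\infty$. Five commodities, all with value-of-time $\gamma_i=1$: commodity 1 from $y$ to $z$ with inflow rate $6\cdot\mathbf 1_{[0,1]}$; commodity 2 from $z$ to $c$ with rate $2\cdot\mathbf 1_{[2,3]}$; commodity 3 from $c$ to $x$ with rate $\mathbf 1_{[7,10+M]}$; commodity 4 from $a$ to $x$ with rate $\mathbf 1_{[4,5]}$; commodity 5 from $q$ to $b$ with rate $2\cdot\mathbf 1_{[9,13+M]}$. Then there exist values $M\in\mathbb R_{\ge0}$ such that for every $\varepsilon\in(0,1]$, no system optimal flow of this network is implementable.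
   Context: Dynamic flow model: directed graph, time horizon $H'=[0,t_f']\subseteq H=[0,t_f]$ (sufficiently large), walks $w$ (finite edge sequences, repetitions allowed) from each commodity's source to its destination, $\mathcal W_i$ the walks of commodity $i$. Edge flows $g\in L_+(H)^E$ induce traversal times $D_e(g,t)$, exit times $T_e(g,t)=t+D_e(g,t)$, and arrival times $A_{w,1}=\mathrm{id}$, $A_{w,j}(g,\cdot)=T_{w[j-1]}(g,\cdot)\circ A_{w,j-1}(g,\cdot)$. A walk flow $h\in L_+(H)^{\mathcal W}$ with $\sum_{w\in\mathcal W_i}h_w=r_i$ induces the edge flow $g=\ell(h)$ satisfying $\int_0^tg_e\,\mathrm d\sigma=\sum_w\sum_{j:w[j]=e}\int_{A_{w,j}(g,\cdot)^{-1}([0,t])}h_w\,\mathrm d\sigma$, supported on $H'$; $\Lambda$ is the set of such admissible $h$. Vickrey queuing model: $D_e(g,t)=\tau_e+q_e(g,t)/\nu_e$, where $q_e(g,t)=\int_0^tg_e\,\mathrm d\sigma-\int_{T_e(g,\cdot)^{-1}([0,t+\tau_e])}g_e\,\mathrm d\sigma$ is the queue, required to be nonnegative and with edge outflow rate (derivative of $t\mapsto\int_{T_e(g,\cdot)^{-1}([0,t])}g_e\,\mathrm d\sigma$) at most $\nu_e$ a.e.; for $\nu_e=\infty$, $D_e\equiv\tau_e$. Costs: $\Psi_{(\hat w,i)}(g,t)=\gamma_i(A_{w,|w|+1}(g,t)-t)$; for tolls $p:H\to\mathbb R_+^E$, $P^p_w(g,t)=\sum_jp_{w[j]}(A_{w,j}(g,t))$.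 $h\in\Lambda$ is a $p$-DUE if for every $i$, $w\in\mathcal W_i$ and a.e. $t$, $h_w(t)>0$ implies $\Psi_w(g,t)+P^p_w(g,t)\le\Psi_{w'}(g,t)+P^p_{w'}(g,t)$ for all $w'\in\mathcal W_i$, where $g=\ell(h)$. An edge flow $g$ is implementable if there are tolls $p\ge0$ and a $p$-DUE $h\in\Lambda$ with $\ell(h)=g$ and $\sum_e\int p_eg_e\,\mathrm d\sigma<\infty$. A system optimal flow is a minimizer of the total travel time $\sum_e\int_H D_e(g,\cdot)g_e\,\mathrm d\sigma$ over $g\in\ell(\Lambda)$. *)

theory Defs
  imports "HOL-Analysis.Analysis"
begin

text \<open>A network: edge tails/heads, free-flow times, capacities (possibly infinite),
commodity sources/destinations, inflow rates and values of time.
Time horizon H = {0..tf}, H' = {0..tf'}.\<close>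

record ('v, 'e, 'i) net =
  etail :: "'e \<Rightarrow> 'v"
  ehead :: "'e \<Rightarrow> 'v"
  tau   :: "'e \<Rightarrow> real"
  cap   :: "'e \<Rightarrow> ereal"
  src   :: "'i \<Rightarrow> 'v"
  dst   :: "'i \<Rightarrow> 'v"
  rate  :: "'i \<Rightarrow> real \<Rightarrow> real"
  vot   :: "'i \<Rightarrow> real"

definition queue :: "real \<Rightarrow> real \<Rightarrow> (real \<Rightarrow> real) \<Rightarrow> (real \<Rightarrow> real) \<Rightarrow> real \<Rightarrow> real" where
  "queue tf tau_e ge D t =
     (LINT s:{0..t}|lborel. ge s)
     - (LINT s:{s \<in> {0..tf}. 0 \<le> s + D s \<and> s + D s \<le> t + tau_e}|lborel. ge s)"

definition outcum :: "real \<Rightarrow> (real \<Rightarrow> real) \<Rightarrow> (real \<Rightarrow> real) \<Rightarrow> real \<Rightarrow> real" where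
  "outcum tf ge D t = (LINT s:{s \<in> {0..tf}. 0 \<le> s + D s \<and> s + D s \<le> t}|lborel. ge s)"

definition vickrey_ok :: "real \<Rightarrow> real \<Rightarrow> ereal \<Rightarrow> (real \<Rightarrow> real) \<Rightarrow> (real \<Rightarrow> real) \<Rightarrow> bool" where
  "vickrey_ok tf tau_e nu_e ge D \<longleftrightarrow>
     (\<forall>t. t \<notin> {0..tf} \<longrightarrow> D t = tau_e) \<and>
     (if nu_e = \<infinity> then (\<forall>t\<in>{0..tf}. D t = tau_e)
      else (\<forall>t\<in>{0..tf}. queue tf tau_e ge D t \<ge> 0 \<and>
                          D t = tau_e + queue tf tau_e ge D t / real_of_ereal nu_e) \<and>
           (AE t in lborel. t \<in> {0..tf} \<longrightarrow>
              (\<exists>d. (outcum tf ge D has_real_derivative d) (at t) \<and> ereal d \<le> nu_e)))"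

definition trav :: "('v, 'e, 'i, 'z) net_scheme \<Rightarrow> real \<Rightarrow> ('e \<Rightarrow> real \<Rightarrow> real) \<Rightarrow> 'e \<Rightarrow> real \<Rightarrow> real" where
  "trav N tf g e = (THE D. vickrey_ok tf (tau N e) (cap N e) (g e) D)"

definition exitT :: "('v, 'e, 'i, 'z) net_scheme \<Rightarrow> real \<Rightarrow> ('e \<Rightarrow> real \<Rightarrow> real) \<Rightarrow> 'e \<Rightarrow> real \<Rightarrow> real" where
  "exitT N tf g e t = t + trav N tf g e t"

text \<open>Arrival times: arr T w j = A_{w,j+1} (0-indexed), so arr T w 0 = id and
arr T w (length w) = A_{w,|w|+1}.\<close>
fun arr :: "('e \<Rightarrow> real \<Rightarrow> real) \<Rightarrow> 'e list \<Rightarrow> nat \<Rightarrow> real \<Rightarrow> real" where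
  "arr T w 0 t = t"
| "arr T w (Suc j) t = T (w ! j) (arr T w j t)"

definition is_walk :: "('v, 'e, 'i, 'z) net_scheme \<Rightarrow> 'v \<Rightarrow> 'v \<Rightarrow> 'e list \<Rightarrow> bool" where
  "is_walk N s d w \<longleftrightarrow> w \<noteq> [] \<and> etail N (hd w) = s \<and> ehead N (last w) = d \<and>
     (\<forall>j. Suc j < length w \<longrightarrow> ehead N (w ! j) = etail N (w ! Suc j))"

definition walks :: "('v, 'e, 'i, 'z) net_scheme \<Rightarrow> ('e list \<times> 'i) set" where
  "walks N = {(w, i). is_walk N (src N i) (dst N i) w}"

definition walks_of :: "('v, 'e, 'i, 'z) net_scheme \<Rightarrow> 'i \<Rightarrow> ('e list \<times> 'i) set" where
  "walks_of N i = {wi \<in> walks N. snd wi = i}"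

definition loads :: "('v, 'e, 'i, 'z) net_scheme \<Rightarrow> real \<Rightarrow> ('e list \<times> 'i \<Rightarrow> real \<Rightarrow> real)
                      \<Rightarrow> ('e \<Rightarrow> real \<Rightarrow> real) \<Rightarrow> bool" where
  "loads N tf h g \<longleftrightarrow>
     (\<forall>e. \<forall>t\<in>{0..tf}.
        ((\<lambda>wi. \<Sum>j\<in>{j. j < length (fst wi) \<and> fst wi ! j = e}.
             (LINT s:{s \<in> {0..tf}. 0 \<le> arr (exitT N tf g) (fst wi) j s \<and>
                                    arr (exitT N tf g) (fst wi) j s \<le> t}|lborel. h wi s))
          has_sum (LINT s:{0..t}|lborel. g e s)) (walks N))"

definition edge_flow :: "real \<Rightarrow> real \<Rightarrow> ('e \<Rightarrow> real \<Rightarrow> real) \<Rightarrow> bool" where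
  "edge_flow tf tf' g \<longleftrightarrow>
     (\<forall>e. set_integrable lborel {0..tf} (g e) \<and> (\<forall>t\<in>{0..tf}. 0 \<le> g e t) \<and>
          (AE t in lborel. t \<in> {0..tf} - {0..tf'} \<longrightarrow> g e t = 0))"

definition induces :: "('v, 'e, 'i, 'z) net_scheme \<Rightarrow> real \<Rightarrow> real \<Rightarrow> ('e list \<times> 'i \<Rightarrow> real \<Rightarrow> real)
                        \<Rightarrow> ('e \<Rightarrow> real \<Rightarrow> real) \<Rightarrow> bool" where
  "induces N tf tf' h g \<longleftrightarrow> loads N tf h g \<and> edge_flow tf tf' g \<and>
     (\<forall>e. vickrey_ok tf (tau N e) (cap N e) (g e) (trav N tf g e))"

definition walk_flow :: "('v, 'e, 'i, 'z) net_scheme \<Rightarrow> real \<Rightarrow> ('e list \<times> 'i \<Rightarrow> real \<Rightarrow> real) \<Rightarrow> bool" where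
  "walk_flow N tf h \<longleftrightarrow>
     (\<forall>wi\<in>walks N. set_integrable lborel {0..tf} (h wi) \<and> (\<forall>t\<in>{0..tf}. 0 \<le> h wi t)) \<and>
     (\<forall>i. AE t in lborel. t \<in> {0..tf} \<longrightarrow> ((\<lambda>wi. h wi t) has_sum rate N i t) (walks_of N i))"

definition Lambda :: "('v, 'e, 'i, 'z) net_scheme \<Rightarrow> real \<Rightarrow> real \<Rightarrow> ('e list \<times> 'i \<Rightarrow> real \<Rightarrow> real) set" where
  "Lambda N tf tf' = {h. walk_flow N tf h \<and> (\<exists>g. induces N tf tf' h g)}"

definition induced_flows :: "('v, 'e, 'i, 'z) net_scheme \<Rightarrow> real \<Rightarrow> real \<Rightarrow> ('e \<Rightarrow> real \<Rightarrow> real) set" where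
  "induced_flows N tf tf' = {g. \<exists>h\<in>Lambda N tf tf'. induces N tf tf' h g}"

definition Psi :: "('v, 'e, 'i, 'z) net_scheme \<Rightarrow> real \<Rightarrow> ('e \<Rightarrow> real \<Rightarrow> real) \<Rightarrow> 'e list \<times> 'i \<Rightarrow> real \<Rightarrow> real" where
  "Psi N tf g wi t = vot N (snd wi) * (arr (exitT N tf g) (fst wi) (length (fst wi)) t - t)"

definition Ptoll :: "('v, 'e, 'i, 'z) net_scheme \<Rightarrow> real \<Rightarrow> ('e \<Rightarrow> real \<Rightarrow> real) \<Rightarrow> ('e \<Rightarrow> real \<Rightarrow> real)
                       \<Rightarrow> 'e list \<times> 'i \<Rightarrow> real \<Rightarrow> real" where
  "Ptoll N tf g p wi t = (\<Sum>j<length (fst wi). p (fst wi ! j) (arr (exitT N tf g) (fst wi) j t))"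

definition is_DUE :: "('v, 'e, 'i, 'z) net_scheme \<Rightarrow> real \<Rightarrow> ('e \<Rightarrow> real \<Rightarrow> real)
                       \<Rightarrow> ('e list \<times> 'i \<Rightarrow> real \<Rightarrow> real) \<Rightarrow> ('e \<Rightarrow> real \<Rightarrow> real) \<Rightarrow> bool" where
  "is_DUE N tf p h g \<longleftrightarrow>
     (\<forall>i. \<forall>wi\<in>walks_of N i. AE t in lborel. t \<in> {0..tf} \<and> h wi t > 0 \<longrightarrow>
        (\<forall>wi'\<in>walks_of N i. Psi N tf g wi t + Ptoll N tf g p wi t \<le> Psi N tf g wi' t + Ptoll N tf g p wi' t))"

definition is_toll :: "real \<Rightarrow> ('e \<Rightarrow> real \<Rightarrow> real) \<Rightarrow> bool" where
  "is_toll tf p \<longleftrightarrow> (\<forall>e t. (t \<in> {0..tf} \<longrightarrow> 0 \<le> p e t) \<and> (t \<notin> {0..tf} \<longrightarrow> p e t = 0))"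

definition implementable :: "('v, 'e::finite, 'i, 'z) net_scheme \<Rightarrow> real \<Rightarrow> real \<Rightarrow> ('e \<Rightarrow> real \<Rightarrow> real) \<Rightarrow> bool" where
  "implementable N tf tf' g \<longleftrightarrow>
     (\<exists>p h. is_toll tf p \<and> h \<in> Lambda N tf tf' \<and> induces N tf tf' h g \<and> is_DUE N tf p h g \<and>
        (\<Sum>e\<in>UNIV. \<integral>\<^sup>+ t. ennreal (indicator {0..tf} t * p e t * g e t) \<partial>lborel) < \<infinity>)"

definition total_travel_time :: "('v, 'e::finite, 'i, 'z) net_scheme \<Rightarrow> real \<Rightarrow> ('e \<Rightarrow> real \<Rightarrow> real) \<Rightarrow> real" where
  "total_travel_time N tf g = (\<Sum>e\<in>UNIV. LINT t:{0..tf}|lborel. trav N tf g e t * g e t)"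

definition system_optimal :: "('v, 'e::finite, 'i, 'z) net_scheme \<Rightarrow> real \<Rightarrow> real \<Rightarrow> ('e \<Rightarrow> real \<Rightarrow> real) \<Rightarrow> bool" where
  "system_optimal N tf tf' g \<longleftrightarrow> g \<in> induced_flows N tf tf' \<and>
     (\<forall>g'\<in>induced_flows N tf tf'. total_travel_time N tf g \<le> total_travel_time N tf g')"

datatype node = Na | Nb | Nc | Nx | Ny | Nz | Nq
datatype edge = E1 | E2 | E3 | E4 | E5 | E6 | E7
datatype com = K1 | K2 | K3 | K4 | K5

lemma UNIV_edge: "(UNIV :: edge set) = {E1, E2, E3, E4, E5, E6, E7}"
  using edge.exhaust by auto

instance edge :: finite
  by standard (simp add: UNIV_edge)

fun ex_tail :: "edge \<Rightarrow> node" where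
  "ex_tail E1 = Na" | "ex_tail E2 = Nb" | "ex_tail E3 = Nc" | "ex_tail E4 = Nq"
| "ex_tail E5 = Nz" | "ex_tail E6 = Nb" | "ex_tail E7 = Ny"

fun ex_head :: "edge \<Rightarrow> node" where
  "ex_head E1 = Nb" | "ex_head E2 = Nc" | "ex_head E3 = Nx" | "ex_head E4 = Nb"
| "ex_head E5 = Nq" | "ex_head E6 = Nz" | "ex_head E7 = Nz"

fun ex_tau :: "real \<Rightarrow> edge \<Rightarrow> real" where
  "ex_tau \<epsilon> E1 = 1" | "ex_tau \<epsilon> E2 = 1" | "ex_tau \<epsilon> E3 = \<epsilon>" | "ex_tau \<epsilon> E4 = \<epsilon>"
| "ex_tau \<epsilon> E5 = 2 - \<epsilon>" | "ex_tau \<epsilon> E6 = 4" | "ex_tau \<epsilon> E7 = 1"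

fun ex_cap :: "edge \<Rightarrow> ereal" where
  "ex_cap E1 = 1" | "ex_cap E2 = 1" | "ex_cap E3 = 1" | "ex_cap E4 = 2"
| "ex_cap E5 = 2" | "ex_cap E6 = \<infinity>" | "ex_cap E7 = 6"

fun ex_src :: "com \<Rightarrow> node" where
  "ex_src K1 = Ny" | "ex_src K2 = Nz" | "ex_src K3 = Nc" | "ex_src K4 = Na" | "ex_src K5 = Nq"

fun ex_dst :: "com \<Rightarrow> node" where
  "ex_dst K1 = Nz" | "ex_dst K2 = Nc" | "ex_dst K3 = Nx" | "ex_dst K4 = Nx" | "ex_dst K5 = Nb"

fun ex_rate :: "real \<Rightarrow> com \<Rightarrow> real \<Rightarrow> real" where
  "ex_rate M K1 t = 6 * indicator {0..1} t"
| "ex_rate M K2 t = 2 * indicator {2..3} t"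
| "ex_rate M K3 t = indicator {7..10 + M} t"
| "ex_rate M K4 t = indicator {4..5} t"
| "ex_rate M K5 t = 2 * indicator {9..13 + M} t"

definition ex_net :: "real \<Rightarrow> real \<Rightarrow> (node, edge, com) net" where
  "ex_net \<epsilon> M = \<lparr> etail = ex_tail, ehead = ex_head, tau = ex_tau \<epsilon>, cap = ex_cap,
                    src = ex_src, dst = ex_dst, rate = ex_rate M, vot = (\<lambda>_. 1) \<rparr>"

end

theory Submission
  imports Defs
begin

text \<open>
  Tolls cannot make \<open>K1\<close> take a detour: \<open>[E7]\<close> is a prefix of each of its walks and tolls are
  nonnegative. A detour of \<open>K1\<close> is nevertheless what the system needs: sent once around
  \<open>E5, E4, E6\<close>, it builds up a queue on \<open>E5\<close> that delays \<open>K2\<close> by two time units, so that \<open>K4\<close> passes \<open>E2\<close>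
  ahead of \<open>K2\<close> and has entered \<open>E3\<close> before \<open>K3\<close> starts. This costs \<open>3 \<epsilon> M\<close> plus a constant.

  Without the detour, \<open>K2\<close> is at \<open>b\<close> during \<open>[4, 5]\<close>. Let \<open>l\<close> be the amount of \<open>K2\<close> and \<open>K4\<close> that does not take
  the direct walk. It has to enter \<open>E4\<close> after \<open>K5\<close> has started to fill this edge to capacity, which leaves a
  queue of at least \<open>l\<close> on \<open>E4\<close> until \<open>K5\<close> ends. The remaining part of \<open>K2\<close> delays the remaining part of \<open>K4\<close>
  on \<open>E2\<close>, so that at least \<open>1 - 2 l\<close> of \<open>K4\<close> enters \<open>E3\<close> after \<open>K3\<close> has started to fill that edge, which
  leaves a queue of at least \<open>1 - 2 l\<close> until \<open>K3\<close> ends. Either way the cost exceeds \<open>3 \<epsilon> M\<close> by about \<open>M / 2\<close>.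
\<close>

section \<open>A single Vickrey edge\<close>

text \<open>The model demands less than it seems to. Travel times are not assumed measurable, and
  the capacity bounds only the derivative of the cumulative outflow, almost everywhere; for a
  monotone function this bounds no increment, since jumps or a singular part remain possible. So a
  null set of exit times must be shown to carry no flow. Only then follow the FIFO order and the
  usual formula for the queue. The formula serves twice: as a lower bound for queues of an unknown
  flow, and for uniqueness, because \<open>trav\<close> is a definite description and says nothing
  about the comparison flow until its travel times are known to be the only solution. An unknown
  flow may use infinitely many walks with loops, hence its treatment as a measure on single
  particles. Upper bounds on its arrival times are very crude: what matters has arrived by time
  \<open>2000\<close>, and all cost before that time is given away, a loss that does not grow with
  \<open>M\<close>. The comparison flow need only be cheaper, not optimal.\<close>

lemma right_open_borel:
  fixes B :: "real set"
  assumes "\<And>x. x \<in> B \<Longrightarrow> \<exists>d>0. {x..<x+d} \<subseteq> B"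
  shows "B \<in> sets borel"
proof -
  obtain d where d: "\<And>x. x \<in> B \<Longrightarrow> 0 < d x" "\<And>x. x \<in> B \<Longrightarrow> {x..<x + d x} \<subseteq> B"
    using assms by metis
  let ?V = "interior B"
  have sub: "{x<..<x + d x} \<subseteq> ?V" if "x \<in> B" for x
    using d(2)[OF that] by (intro interior_maximal) auto
  have "\<exists>r::rat. x < of_rat r \<and> of_rat r < x + d x" if "x \<in> B" for x
    using of_rat_dense[of x "x + d x"] d(1)[OF that] by auto
  then obtain r :: "real \<Rightarrow> rat" where r: "\<And>x. x \<in> B \<Longrightarrow> x < of_rat (r x) \<and> of_rat (r x) < x + d x"
    by metis
  \<comment> \<open>Outside the interior, the rational chosen right of a point determines that
    point: such a \<open>y\<close> beyond \<open>x\<close> lies beyond the whole right neighbourhood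
    of \<open>x\<close>. So only countably many points are not interior.\<close>
  have less: "r x \<noteq> r y" if "x \<in> B" "y \<in> B - ?V" "x < y" for x y
  proof -
    have "y \<notin> {x<..<x + d x}" using sub[OF that(1)] that(2) by blast
    then have "x + d x \<le> y" using that by auto
    then show ?thesis using r[of x] r[of y] that by force
  qed
  have "inj_on r (B - ?V)"
  proof (rule inj_onI)
    fix x y assume "x \<in> B - ?V" "y \<in> B - ?V" "r x = r y"
    then show "x = y" using less[of x y] less[of y x] by (cases x y rule: linorder_cases) auto
  qed
  then have "countable (B - ?V)"
    by (metis countableI' countable_image_inj_on countableI_type)
  then have "B - ?V \<in> sets borel" by (simp add: sets.countable)
  moreover have "?V \<in> sets borel" by simp
  moreover have "B = (B - ?V) \<union> ?V" using interior_subset by blast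
  ultimately show ?thesis by (metis sets.Un)
qed

locale vickrey_edge =
  fixes tf tau nu :: real and g D :: "real \<Rightarrow> real"
  assumes tau: "0 \<le> tau" and nu: "0 < nu"
    and g_int: "set_integrable lborel {0..tf} g"
    and g_nonneg: "\<And>t. t \<in> {0..tf} \<Longrightarrow> 0 \<le> g t"
    and ok: "vickrey_ok tf tau (ereal nu) g D"
begin

definition G :: "real \<Rightarrow> real" where "G t = (LINT s:{0..t}|lborel. g s)"
definition q :: "real \<Rightarrow> real" where "q t = queue tf tau g D t"
definition F :: "real \<Rightarrow> real" where "F t = outcum tf g D t"
text \<open>Extension by zero, so that the inflow becomes a finite Borel measure
  \<open>\<mu>\<close> on the whole line and outflow estimates become inclusions of sets.\<close>

definition gbar :: "real \<Rightarrow> real" where "gbar s = indicator {0..tf} s * g s"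
definition \<mu> :: "real measure" where "\<mu> = density lborel (\<lambda>s. ennreal (gbar s))"

lemma gbar_integrable: "integrable lborel gbar"
  using g_int by (simp add: gbar_def[abs_def] set_integrable_def)

lemma gbar_measurable [measurable]: "gbar \<in> borel_measurable borel"
  using borel_measurable_integrable[OF gbar_integrable] by simp

lemma gbar_nonneg: "0 \<le> gbar s"
  using g_nonneg by (auto simp: gbar_def indicator_def)

lemma sets_\<mu> [simp, measurable_cong]: "sets \<mu> = sets borel" by (simp add: \<mu>_def)
lemma space_\<mu> [simp]: "space \<mu> = UNIV" by (simp add: \<mu>_def)

lemma emeasure_\<mu>:
  assumes [measurable]: "A \<in> sets borel"
  shows "emeasure \<mu> A = ennreal (LINT s|lborel. indicator A s * gbar s)"
proof -
  have "integrable lborel (\<lambda>s. indicator A s * gbar s)"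
    by (rule Bochner_Integration.integrable_bound[OF gbar_integrable])
      (auto simp: indicator_def)
  then have "(\<integral>\<^sup>+ s. ennreal (indicator A s * gbar s) \<partial>lborel) = ennreal (LINT s|lborel. indicator A s * gbar s)"
    by (intro nn_integral_eq_integral) (auto simp: gbar_nonneg)
  moreover have "(\<lambda>s. ennreal (indicator A s * gbar s)) = (\<lambda>s. ennreal (gbar s) * indicator A s)"
    by (auto simp: indicator_def)
  ultimately show ?thesis
    by (simp add: \<mu>_def emeasure_density)
qed

lemma measure_\<mu>:
  assumes [measurable]: "A \<in> sets borel"
  shows "measure \<mu> A = (LINT s|lborel. indicator A s * gbar s)"
  unfolding measure_def emeasure_\<mu>[OF assms]
  by (simp add: gbar_nonneg integral_nonneg_AE)

sublocale fin: finite_measure \<mu>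
  by (rule finite_measureI) (simp add: emeasure_\<mu>)

lemma G_measure: "t \<le> tf \<Longrightarrow> G t = measure \<mu> {..t}"
  by (auto simp: G_def measure_\<mu> set_lebesgue_integral_def gbar_def indicator_def intro!: Bochner_Integration.integral_cong)

lemma D_ge_tau: "D t \<ge> tau"
  using ok nu by (cases "t \<in> {0..tf}") (auto simp: vickrey_ok_def)

lemma D_eq: "t \<in> {0..tf} \<Longrightarrow> D t = tau + q t / nu"
  using ok by (auto simp: vickrey_ok_def q_def)

lemma D_out: "t \<notin> {0..tf} \<Longrightarrow> D t = tau"
  using ok by (auto simp: vickrey_ok_def)

lemma q_nonneg: "t \<in> {0..tf} \<Longrightarrow> 0 \<le> q t"
  using ok by (auto simp: vickrey_ok_def q_def)

lemma q_eq: "q t = G t - F (t + tau)"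
  by (simp add: q_def queue_def G_def F_def outcum_def)

text \<open>With \<open>gbar s \<noteq> 0\<close> in the indicator the set is the support of the
  integrand, so the integrand is measurable only if the set is.\<close>

lemma F_indicator: "F t = (LINT s|lborel. indicator {s. s + D s \<le> t \<and> gbar s \<noteq> 0} s * gbar s)"
  using D_ge_tau tau
  by (auto simp: F_def outcum_def set_lebesgue_integral_def gbar_def indicator_def intro!: Bochner_Integration.integral_cong)
     (smt (verit, best))

text \<open>The exit time is not assumed measurable, and a nonmeasurable sublevel set would silently make
  the outflow integral \<open>0\<close>. The set of levels where this happens is right-open, hence Borel, and on
  it the outflow vanishes; off it the outflow is monotone. So the outflow is Borel in any case,
  and with it the exit time.\<close>

lemma F_measurable: "F \<in> borel_measurable borel"
proof -
  define S where "S t = {s. s + D s \<le> t \<and> gbar s \<noteq> 0}" for t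
  define B where "B = {t. S t \<notin> sets borel}"
  have F0: "F t = 0" if "t \<in> B" for t
  proof -
    have "\<not> integrable lborel (\<lambda>s. indicator (S t) s * gbar s)"
    proof
      assume "integrable lborel (\<lambda>s. indicator (S t) s * gbar s)"
      then have [measurable]: "(\<lambda>s. indicator (S t) s * gbar s) \<in> borel_measurable borel"
        using borel_measurable_integrable by force
      have "{s\<in>space borel. indicator (S t) s * gbar s \<noteq> 0} \<in> sets borel" by measurable
      also have "{s\<in>space borel. indicator (S t) s * gbar s \<noteq> 0} = S t"
        by (auto simp: indicator_def S_def)
      finally show False using that by (simp add: B_def)
    qed
    then show ?thesis by (simp add: F_indicator not_integrable_integral_eq S_def)
  qed
  have B_borel: "B \<in> sets borel"
  proof (rule right_open_borel, rule ccontr)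
    fix x assume x: "x \<in> B" and neg: "\<not> (\<exists>d>0. {x..<x + d} \<subseteq> B)"
    \<comment> \<open>Measurable levels tending to \<open>x\<close> from the right would make the
      sublevel set at \<open>x\<close> a countable intersection of measurable sets.\<close>
    have "\<exists>y. x \<le> y \<and> y < x + 1 / Suc n \<and> S y \<in> sets borel" for n
    proof -
      have "\<not> {x..<x + 1 / Suc n} \<subseteq> B" using neg by (auto simp del: of_nat_Suc)
      then show ?thesis by (auto simp: B_def)
    qed
    then obtain y where y: "\<And>n. x \<le> y n" "\<And>n. y n < x + 1 / Suc n" "\<And>n. S (y n) \<in> sets borel"
      by metis
    have "S x = (\<Inter>n. S (y n))"
    proof (intro equalityI subsetI)
      fix s assume "s \<in> (\<Inter>n. S (y n))"
      then have s: "s + D s \<le> y n" "gbar s \<noteq> 0" for n by (auto simp: S_def)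
      have "s + D s \<le> x"
      proof (rule field_le_epsilon)
        fix e :: real assume "e > 0"
        then obtain n where "1 / Suc n < e"
          using reals_Archimedean[of e] by (auto simp: divide_inverse)
        then show "s + D s \<le> x + e" using s(1)[of n] y(2)[of n] by linarith
      qed
      then show "s \<in> S x" using s by (simp add: S_def)
    qed (use y(1) in \<open>auto simp: S_def intro: order_trans\<close>)
    also have "\<dots> \<in> sets borel" using y(3) by auto
    finally show False using x by (simp add: B_def)
  qed
  have "mono_on (-B) F"
  proof (rule mono_onI)
    fix x y assume xy: "x \<in> -B" "y \<in> -B" "x \<le> y"
    then have [measurable]: "S x \<in> sets borel" "S y \<in> sets borel" by (auto simp: B_def)
    have "integrable lborel (\<lambda>s. indicator (S x) s * gbar s)" "integrable lborel (\<lambda>s. indicator (S y) s * gbar s)"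
      by (auto intro!: Bochner_Integration.integrable_bound[OF gbar_integrable] simp: indicator_def)
    then show "F x \<le> F y"
      unfolding F_indicator S_def[symmetric]
      by (intro integral_mono) (use xy in \<open>auto simp: S_def indicator_def gbar_nonneg\<close>)
  qed
  then have "F \<in> borel_measurable (restrict_space borel (-B))"
    by (rule borel_measurable_mono_on_fnc)
  moreover have "F \<in> borel_measurable (restrict_space borel B)"
  proof -
    have "(\<lambda>x. 0::real) \<in> borel_measurable (restrict_space borel B)" by simp
    then show ?thesis
      using F0 by (subst measurable_cong[where g="\<lambda>_. 0"]) (auto simp: space_restrict_space)
  qed
  ultimately have "F \<in> borel_measurable (restrict_space borel \<Omega>)" if "\<Omega> \<in> {B, -B}" for \<Omega>
    using that by blast
  then show ?thesis
    by (rule measurable_piecewise_restrict[of "{B, -B}", rotated 3]) (use B_borel in auto)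
qed

lemma G_mono: "\<lbrakk>s \<le> t; t \<le> tf\<rbrakk> \<Longrightarrow> G s \<le> G t"
  by (simp add: G_measure fin.finite_measure_mono)

lemma D_measurable [measurable]: "D \<in> borel_measurable borel"
proof -
  note F_measurable [measurable]
  have "mono (\<lambda>t. measure \<mu> {..t})" by (auto simp: mono_def intro!: fin.finite_measure_mono)
  then have [measurable]: "(\<lambda>t. measure \<mu> {..t}) \<in> borel_measurable borel"
    by (rule borel_measurable_mono)
  have "D = (\<lambda>t. if t \<in> {0..tf} then tau + (measure \<mu> {..t} - F (t + tau)) / nu else tau)"
    using D_eq D_out by (auto simp: q_eq G_measure)
  also have "\<dots> \<in> borel_measurable borel" by measurable
  finally show ?thesis .
qed

lemma F_measure: "F t = measure \<mu> {s. s + D s \<le> t}"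
proof -
  have [measurable]: "{s. s + D s \<le> t} \<in> sets borel"
  proof -
    have "{s\<in>space borel. s + D s \<le> t} \<in> sets borel" by measurable
    then show ?thesis by simp
  qed
  show ?thesis
    by (auto simp: F_indicator measure_\<mu> indicator_def intro!: Bochner_Integration.integral_cong)
qed

lemma F_diff: "a \<le> b \<Longrightarrow> F b - F a = measure \<mu> {s. a < s + D s \<and> s + D s \<le> b}"
proof -
  assume ab: "a \<le> b"
  have [measurable]: "{s. s + D s \<le> t} \<in> sets borel" for t
  proof -
    have "{s\<in>space borel. s + D s \<le> t} \<in> sets borel" by measurable
    then show ?thesis by simp
  qed
  have "{s. a < s + D s \<and> s + D s \<le> b} = {s. s + D s \<le> b} - {s. s + D s \<le> a}" by auto
  then show ?thesis using ab
    by (simp add: F_measure fin.finite_measure_Diff Collect_mono_iff)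
qed

lemma F_mono: "a \<le> b \<Longrightarrow> F a \<le> F b"
  using F_diff[of a b] by (smt (verit) measure_nonneg)

end

section \<open>From the almost everywhere derivative bound to a capacity bound on every
  interval\<close>

lemma DERIV_increment_bound:
  fixes f :: "real \<Rightarrow> real"
  assumes "(f has_real_derivative d) (at x)" "e > 0"
  obtains r where "r > 0" "\<And>y. \<bar>y - x\<bar> < r \<Longrightarrow> \<bar>f y - f x - d * (y - x)\<bar> \<le> e * \<bar>y - x\<bar>"
  using assms unfolding has_field_derivative_def has_derivative_at_alt by fastforce

text \<open>On each cell of length \<open>r\<close> the inverse of \<open>T\<close> is Lipschitz
  with constant \<open>1 / c\<close>, and Lipschitz maps preserve null sets; countably many cells
  cover \<open>S\<close>.\<close>

lemma negligible_if_expanding: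
  fixes T :: "real \<Rightarrow> real"
  assumes "negligible N" and "T ` S \<subseteq> N" and "c > 0" and "r > 0"
    and exp: "\<And>s t. \<lbrakk>s \<in> S; t \<in> S; s < t; t < s + r\<rbrakk> \<Longrightarrow> c * (t - s) \<le> T t - T s"
  shows "negligible S"
proof -
  define V where "V k = S \<inter> {of_int k * r..<of_int (k + 1) * r}" for k :: int
  have V: "negligible (V k)" for k
  proof -
    have e: "c * \<bar>t - s\<bar> \<le> \<bar>T t - T s\<bar>" if "s \<in> V k" "t \<in> V k" for s t
    proof (cases s t rule: linorder_cases)
      case less
      with exp[of s t] that \<open>r > 0\<close> show ?thesis
        by (force simp: V_def algebra_simps)
    next
      case greater
      with exp[of t s] that \<open>r > 0\<close> show ?thesis
        by (force simp: V_def algebra_simps)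
    qed auto
    have inj: "inj_on T (V k)"
      using e \<open>c > 0\<close> by (intro inj_onI) (smt (verit, best) zero_less_mult_iff)
    have "negligible (T ` V k)"
      using assms(1,2) by (elim negligible_subset) (auto simp: V_def)
    then have "negligible (inv_into (V k) T ` (T ` V k))"
    proof (rule negligible_locally_Lipschitz_image[rotated])
      fix x assume x: "x \<in> T ` V k"
      have "norm (inv_into (V k) T y - inv_into (V k) T x) \<le> inverse c * norm (y - x)" if y: "y \<in> T ` V k" for y
        using x y e \<open>c > 0\<close> by (auto simp: inv_into_f_f[OF inj] field_simps)
      then show "\<exists>U B. open U \<and> x \<in> U \<and>
          (\<forall>y\<in>T ` V k \<inter> U. norm (inv_into (V k) T y - inv_into (V k) T x) \<le> B * norm (y - x))"
        by (intro exI[of _ UNIV] exI[of _ "inverse c"]) auto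
    qed simp
    then show ?thesis using inj by (simp add: inv_into_image_cancel)
  qed
  have "S \<subseteq> (\<Union>k. V k)"
  proof
    fix s assume "s \<in> S"
    moreover have "of_int \<lfloor>s / r\<rfloor> * r \<le> s"
      using floor_correct[of "s / r"] by (simp only: pos_le_divide_eq[OF \<open>r > 0\<close>, symmetric])
    moreover have "s < of_int (\<lfloor>s / r\<rfloor> + 1) * r"
      using floor_correct[of "s / r"] by (simp only: pos_divide_less_eq[OF \<open>r > 0\<close>, symmetric])
    ultimately show "s \<in> (\<Union>k. V k)" by (auto simp: V_def intro!: exI[of _ "\<lfloor>s / r\<rfloor>"])
  qed
  moreover have "negligible (\<Union>k. V k)"
  proof -
    have "countable (range V)" by simp
    then show ?thesis using V by (metis negligible_countable_Union rangeE)
  qed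
  ultimately show ?thesis using negligible_subset by blast
qed

context vickrey_edge
begin

lemma gbar_hk: "gbar integrable_on {a..b}"
  by (metis gbar_integrable integrable_on_lborel integrable_on_subinterval subset_UNIV)

lemma G_integral: "t \<le> tf \<Longrightarrow> G t = integral {0..t} gbar"
proof -
  assume "t \<le> tf"
  then have "G t = (LINT s:{0..t}|lborel. gbar s)"
    by (auto simp: G_def set_lebesgue_integral_def gbar_def indicator_def intro!: Bochner_Integration.integral_cong)
  also have "\<dots> = integral {0..t} gbar"
  proof (rule set_borel_integral_eq_integral)
    show "set_integrable lborel {0..t} gbar"
      unfolding set_integrable_def
      by (rule Bochner_Integration.integrable_bound[OF gbar_integrable]) (auto simp: indicator_def)
  qed
  finally show ?thesis .
qed

lemma G_continuous: "continuous_on {0..tf} G"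
proof -
  have "continuous_on {0..tf} (\<lambda>t. integral {0..t} gbar)"
    using gbar_hk by (rule indefinite_integral_continuous_1)
  then show ?thesis by (rule continuous_on_eq) (simp add: G_integral)
qed

lemma exit_times: "t \<in> {0..tf} \<Longrightarrow> nu * (t + D t) = nu * (t + tau) + G t - F (t + tau)"
  using nu by (simp add: D_eq q_eq field_simps)

lemma sets_exit [measurable]: "A \<in> sets borel \<Longrightarrow> {s. s + D s \<in> A} \<in> sets borel"
proof -
  assume [measurable]: "A \<in> sets borel"
  have "{s\<in>space borel. s + D s \<in> A} \<in> sets borel" by measurable
  then show ?thesis by simp
qed

text \<open>Almost everywhere the exit time has a positive lower right derivative where the inflow is positive,
  so it cannot squeeze positive inflow into a null set of exit times.\<close>

lemma exit_null:
  assumes N: "N \<in> sets borel" "negligible N" "N \<subseteq> {..tf}"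
  shows "measure \<mu> {s. s + D s \<in> N} = 0"
proof -
  define S where "S = {s. s + D s \<in> N} \<inter> {s. gbar s > 0}"
  have S_borel: "S \<in> sets borel"
  proof -
    have "{s\<in>space borel. gbar s > 0} \<in> sets borel" by measurable
    then show ?thesis using sets_exit[OF N(1)] by (auto simp: S_def)
  qed
  obtain N2 where N2: "negligible N2"
    "\<And>x e. \<lbrakk>x \<notin> N2; 0 < e\<rbrakk> \<Longrightarrow> \<exists>d>0. \<forall>h. 0 < h \<and> h < d \<longrightarrow> norm (integral {x..x+h} gbar / h - gbar x) < e"
  proof -
    have "\<And>a b. gbar integrable_on cbox a b" using gbar_hk by simp
    from integrable_ccontinuous_explicit[OF this] show ?thesis
      using that by (auto simp: divide_inverse mult.commute)
  qed
  have "AE t in lborel. t \<in> {0..tf} \<longrightarrow> (\<exists>d. (F has_real_derivative d) (at t) \<and> d \<le> nu)"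
  proof -
    have "F = outcum tf g D" by (auto simp: F_def)
    then show ?thesis using ok by (simp add: vickrey_ok_def)
  qed
  then obtain N1 where N1: "N1 \<in> null_sets lborel"
      "{t. \<not> (t \<in> {0..tf} \<longrightarrow> (\<exists>d. (F has_real_derivative d) (at t) \<and> d \<le> nu))} \<subseteq> N1"
    by (auto elim!: AE_E simp: null_sets_def)
  have N1': "negligible ((\<lambda>x. x - tau) ` N1)"
  proof -
    have "negligible N1" using N1(1) by (simp add: negligible_iff_null_sets null_sets_completionI)
    then show ?thesis using negligible_translation[of N1 "- tau"] by simp
  qed
  \<comment> \<open>Countably many pieces on which the exit time expands with a uniform constant and
    range. Lebesgue differentiation fails only on \<open>N2\<close>, the outflow derivative bound
    only on \<open>N1\<close>; all other points of \<open>S\<close> below \<open>tf\<close> belong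
    to some piece.\<close>
  define S' where "S' n = {s\<in>S. \<forall>t. s < t \<and> t < s + 1 / Suc n \<longrightarrow> 1 / Suc n * (t - s) \<le> (t + D t) - (s + D s)}" for n
  have "negligible (S' n)" for n
    by (rule negligible_if_expanding[OF N(2), where T="\<lambda>s. s + D s" and c="1 / Suc n" and r="1 / Suc n"])
      (auto simp: S'_def S_def simp del: of_nat_Suc)
  then have US': "negligible (\<Union>n. S' n)" by (rule negligible_Union_nat)
  have "S \<subseteq> N2 \<union> (\<lambda>x. x - tau) ` N1 \<union> {tf} \<union> (\<Union>n. S' n)"
  proof
    fix s assume s: "s \<in> S"
    show "s \<in> N2 \<union> (\<lambda>x. x - tau) ` N1 \<union> {tf} \<union> (\<Union>n. S' n)"
    proof (rule ccontr)
      assume neg: "\<not> ?thesis"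
      have "gbar s > 0" using s by (simp add: S_def)
      then have st: "s \<in> {0..tf}" by (cases "s \<in> {0..tf}") (auto simp: gbar_def)
      then have st': "0 \<le> s" "s < tf" using neg by auto
      \<comment> \<open>The derivative bound is available only within the horizon; this is why
        \<open>N\<close> must lie below \<open>tf\<close>.\<close>
      have "s + tau \<le> tf" using s N(3) D_ge_tau[of s] by (auto simp: S_def)
      moreover have "s + tau \<notin> N1" using neg by force
      moreover have "s + tau \<in> {0..tf} \<longrightarrow> s + tau \<notin> N1 \<longrightarrow> (\<exists>d. (F has_real_derivative d) (at (s + tau)) \<and> d \<le> nu)"
        using N1(2) by blast
      ultimately obtain d where d: "(F has_real_derivative d) (at (s + tau))" "d \<le> nu"
        using st' tau by auto
      \<comment> \<open>The error \<open>e\<close> is lost twice, in the inflow and in the outflow,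
        so that half of \<open>gbar s\<close> remains as a lower slope of \<open>nu\<close> times
        the exit time.\<close>
      define e where "e = gbar s / 4"
      have e: "e > 0" using \<open>gbar s > 0\<close> by (simp add: e_def)
      obtain r where r: "r > 0" "\<And>y. \<bar>y - (s + tau)\<bar> < r \<Longrightarrow> \<bar>F y - F (s + tau) - d * (y - (s + tau))\<bar> \<le> e * \<bar>y - (s + tau)\<bar>"
        using DERIV_increment_bound[OF d(1) e] by blast
      obtain r' where r': "r' > 0" "\<And>h. \<lbrakk>0 < h; h < r'\<rbrakk> \<Longrightarrow> norm (integral {s..s+h} gbar / h - gbar s) < e"
        using N2(2)[of s e] neg e by auto
      define m where "m = Min {r, r', tf - s, gbar s / (2 * nu)}"
      have "m > 0" using r r' st' \<open>gbar s > 0\<close> nu by (simp add: m_def)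
      then obtain n where n: "1 / Suc n < m"
        using reals_Archimedean[of m] by (auto simp: divide_inverse)
      have m: "m \<le> r" "m \<le> r'" "m \<le> tf - s" "m \<le> gbar s / (2 * nu)" by (simp_all add: m_def)
      have "1 / Suc n * (t - s) \<le> (t + D t) - (s + D s)" if t: "s < t" "t < s + 1 / Suc n" for t
      proof -
        define h where "h = t - s"
        have h: "0 < h" "h < m" using t n by (auto simp: h_def)
        have "G t - G s = integral {s..s+h} gbar"
        proof -
          have "integral {0..s} gbar + integral {s..t} gbar = integral {0..t} gbar"
            using st' t gbar_hk by (intro Henstock_Kurzweil_Integration.integral_combine) auto
          then show ?thesis using h m t st' by (simp add: G_integral h_def)
        qed
        moreover have "integral {s..s+h} gbar / h > gbar s - e"
          using r'(2)[of h] h m by (simp add: abs_if split: if_splits)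
        ultimately have G: "G t - G s \<ge> (gbar s - e) * h" using h by (simp add: field_simps)
        have "F (t + tau) - F (s + tau) \<le> (d + e) * h"
          using r(2)[of "t + tau"] h m by (auto simp: h_def algebra_simps abs_if split: if_splits)
        also have "\<dots> \<le> (nu + e) * h" using d h by (intro mult_right_mono) auto
        finally have Fb: "F (t + tau) - F (s + tau) \<le> (nu + e) * h" .
        have "nu * ((t + D t) - (s + D s)) = nu * h + (G t - G s) - (F (t + tau) - F (s + tau))"
          using exit_times[of t] exit_times[of s] h m st' by (simp add: h_def algebra_simps)
        also have "\<dots> \<ge> nu * h + (gbar s - e) * h - (nu + e) * h" using G Fb by linarith
        also have "nu * h + (gbar s - e) * h - (nu + e) * h = gbar s / 2 * h"
          by (simp add: e_def field_simps)
        finally have "gbar s / (2 * nu) * h \<le> (t + D t) - (s + D s)"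
          using nu by (simp add: field_simps)
        moreover have "1 / Suc n * h \<le> gbar s / (2 * nu) * h"
          using n m h by (intro mult_right_mono) auto
        ultimately show ?thesis by (simp add: h_def)
      qed
      then have "s \<in> S' n" using s by (auto simp: S'_def)
      then show False using neg by auto
    qed
  qed
  moreover have "negligible (N2 \<union> (\<lambda>x. x - tau) ` N1 \<union> {tf} \<union> (\<Union>n. S' n))"
    using N2(1) N1' US' by (intro negligible_Un) auto
  ultimately have "negligible S" by (rule negligible_subset[rotated])
  then have "S \<in> null_sets lborel"
    using S_borel by (metis negligible_iff_null_sets null_sets_completion_iff sets_lborel)
  then have "AE s in lborel. s \<notin> S" by (rule AE_not_in)
  then have "AE s in lborel. indicator {s. s + D s \<in> N} s * gbar s = 0"
    by eventually_elim (use gbar_nonneg in \<open>auto simp: S_def indicator_def less_le\<close>)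
  then have "(LINT s|lborel. indicator {s. s + D s \<in> N} s * gbar s) = 0"
    by (rule integral_eq_zero_AE)
  then show ?thesis using sets_exit[OF N(1)] by (simp add: measure_\<mu>)
qed

text \<open>A slope bound around the points of \<open>A\<close> controls the outflow at exit times
  in \<open>A\<close>, however \<open>F\<close> behaves elsewhere: an interval shorter than
  \<open>d\<close> that meets \<open>A\<close> is essentially one of the tested intervals, and a
  long interval is cut into short ones.\<close>

lemma exit_slope_bound:
  assumes "d > 0" "c \<ge> 0" "a \<le> b"
  defines "A \<equiv> {\<theta>. \<forall>x y. x < \<theta> \<and> \<theta> < y \<and> y - x < d \<longrightarrow> F y - F x \<le> c * (y - x)}"
  shows "A \<in> sets borel" and "measure \<mu> {s. s + D s \<in> A \<inter> {a<..b}} \<le> c * (b - a)"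
proof -
  have "- A = (\<Union>p\<in>{(x, y). y - x < d \<and> F y - F x > c * (y - x)}. {fst p<..<snd p})"
    by (fastforce simp: A_def not_le)
  then have "open (- A)" by (auto intro!: open_UN)
  then show A: "A \<in> sets borel" by (metis borel_open borel_comp double_complement)
  have short: "measure \<mu> {s. s + D s \<in> A \<inter> {a<..b}} \<le> c * (b - a)" if ab: "a \<le> b" "b - a < d" for a b
  proof (cases "A \<inter> {a<..b} = {}")
    case True
    then show ?thesis using ab \<open>c \<ge> 0\<close> by simp
  next
    case False
    then obtain th where th: "th \<in> A" "a < th" "th \<le> b" by auto
    have "F b - F a \<le> c * (b - a)"
    proof (rule ccontr)
      assume "\<not> ?thesis"
      then have pos: "F b - F a - c * (b - a) > 0" by simp
      \<comment> \<open>The point of \<open>A\<close> may be the endpoint \<open>b\<close>, but the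
        defining inequality wants it strictly inside; the interval is prolonged by an
        \<open>h\<close> too small to absorb the excess.\<close>
      define h where "h = min ((d - (b - a)) / 2) ((F b - F a - c * (b - a)) / (2 * (c + 1)))"
      have h: "0 < h" "h \<le> (d - (b - a)) / 2" "h \<le> (F b - F a - c * (b - a)) / (2 * (c + 1))"
        using pos ab \<open>c \<ge> 0\<close> unfolding h_def by (simp, simp only: min.cobounded1, simp only: min.cobounded2)
      have "F (b + h) - F a \<le> c * (b + h - a)"
        using th h ab by (auto simp: A_def)
      moreover have "F b \<le> F (b + h)" using h by (intro F_mono) auto
      moreover have "c * h \<le> (c + 1) * h" using h by simp
      moreover have "(c + 1) * h \<le> (F b - F a - c * (b - a)) / 2"
        using h(3) \<open>c \<ge> 0\<close> by (simp add: field_simps)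
      ultimately show False using pos by (simp add: algebra_simps)
    qed
    moreover have "measure \<mu> {s. s + D s \<in> A \<inter> {a<..b}} \<le> measure \<mu> {s. s + D s \<in> {a<..b}}"
      by (intro fin.finite_measure_mono) auto
    ultimately show ?thesis using F_diff[OF ab(1)] by simp
  qed
  have "measure \<mu> {s. s + D s \<in> A \<inter> {a<..b}} \<le> c * (b - a)" if "a \<le> b" "b - a < Suc k * d" for k a b
    using that
  proof (induction k arbitrary: a b)
    case 0
    then show ?case using short by simp
  next
    case (Suc k)
    define l where "l = (b - a) / Suc (Suc k)"
    have l: "0 \<le> l" "l < d" "b - a = Suc (Suc k) * l"
      using Suc.prems by (auto simp: l_def field_simps)
    have "{s. s + D s \<in> A \<inter> {a<..b}} \<subseteq> {s. s + D s \<in> A \<inter> {a<..b - l}} \<union> {s. s + D s \<in> A \<inter> {b - l<..b}}"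
      by auto
    then have "measure \<mu> {s. s + D s \<in> A \<inter> {a<..b}}
        \<le> measure \<mu> ({s. s + D s \<in> A \<inter> {a<..b - l}} \<union> {s. s + D s \<in> A \<inter> {b - l<..b}})"
      using A by (intro fin.finite_measure_mono) auto
    also have "\<dots> \<le> measure \<mu> {s. s + D s \<in> A \<inter> {a<..b - l}} + measure \<mu> {s. s + D s \<in> A \<inter> {b - l<..b}}"
      using A by (intro measure_Un_le) auto
    also have "measure \<mu> {s. s + D s \<in> A \<inter> {b - l<..b}} \<le> c * (b - (b - l))"
      using l by (intro short) auto
    also have "measure \<mu> {s. s + D s \<in> A \<inter> {a<..b - l}} \<le> c * (b - l - a)"
    proof (rule Suc.IH)
      have "b - l - a = Suc k * l" using l(3) by (simp add: algebra_simps)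
      moreover have "Suc k * l < Suc k * d" using l(2) by simp
      ultimately show "b - l - a < Suc k * d" "a \<le> b - l" using l(1)
        by (linarith, smt (verit) of_nat_0_le_iff zero_le_mult_iff)
    qed
    finally show ?case by (simp add: algebra_simps)
  qed
  moreover obtain k where "b - a < Suc k * d"
  proof -
    obtain k :: nat where "b - a < k * d" using reals_Archimedean3[OF \<open>d > 0\<close>] by blast
    also have "k * d \<le> Suc k * d" using \<open>d > 0\<close> by simp
    finally show ?thesis using that by blast
  qed
  ultimately show "measure \<mu> {s. s + D s \<in> A \<inter> {a<..b}} \<le> c * (b - a)"
    using \<open>a \<le> b\<close> by blast
qed

text \<open>Off a null set the derivative is at most \<open>nu\<close>, which puts the point into
  some \<open>A n\<close> with slope bound \<open>nu + e\<close>. The null set carries no outflow by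
  \<open>exit_null\<close>, and the increasing sets \<open>A n\<close> pass their bound on to their
  union.\<close>

lemma outflow_le_capacity:
  assumes "0 \<le> a" "a \<le> b" "b \<le> tf"
  shows "F b - F a \<le> nu * (b - a)"
proof -
  have *: "F b - F a \<le> (nu + e) * (b - a)" if e: "e > 0" for e
  proof -
    define A where "A n = {\<theta>. \<forall>x y. x < \<theta> \<and> \<theta> < y \<and> y - x < 1 / Suc n \<longrightarrow> F y - F x \<le> (nu + e) * (y - x)}" for n
    have slope: "A n \<in> sets borel" "measure \<mu> {s. s + D s \<in> A n \<inter> {a<..b}} \<le> (nu + e) * (b - a)" for n
      unfolding A_def using nu e assms by (intro exit_slope_bound; simp)+
    have A_borel [measurable]: "A n \<in> sets borel" for n
      by (rule slope(1))
    define N where "N = {a<..b} - (\<Union>n. A n)"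
    have N_borel: "N \<in> sets borel" by (auto simp: N_def)
    have "AE t in lborel. t \<in> {0..tf} \<longrightarrow> (\<exists>d. (F has_real_derivative d) (at t) \<and> d \<le> nu)"
    proof -
      have "F = outcum tf g D" by (auto simp: F_def)
      then show ?thesis using ok by (simp add: vickrey_ok_def)
    qed
    then have "AE t in lborel. t \<notin> N"
    proof eventually_elim
      case (elim t)
      show ?case
      proof
        assume t: "t \<in> N"
        then obtain d where d: "(F has_real_derivative d) (at t)" "d \<le> nu"
          using elim assms by (auto simp: N_def)
        obtain r where r: "r > 0" "\<And>y. \<bar>y - t\<bar> < r \<Longrightarrow> \<bar>F y - F t - d * (y - t)\<bar> \<le> e * \<bar>y - t\<bar>"
          using DERIV_increment_bound[OF d(1) e] by blast
        obtain n where n: "1 / Suc n < r"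
          using reals_Archimedean[of r] r by (auto simp: divide_inverse)
        have "t \<in> A n"
          unfolding A_def
        proof (intro CollectI allI impI)
          fix x y assume xy: "x < t \<and> t < y \<and> y - x < 1 / Suc n"
          have "F y - F x \<le> (d + e) * (y - x)"
            using r(2)[of y] r(2)[of x] xy n by (simp add: abs_if algebra_simps split: if_splits)
          also have "\<dots> \<le> (nu + e) * (y - x)" using d xy by (intro mult_right_mono) auto
          finally show "F y - F x \<le> (nu + e) * (y - x)" .
        qed
        then show False using t by (auto simp: N_def)
      qed
    qed
    then have "N \<in> null_sets lborel" using N_borel by (simp add: AE_iff_null_sets)
    then have "negligible N" by (simp add: negligible_iff_null_sets null_sets_completionI)
    then have N0: "measure \<mu> {s. s + D s \<in> N} = 0"
      using N_borel assms by (intro exit_null) (auto simp: N_def)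
    have "(\<lambda>n. measure \<mu> {s. s + D s \<in> A n \<inter> {a<..b}}) \<longlonglongrightarrow> measure \<mu> (\<Union>n. {s. s + D s \<in> A n \<inter> {a<..b}})"
    proof (rule fin.finite_Lim_measure_incseq)
      have "1 / real (Suc n) \<le> 1 / real (Suc m)" if "m \<le> n" for m n
        using that by (simp add: frac_le)
      then have "A m \<subseteq> A n" if "m \<le> n" for m n
        unfolding A_def using that by (smt (verit) Collect_mono)
      then show "incseq (\<lambda>n. {s. s + D s \<in> A n \<inter> {a<..b}})" by (fastforce simp: incseq_def)
    qed auto
    then have U: "measure \<mu> (\<Union>n. {s. s + D s \<in> A n \<inter> {a<..b}}) \<le> (nu + e) * (b - a)"
      by (rule LIMSEQ_le_const2) (use slope(2) in auto)
    have "F b - F a = measure \<mu> {s. s + D s \<in> {a<..b}}" using F_diff[OF assms(2)] by simp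
    also have "\<dots> \<le> measure \<mu> ((\<Union>n. {s. s + D s \<in> A n \<inter> {a<..b}}) \<union> {s. s + D s \<in> N})"
      using N_borel by (intro fin.finite_measure_mono) (auto simp: N_def)
    also have "\<dots> \<le> measure \<mu> (\<Union>n. {s. s + D s \<in> A n \<inter> {a<..b}}) + measure \<mu> {s. s + D s \<in> N}"
      using N_borel by (intro measure_Un_le) auto
    finally show ?thesis using U N0 by simp
  qed
  show ?thesis
  proof (cases "a = b")
    case False
    show ?thesis
    proof (rule field_le_epsilon)
      fix e :: real assume "e > 0"
      then show "F b - F a \<le> nu * (b - a) + e"
        using *[of "e / (b - a)"] False assms by (simp add: distrib_right)
    qed
  qed simp
qed

section \<open>Bounds for the queue and uniqueness of travel times\<close>

lemma G_nonneg: "t \<le> tf \<Longrightarrow> 0 \<le> G t"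
  by (simp add: G_measure)

lemma F_nonneg: "0 \<le> F t"
  by (simp add: F_measure)

lemma G_zero: "0 \<le> tf \<Longrightarrow> G 0 = 0"
  using G_integral[of 0] by simp

lemma q_le_G: "q t \<le> G t"
  using F_nonneg by (simp add: q_eq)

lemma D_le: "t \<in> {0..tf} \<Longrightarrow> D t \<le> tau + G t / nu"
  using nu q_le_G[of t] by (simp add: D_eq divide_right_mono)

lemma q_increment:
  assumes "0 \<le> s" "s \<le> t" "t + tau \<le> tf"
  shows "q s + (G t - G s) - nu * (t - s) \<le> q t"
  using outflow_le_capacity[of "s + tau" "t + tau"] assms tau by (simp add: q_eq algebra_simps)

lemma q_lower:
  assumes "0 \<le> s" "s \<le> t" "t + tau \<le> tf"
  shows "G t - G s - nu * (t - s) \<le> q t"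
  using q_increment[OF assms] q_nonneg[of s] assms tau by auto

text \<open>This is FIFO: between the two entrances the queue shrinks by at most what the capacity
  serves in that time.\<close>

lemma exit_mono:
  assumes "s \<le> t" "0 \<le> t" "t + tau \<le> tf"
  shows "s + D s \<le> t + D t"
proof (cases "0 \<le> s")
  case True
  have "q s + (G t - G s) - nu * (t - s) \<le> q t" using q_increment True assms by blast
  moreover have "G s \<le> G t" using assms tau by (intro G_mono) auto
  ultimately have "q s \<le> nu * (t - s) + q t" by linarith
  then have "q s / nu \<le> (t - s) + q t / nu" using nu by (simp add: field_simps)
  then show ?thesis using True assms tau by (simp add: D_eq)
next
  case False
  then show ?thesis using D_ge_tau[of t] assms by (simp add: D_out)
qed

text \<open>The queue is empty at some earlier time and the edge works at capacity since then.\<close>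

lemma q_upper:
  assumes t: "0 \<le> t" "t \<le> tf" "t + tau + G t / nu \<le> tf"
  obtains s where "0 \<le> s" "s \<le> t" "q t = G t - G s - nu * (t - s)"
proof -
  have t_tau: "t + tau \<le> tf" "t \<le> tf"
    using t divide_nonneg_pos[OF G_nonneg[of t] nu] by linarith+
  define \<psi> where "\<psi> u = nu * u - F (u + tau)" for u
  have q_psi: "q u = G u - nu * u + \<psi> u" for u by (simp add: q_eq \<psi>_def)
  have psi_mono: "\<psi> u \<le> \<psi> v" if "0 \<le> u" "u \<le> v" "v \<le> t" for u v
    using outflow_le_capacity[of "u + tau" "v + tau"] that tau t_tau by (simp add: \<psi>_def algebra_simps)
  have psi_cont: "continuous_on {0..t} \<psi>"
  proof (rule continuous_on_subset)
    have lip: "\<bar>F x - F y\<bar> \<le> nu * \<bar>x - y\<bar>" if "x \<in> {0..tf}" "y \<in> {0..tf}" for x y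
      using outflow_le_capacity[of x y] outflow_le_capacity[of y x] F_mono[of x y] F_mono[of y x] that
      by (cases "x \<le> y") auto
    have "nu-lipschitz_on {0..tf} F"
      using lip nu by (intro lipschitz_onI) (auto simp: dist_real_def)
    then have "continuous_on {0..tf} F" by (rule lipschitz_on_continuous_on)
    moreover have "continuous_on {0..t} (\<lambda>u. u + tau)" by (intro continuous_intros)
    ultimately have "continuous_on {0..t} (\<lambda>u. F (u + tau))"
      by (rule continuous_on_compose2) (use t_tau tau in auto)
    then show "continuous_on {0..t} \<psi>"
      unfolding \<psi>_def by (intro continuous_intros)
  qed simp
  have G_cont: "continuous_on {0..t} G"
    using G_continuous by (rule continuous_on_subset) (use t_tau in auto)
  define K where "K = {u \<in> {0..t}. \<psi> u = \<psi> t}"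
  have "closed K"
    unfolding K_def using psi_cont by (intro continuous_closed_preimage_constant) auto
  then have "compact K" unfolding K_def
    by (metis (no_types, lifting) bounded_closed_interval bounded_subset compact_eq_bounded_closed mem_Collect_eq subsetI)
  moreover have "K \<noteq> {}" using t by (auto simp: K_def)
  ultimately obtain s where s: "s \<in> K" "\<And>u. u \<in> K \<Longrightarrow> s \<le> u"
    by (metis compact_attains_inf)
  have s': "0 \<le> s" "s \<le> t" "\<psi> s = \<psi> t" using s(1) by (auto simp: K_def)
  have "q s = 0"
  proof (rule ccontr)
    assume "q s \<noteq> 0"
    then have pos: "q s > 0" using q_nonneg[of s] s' t_tau by auto
    have "s \<noteq> 0" using pos G_zero F_nonneg[of "0 + tau"] t_tau t q_eq[of 0] by (cases "s = 0") auto
    then have s0: "0 < s" using s' by simp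
    \<comment> \<open>Up to the constant \<open>nu * tau\<close>, this is \<open>nu\<close> times
      the exit time.\<close>
    define W where "W u = G u + \<psi> u" for u
    have W: "W u = nu * u + q u" for u by (simp add: W_def q_psi)
    have "continuous_on {0..t} W" unfolding W_def using psi_cont G_cont by (intro continuous_intros)
    then have "\<exists>d>0. \<forall>u\<in>{0..t}. dist u s < d \<longrightarrow> dist (W u) (W s) < q s"
      using s' pos unfolding continuous_on_iff by auto
    then obtain d where d: "d > 0" "\<And>u. u \<in> {0..t} \<Longrightarrow> dist u s < d \<Longrightarrow> dist (W u) (W s) < q s"
      by blast
    define u where "u = max 0 (s - d / 2)"
    have u: "0 \<le> u" "u < s" "\<bar>u - s\<bar> < d" using s0 d(1) by (auto simp: u_def max_def)
    have "dist (W u) (W s) < q s" using d(2)[of u] u s' by (auto simp: dist_real_def)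
    then have Wu: "W u > nu * s" using W[of s] by (auto simp: dist_real_def)
    have "\<psi> u = \<psi> s"
    proof (rule ccontr)
      assume "\<psi> u \<noteq> \<psi> s"
      then have less: "\<psi> u < \<psi> s" using psi_mono[of u s] u s' by auto
      have "nu * (u + D u) = nu * tau + W u"
        using exit_times[of u] u s' t_tau by (simp add: W_def \<psi>_def algebra_simps)
      then have Tu: "u + D u = tau + W u / nu" using nu by (simp add: field_simps)
      have "u + D u > s + tau" unfolding Tu using Wu nu by (simp add: field_simps)
      moreover have "u + D u \<le> tf"
      proof -
        have "D u \<le> tau + G u / nu" using u s' t_tau by (intro D_le) auto
        moreover have "G u / nu \<le> G t / nu"
          using u s' t_tau nu by (intro divide_right_mono G_mono) auto
        ultimately show ?thesis using u s' t by linarith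
      qed
      ultimately have "F (u + D u) - F (s + tau) \<le> nu * (u + D u - (s + tau))"
        using s' tau by (intro outflow_le_capacity) auto
      \<comment> \<open>By FIFO all inflow until \<open>u\<close> is out by the exit time of
        \<open>u\<close>. Together with the capacity bound from \<open>s + tau\<close> on, this
        gives \<open>\<psi> s \<le> \<psi> u\<close>.\<close>
      moreover have "F (u + D u) \<ge> G u"
      proof -
        have "G u = measure \<mu> {..u}" using u s' t_tau by (simp add: G_measure)
        also have "\<dots> \<le> measure \<mu> {s. s + D s \<le> u + D u}"
          using exit_mono u s' t_tau sets_exit[of "{..u + D u}"]
          by (intro fin.finite_measure_mono) (auto simp: atMost_def)
        finally show ?thesis by (simp add: F_measure)
      qed
      moreover have "nu * (u + D u - (s + tau)) = W u - nu * s"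
        using nu by (simp add: Tu field_simps)
      moreover have "F (s + tau) = nu * s - \<psi> s" by (simp add: \<psi>_def)
      ultimately show False using less by (simp add: W_def)
    qed
    then have "u \<in> K" using u s' by (auto simp: K_def)
    then show False using s(2) u by fastforce
  qed
  then have "q t = G t - G s - nu * (t - s)" using s'(3) q_psi[of s] q_psi[of t] by (simp add: algebra_simps)
  then show ?thesis using that s' by blast
qed

lemma D_eq_tau:
  assumes "0 \<le> t" "t \<le> tf" "t + tau + G t / nu \<le> tf" "\<And>s. \<lbrakk>0 \<le> s; s \<le> t\<rbrakk> \<Longrightarrow> G t - G s \<le> nu * (t - s)"
  shows "D t = tau"
proof -
  obtain s where "0 \<le> s" "s \<le> t" "q t = G t - G s - nu * (t - s)" using q_upper[OF assms(1-3)] .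
  then have "q t \<le> 0" using assms(4)[of s] by auto
  then show ?thesis using q_nonneg[of t] assms(1,2) D_eq[of t] by auto
qed

end

lemma vickrey_unique:
  fixes tf tau nu :: real
  assumes "vickrey_edge tf tau nu g D1" and "vickrey_edge tf tau nu g D2"
    and t0: "0 \<le> t0" "t0 \<le> tf" "t0 + tau + vickrey_edge.G g t0 / nu \<le> tf"
    and G_end: "vickrey_edge.G g tf = vickrey_edge.G g t0" and "D1 t0 = tau"
  shows "D1 = D2"
proof -
  interpret A: vickrey_edge tf tau nu g D1 by fact
  interpret B: vickrey_edge tf tau nu g D2 by fact
  have le: "q1 t \<le> q2 t" if "0 \<le> t" "t \<le> t0" "q1 = A.q \<and> q2 = B.q \<or> q1 = B.q \<and> q2 = A.q" for t q1 q2
  proof -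
    have "A.G t / nu \<le> A.G t0 / nu"
      using that t0 A.nu by (intro divide_right_mono A.G_mono) auto
    then have *: "t + tau + A.G t / nu \<le> tf" using t0 that by linarith
    moreover have "0 \<le> A.G t / nu" using A.G_nonneg that t0 A.nu by simp
    ultimately have **: "t + tau \<le> tf" by linarith
    have tf: "t \<le> tf" and t: "0 \<le> t" using that t0 by auto
    from that(3) show ?thesis
    proof
      assume "q1 = A.q \<and> q2 = B.q"
      moreover obtain s where "0 \<le> s" "s \<le> t" "A.q t = A.G t - A.G s - nu * (t - s)"
        using A.q_upper[OF t tf *] .
      ultimately show ?thesis using B.q_lower[of s t] ** by simp
    next
      assume "q1 = B.q \<and> q2 = A.q"
      moreover obtain s where "0 \<le> s" "s \<le> t" "B.q t = A.G t - A.G s - nu * (t - s)"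
        using B.q_upper[OF t tf *] .
      ultimately show ?thesis using A.q_lower[of s t] ** by simp
    qed
  qed
  have q_eq: "A.q t = B.q t" if "0 \<le> t" "t \<le> t0" for t
    using le[OF that, of A.q B.q] le[OF that, of B.q A.q] by auto
  have "A.q t0 = 0" using A.D_eq[of t0] t0 \<open>D1 t0 = tau\<close> A.nu by auto
  then have q0: "A.q t0 = 0" "B.q t0 = 0" using q_eq t0 by auto
  have late: "A.q t = 0 \<and> B.q t = 0" if "t0 \<le> t" "t \<le> tf" for t
  proof -
    have "A.G t = A.G t0"
      using A.G_mono[of t0 t] A.G_mono[of t tf] that G_end by auto
    moreover have "A.F (t0 + tau) \<le> A.F (t + tau)" "B.F (t0 + tau) \<le> B.F (t + tau)"
      using that by (auto intro: A.F_mono B.F_mono)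
    ultimately have "A.q t \<le> 0" "B.q t \<le> 0" using q0 by (auto simp: A.q_eq B.q_eq)
    then show ?thesis using A.q_nonneg[of t] B.q_nonneg[of t] that t0 by auto
  qed
  show ?thesis
  proof
    fix t
    show "D1 t = D2 t"
    proof (cases "t \<in> {0..tf}")
      case True
      then have "A.q t = B.q t" using q_eq late by (cases "t \<le> t0") auto
      then show ?thesis using True by (simp add: A.D_eq B.D_eq)
    qed (simp add: A.D_out B.D_out)
  qed
qed

section \<open>The particle measure of a loaded network\<close>

text \<open>Links \<open>has_sum\<close>, in which loading and walk flows are stated, to integrals
  over the countable set of walks, where Tonelli applies.\<close>

lemma nn_integral_count_space_has_sum:
  assumes "(f has_sum S) A" and nonneg: "\<And>x. x \<in> A \<Longrightarrow> 0 \<le> (f x :: real)"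
  shows "(\<integral>\<^sup>+ x. ennreal (f x) \<partial>count_space A) = ennreal S"
proof -
  have "f summable_on A" using assms(1) by (rule has_sum_imp_summable)
  then have "(\<lambda>x. norm (f x)) summable_on A" by (rule summable_on_iff_abs_summable_on_real[THEN iffD1])
  then have "Infinite_Set_Sum.abs_summable_on f A" by (rule abs_summable_equivalent[THEN iffD1])
  then have "(\<integral>\<^sup>+ x. ennreal (f x) \<partial>count_space A) = ennreal (infsetsum f A)" "infsetsum f A = infsum f A"
    using nonneg by (auto intro: nn_integral_conv_infsetsum infsetsum_infsum)
  then show ?thesis using assms(1) by (simp add: infsumI)
qed

locale loaded_net =
  fixes N :: "('v, 'e::finite, 'i::finite, 'z) net_scheme" and tf tf' :: real
    and h :: "'e list \<times> 'i \<Rightarrow> real \<Rightarrow> real" and g :: "'e \<Rightarrow> real \<Rightarrow> real"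
  assumes ind: "induces N tf tf' h g" and wf: "walk_flow N tf h"
    and tau_nonneg: "\<And>e. 0 \<le> tau N e" and cap_pos: "\<And>e. 0 < cap N e"
    and rate_int: "\<And>i. set_integrable lborel {0..tf} (rate N i)"
    and rate_nonneg: "\<And>i s. 0 \<le> rate N i s"
begin

abbreviation W :: "('e list \<times> 'i) set" where "W \<equiv> walks N"
abbreviation D :: "'e \<Rightarrow> real \<Rightarrow> real" where "D \<equiv> trav N tf g"
definition cum :: "'e \<Rightarrow> real \<Rightarrow> real" where "cum e t = (LINT s:{0..t}|lborel. g e s)"
definition atime :: "'e list \<times> 'i \<Rightarrow> nat \<Rightarrow> real \<Rightarrow> real" where
  "atime wi j s = arr (exitT N tf g) (fst wi) j s"
definition dens :: "'e list \<times> 'i \<Rightarrow> real \<Rightarrow> real" where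
  "dens wi s = indicator {0..tf} s * h wi s"
text \<open>\<open>P\<close> is the distribution of the particles over walk, commodity and departure time. The cumulative inflow of
  an edge is the expected number of visits, so edge flows are bounded by statements about single particles.\<close>

definition P :: "(('e list \<times> 'i) \<times> real) measure" where
  "P = density (count_space W \<Otimes>\<^sub>M lborel) (\<lambda>p. ennreal (dens (fst p) (snd p)))"
text \<open>Positions are collected, so repeated use of \<open>e\<close> counts with multiplicity;
  the time interval is half-open, so that counts over adjacent intervals add up.\<close>

definition visits :: "'e \<Rightarrow> real \<Rightarrow> real \<Rightarrow> ('e list \<times> 'i) \<times> real \<Rightarrow> nat set" where
  "visits e a t p = {j. j < length (fst (fst p)) \<and> fst (fst p) ! j = e \<and> a < atime (fst p) j (snd p) \<and> atime (fst p) j (snd p) \<le> t}"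

lemma edge_ok: "vickrey_ok tf (tau N e) (cap N e) (g e) (D e)"
  using ind by (simp add: induces_def)

lemma g_int: "set_integrable lborel {0..tf} (g e)" and g_nonneg: "t \<in> {0..tf} \<Longrightarrow> 0 \<le> g e t"
  using ind by (auto simp: induces_def edge_flow_def)

lemma edge: "cap N e = ereal nu \<Longrightarrow> vickrey_edge tf (tau N e) nu (g e) (D e)"
  using edge_ok[of e] cap_pos[of e] tau_nonneg[of e] g_int[of e] g_nonneg[of _ e]
  by unfold_locales auto

lemma edge_G: "cap N e = ereal nu \<Longrightarrow> vickrey_edge.G (g e) = cum e"
  using vickrey_edge.G_def[OF edge, of e nu] by (auto simp: cum_def)

lemma D_inf: "cap N e = \<infinity> \<Longrightarrow> D e t = tau N e"
  using edge_ok[of e] by (cases "t \<in> {0..tf}") (auto simp: vickrey_ok_def)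

lemma cap_cases: obtains "cap N e = \<infinity>" | nu where "cap N e = ereal nu"
  using cap_pos[of e] by (cases "cap N e") auto

lemma D_ge: "tau N e \<le> D e t"
  by (cases e rule: cap_cases) (auto simp: D_inf intro: vickrey_edge.D_ge_tau edge)

lemma D_measurable [measurable]: "D e \<in> borel_measurable borel"
proof (cases e rule: cap_cases)
  case 1
  then have "D e = (\<lambda>_. tau N e)" by (auto simp: D_inf)
  then show ?thesis by simp
qed (blast intro: vickrey_edge.D_measurable edge)

lemma atime_0 [simp]: "atime wi 0 s = s"
  by (simp add: atime_def)

lemma atime_Suc: "atime wi (Suc j) s = atime wi j s + D (fst wi ! j) (atime wi j s)"
  by (simp add: atime_def exitT_def)

lemma atime_measurable [measurable]: "atime wi j \<in> borel_measurable borel"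
proof (induction j)
  case 0
  have "atime wi 0 = (\<lambda>s. s)" by auto
  then show ?case by simp
next
  case (Suc j)
  note Suc.IH [measurable]
  have "atime wi (Suc j) = (\<lambda>s. atime wi j s + D (fst wi ! j) (atime wi j s))" by (auto simp: atime_Suc)
  then show ?case by simp
qed

lemma atime_Suc_ge: "atime wi j s + tau N (fst wi ! j) \<le> atime wi (Suc j) s"
  using D_ge by (simp add: atime_Suc)

lemma atime_mono: "j \<le> k \<Longrightarrow> atime wi j s \<le> atime wi k s"
proof (induction k)
  case (Suc k)
  have "atime wi k s \<le> atime wi (Suc k) s"
    using atime_Suc_ge[of wi k s] tau_nonneg[of "fst wi ! k"] by linarith
  then show ?case using Suc by (cases "j = Suc k") (auto simp: le_Suc_eq)
qed simp

lemma countable_W: "countable W"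
  by (rule countable_subset[of _ "lists UNIV \<times> UNIV"]) (auto intro!: countable_SIGMA countable_lists countable_finite)

lemma h_int: "wi \<in> W \<Longrightarrow> set_integrable lborel {0..tf} (h wi)"
  and h_nonneg: "\<lbrakk>wi \<in> W; t \<in> {0..tf}\<rbrakk> \<Longrightarrow> 0 \<le> h wi t"
  using wf by (auto simp: walk_flow_def)

lemma dens_integrable: "wi \<in> W \<Longrightarrow> integrable lborel (dens wi)"
  using h_int[of wi] by (simp add: dens_def[abs_def] set_integrable_def)

lemma dens_measurable: "wi \<in> W \<Longrightarrow> dens wi \<in> borel_measurable borel"
  using borel_measurable_integrable[OF dens_integrable] by simp

lemma dens_nonneg: "wi \<in> W \<Longrightarrow> 0 \<le> dens wi s"
  using h_nonneg[of wi s] by (auto simp: dens_def indicator_def)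

lemma pair_measurable:
  assumes "\<And>wi. wi \<in> W \<Longrightarrow> (\<lambda>s. f (wi, s)) \<in> measurable borel M"
  shows "f \<in> measurable (count_space W \<Otimes>\<^sub>M lborel) M"
  using assms by (intro measurable_pair_measure_countable1 countable_W) auto

lemma P_dens_measurable [measurable]:
  "(\<lambda>p. ennreal (dens (fst p) (snd p))) \<in> borel_measurable (count_space W \<Otimes>\<^sub>M lborel)"
  using dens_measurable by (intro pair_measurable) auto

lemma space_P [simp]: "space P = W \<times> UNIV"
  by (simp add: P_def space_pair_measure)

lemma sets_P [measurable_cong]: "sets P = sets (count_space W \<Otimes>\<^sub>M lborel)"
  by (simp add: P_def)

lemma P_measurable:
  assumes "\<And>wi. wi \<in> W \<Longrightarrow> (\<lambda>s. f (wi, s)) \<in> measurable borel M"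
  shows "f \<in> measurable P M"
  using pair_measurable[OF assms] by (simp add: measurable_cong_sets[OF sets_P refl])

lemma P_sets:
  assumes "\<And>wi. wi \<in> W \<Longrightarrow> Measurable.pred borel (\<lambda>s. Q wi s)"
  shows "{p. fst p \<in> W \<and> Q (fst p) (snd p)} \<in> sets P"
proof -
  have "Measurable.pred P (\<lambda>p. Q (fst p) (snd p))" using assms by (intro P_measurable) auto
  then have "{p \<in> space P. Q (fst p) (snd p)} \<in> sets P" by measurable
  moreover have "{p \<in> space P. Q (fst p) (snd p)} = {p. fst p \<in> W \<and> Q (fst p) (snd p)}" by (auto simp: mem_Times_iff)
  ultimately show ?thesis by simp
qed

text \<open>The first order of integration suits the loading equation, stated walk by walk; the
  second suits the inflow rates, which are sums over walks at a fixed time.\<close>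

lemma nn_integral_P:
  assumes "\<And>wi. wi \<in> W \<Longrightarrow> (\<lambda>s. f (wi, s)) \<in> borel_measurable borel"
  shows "(\<integral>\<^sup>+ p. f p \<partial>P) = (\<integral>\<^sup>+ wi. \<integral>\<^sup>+ s. ennreal (dens wi s) * f (wi, s) \<partial>lborel \<partial>count_space W)"
    and "(\<integral>\<^sup>+ p. f p \<partial>P) = (\<integral>\<^sup>+ s. \<integral>\<^sup>+ wi. ennreal (dens wi s) * f (wi, s) \<partial>count_space W \<partial>lborel)"
proof -
  have f [measurable]: "f \<in> borel_measurable (count_space W \<Otimes>\<^sub>M lborel)" using assms by (rule pair_measurable)
  have 1: "(\<integral>\<^sup>+ p. f p \<partial>P) = (\<integral>\<^sup>+ p. ennreal (dens (fst p) (snd p)) * f p \<partial>(count_space W \<Otimes>\<^sub>M lborel))"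
    unfolding P_def by (rule nn_integral_density) measurable
  then show "(\<integral>\<^sup>+ p. f p \<partial>P) = (\<integral>\<^sup>+ wi. \<integral>\<^sup>+ s. ennreal (dens wi s) * f (wi, s) \<partial>lborel \<partial>count_space W)"
    using lborel.nn_integral_fst[of "\<lambda>p. ennreal (dens (fst p) (snd p)) * f p" "count_space W"] by simp
  interpret C: sigma_finite_measure "count_space W"
    by (rule sigma_finite_measure_count_space_countable[OF countable_W])
  interpret CL: pair_sigma_finite "count_space W" lborel ..
  show "(\<integral>\<^sup>+ p. f p \<partial>P) = (\<integral>\<^sup>+ s. \<integral>\<^sup>+ wi. ennreal (dens wi s) * f (wi, s) \<partial>count_space W \<partial>lborel)"
    unfolding 1 using CL.nn_integral_snd[of "\<lambda>p. ennreal (dens (fst p) (snd p)) * f p"]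
    by simp
qed

section \<open>Cumulative inflow as an expected number of visits\<close>

lemma visits_measurable_section: "(\<lambda>s. of_nat (card (visits e a t (wi, s))) :: ennreal) \<in> borel_measurable borel"
proof -
  have "visits e a t (wi, s) = {j\<in>{j. j < length (fst wi) \<and> fst wi ! j = e}. a < atime wi j s \<and> atime wi j s \<le> t}" for s
    by (auto simp: visits_def)
  moreover have "(\<lambda>s. of_nat (card {j\<in>{j. j < length (fst wi) \<and> fst wi ! j = e}. a < atime wi j s \<and> atime wi j s \<le> t}) :: ennreal) \<in> borel_measurable borel"
    by measurable
  ultimately show ?thesis by simp
qed

lemma visits_measurable [measurable]: "(\<lambda>p. of_nat (card (visits e a t p)) :: ennreal) \<in> borel_measurable P"
  using visits_measurable_section by (rule P_measurable)

lemma finite_visits: "finite (visits e a t p)"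
  by (rule finite_subset[of _ "{..<length (fst (fst p))}"]) (auto simp: visits_def)

text \<open>The loading equation, with sum over walks and integral over departures merged by
  Tonelli. Arrival times are nonnegative, so the lower end \<open>-1\<close> excludes nothing and
  keeps arrivals at time \<open>0\<close>.\<close>

lemma cum_visits:
  assumes t: "t \<in> {0..tf}"
  shows "ennreal (cum e t) = (\<integral>\<^sup>+ p. of_nat (card (visits e (-1) t p)) \<partial>P)"
proof -
  have atime_pos: "0 \<le> atime wi j s" if "0 \<le> s" for wi j s
    using atime_mono[of 0 j wi s] that by simp
  define mass where "mass wi j = (LINT s:{s \<in> {0..tf}. 0 \<le> atime wi j s \<and> atime wi j s \<le> t}|lborel. h wi s)" for wi j
  have mass: "ennreal (mass wi j) = (\<integral>\<^sup>+ s. ennreal (dens wi s) * indicator {s. -1 < atime wi j s \<and> atime wi j s \<le> t} s \<partial>lborel)" "0 \<le> mass wi j"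
    if wi: "wi \<in> W" for wi j
  proof -
    note dens_measurable[OF wi, measurable]
    have eq: "mass wi j = (LINT s|lborel. dens wi s * indicator {s. -1 < atime wi j s \<and> atime wi j s \<le> t} s)"
      unfolding mass_def set_lebesgue_integral_def
      by (intro Bochner_Integration.integral_cong refl)
        (use atime_pos[of _ wi j] in \<open>auto simp: dens_def indicator_def intro: less_le_trans[of "-1" 0]\<close>)
    have "integrable lborel (\<lambda>s. dens wi s * indicator {s. -1 < atime wi j s \<and> atime wi j s \<le> t} s)"
      by (rule Bochner_Integration.integrable_bound[OF dens_integrable[OF wi]]) (auto simp: indicator_def)
    then have "ennreal (mass wi j) = (\<integral>\<^sup>+ s. ennreal (dens wi s * indicator {s. -1 < atime wi j s \<and> atime wi j s \<le> t} s) \<partial>lborel)"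
      unfolding eq using wi by (intro nn_integral_eq_integral[symmetric]) (auto simp: dens_nonneg)
    also have "\<dots> = (\<integral>\<^sup>+ s. ennreal (dens wi s) * indicator {s. -1 < atime wi j s \<and> atime wi j s \<le> t} s \<partial>lborel)"
      by (intro nn_integral_cong) (auto simp: indicator_def)
    finally show "ennreal (mass wi j) = (\<integral>\<^sup>+ s. ennreal (dens wi s) * indicator {s. -1 < atime wi j s \<and> atime wi j s \<le> t} s \<partial>lborel)" .
    show "0 \<le> mass wi j" unfolding eq using wi by (intro integral_nonneg_AE) (auto simp: dens_nonneg)
  qed
  let ?J = "\<lambda>wi. {j. j < length (fst wi) \<and> fst wi ! j = e}"
  have "((\<lambda>wi. \<Sum>j\<in>?J wi. mass wi j) has_sum cum e t) W"
    using ind t by (auto simp: induces_def loads_def cum_def mass_def atime_def)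
  then have "ennreal (cum e t) = (\<integral>\<^sup>+ wi. ennreal (\<Sum>j\<in>?J wi. mass wi j) \<partial>count_space W)"
    by (rule nn_integral_count_space_has_sum[symmetric]) (auto intro: sum_nonneg mass)
  also have "\<dots> = (\<integral>\<^sup>+ wi. \<integral>\<^sup>+ s. ennreal (dens wi s) * of_nat (card (visits e (-1) t (wi, s))) \<partial>lborel \<partial>count_space W)"
  proof (intro nn_integral_cong)
    fix wi assume "wi \<in> space (count_space W)"
    then have wi: "wi \<in> W" by simp
    note dens_measurable[OF wi, measurable]
    have fin: "finite (?J wi)" by simp
    have card: "of_nat (card (visits e (-1) t (wi, s))) = (\<Sum>j\<in>?J wi. indicator {s. -1 < atime wi j s \<and> atime wi j s \<le> t} s :: ennreal)" for s
    proof -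
      have "visits e (-1) t (wi, s) = {j\<in>?J wi. -1 < atime wi j s \<and> atime wi j s \<le> t}" by (auto simp: visits_def)
      then have "card (visits e (-1) t (wi, s)) = (\<Sum>j\<in>?J wi. if -1 < atime wi j s \<and> atime wi j s \<le> t then 1 else 0)"
        using fin by (simp add: sum.If_cases Int_def conj_assoc)
      then show ?thesis by (simp add: indicator_def of_bool_def if_distrib cong: if_cong)
    qed
    have "ennreal (\<Sum>j\<in>?J wi. mass wi j) = (\<Sum>j\<in>?J wi. ennreal (mass wi j))"
      by (intro sum_ennreal[symmetric] mass(2) wi)
    also have "\<dots> = (\<integral>\<^sup>+ s. (\<Sum>j\<in>?J wi. ennreal (dens wi s) * indicator {s. -1 < atime wi j s \<and> atime wi j s \<le> t} s) \<partial>lborel)"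
      using mass(1)[OF wi] by (subst nn_integral_sum) auto
    also have "\<dots> = (\<integral>\<^sup>+ s. ennreal (dens wi s) * of_nat (card (visits e (-1) t (wi, s))) \<partial>lborel)"
      by (simp only: card sum_distrib_left)
    finally show "ennreal (\<Sum>j\<in>?J wi. mass wi j) = \<dots>" .
  qed
  also have "\<dots> = (\<integral>\<^sup>+ p. of_nat (card (visits e (-1) t p)) \<partial>P)"
    by (rule nn_integral_P(1)[symmetric]) (rule visits_measurable_section)
  finally show ?thesis .
qed

lemma cum_diff_visits:
  assumes "0 \<le> a" "a \<le> t" "t \<le> tf"
  shows "(\<integral>\<^sup>+ p. of_nat (card (visits e a t p)) \<partial>P) = ennreal (cum e t - cum e a)"
proof -
  have card: "card (visits e (-1) t p) = card (visits e (-1) a p) + card (visits e a t p)" for p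
  proof -
    have "visits e (-1) t p = visits e (-1) a p \<union> visits e a t p"
      using assms by (auto simp: visits_def)
    moreover have "visits e (-1) a p \<inter> visits e a t p = {}" by (auto simp: visits_def)
    ultimately show ?thesis by (simp add: card_Un_disjoint finite_visits)
  qed
  have nonneg: "0 \<le> cum e u" if "u \<le> tf" for u
    unfolding cum_def set_lebesgue_integral_def using that g_nonneg
    by (intro integral_nonneg_AE) (auto simp: indicator_def)
  have "ennreal (cum e t) = ennreal (cum e a) + (\<integral>\<^sup>+ p. of_nat (card (visits e a t p)) \<partial>P)"
    using assms by (simp add: cum_visits card nn_integral_add)
  then have "(\<integral>\<^sup>+ p. of_nat (card (visits e a t p)) \<partial>P) = ennreal (cum e t) - ennreal (cum e a)"
    by simp
  then show ?thesis using nonneg[of a] assms by (simp add: ennreal_minus)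
qed

lemma P_commodity:
  assumes [measurable]: "S \<in> sets borel"
  shows "emeasure P {p. fst p \<in> W \<and> snd (fst p) = i \<and> snd p \<in> S} = ennreal (LINT s:{0..tf} \<inter> S|lborel. rate N i s)"
proof -
  let ?A = "{p. fst p \<in> W \<and> snd (fst p) = i \<and> snd p \<in> S}"
  have "?A \<in> sets P" by (rule P_sets[where Q="\<lambda>wi s. snd wi = i \<and> s \<in> S"]) measurable
  then have "emeasure P ?A = (\<integral>\<^sup>+ p. indicator ?A p \<partial>P)" by simp
  also have "\<dots> = (\<integral>\<^sup>+ s. \<integral>\<^sup>+ wi. ennreal (dens wi s) * indicator ?A (wi, s) \<partial>count_space W \<partial>lborel)"
    by (rule nn_integral_P(2)) (auto simp: indicator_def)
  also have "\<dots> = (\<integral>\<^sup>+ s. ennreal (indicator ({0..tf} \<inter> S) s * rate N i s) \<partial>lborel)"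
  proof (rule nn_integral_cong_AE)
    have "AE s in lborel. s \<in> {0..tf} \<longrightarrow> ((\<lambda>wi. h wi s) has_sum rate N i s) (walks_of N i)"
      using wf by (simp add: walk_flow_def)
    then show "AE s in lborel. (\<integral>\<^sup>+ wi. ennreal (dens wi s) * indicator ?A (wi, s) \<partial>count_space W)
        = ennreal (indicator ({0..tf} \<inter> S) s * rate N i s)"
    proof eventually_elim
      case (elim s)
      show ?case
      proof (cases "s \<in> {0..tf} \<inter> S")
        case True
        then have "(\<integral>\<^sup>+ wi. ennreal (h wi s) \<partial>count_space (walks_of N i)) = ennreal (rate N i s)"
          using elim h_nonneg by (intro nn_integral_count_space_has_sum) (auto simp: walks_of_def)
        also have "(\<integral>\<^sup>+ wi. ennreal (h wi s) \<partial>count_space (walks_of N i))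
            = (\<integral>\<^sup>+ wi. ennreal (h wi s) * indicator (walks_of N i) wi \<partial>count_space UNIV)"
          by (rule nn_integral_count_space_indicator) simp
        also have "\<dots> = (\<integral>\<^sup>+ wi. ennreal (dens wi s) * indicator ?A (wi, s) * indicator W wi \<partial>count_space UNIV)"
          using True by (intro nn_integral_cong) (auto simp: indicator_def dens_def walks_of_def)
        also have "\<dots> = (\<integral>\<^sup>+ wi. ennreal (dens wi s) * indicator ?A (wi, s) \<partial>count_space W)"
          by (rule nn_integral_count_space_indicator[symmetric]) simp
        finally show ?thesis using True by simp
      next
        case False
        then have "(\<lambda>wi. ennreal (dens wi s) * indicator ?A (wi, s)) = (\<lambda>wi. 0)"
          by (auto simp: dens_def indicator_def)
        then show ?thesis using False by simp
      qed
    qed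
  qed
  also have "\<dots> = ennreal (LINT s:{0..tf} \<inter> S|lborel. rate N i s)"
  proof -
    have "set_integrable lborel ({0..tf} \<inter> S) (rate N i)"
      using rate_int[of i] by (rule set_integrable_subset) auto
    then show ?thesis
      unfolding set_lebesgue_integral_def set_integrable_def
      by (subst nn_integral_eq_integral) (auto simp: rate_nonneg)
  qed
  finally show ?thesis .
qed

sublocale P: finite_measure P
proof (rule finite_measureI)
  let ?A = "\<lambda>i. {p. fst p \<in> W \<and> snd (fst p) = i \<and> snd p \<in> (UNIV :: real set)}"
  have "?A i \<in> sets P" for i by (rule P_sets[where Q="\<lambda>wi s. snd wi = i \<and> s \<in> UNIV"]) auto
  then have "emeasure P (\<Union>i\<in>UNIV. ?A i) \<le> (\<Sum>i\<in>UNIV. emeasure P (?A i))"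
    by (intro emeasure_subadditive_finite) auto
  also have "\<dots> < \<infinity>" by (subst P_commodity) (auto simp: ennreal_sum_less_top)
  also have "(\<Union>i\<in>UNIV. ?A i) = space P" by auto
  finally show "emeasure P (space P) \<noteq> \<infinity>" by simp
qed

lemma AE_P_dens: "AE p in P. 0 < dens (fst p) (snd p)"
proof -
  have "AE p in count_space W \<Otimes>\<^sub>M lborel. ennreal (dens (fst p) (snd p)) > 0 \<longrightarrow> 0 < dens (fst p) (snd p)"
    by simp
  then show ?thesis unfolding P_def by (subst AE_density) auto
qed

lemma AE_P_time: "AE p in P. snd p \<in> {0..tf}"
  using AE_P_dens
proof eventually_elim
  case (elim p)
  then show ?case by (cases "snd p \<in> {0..tf}") (auto simp: dens_def)
qed

lemma AE_P_walk: "AE p in P. fst p \<in> W"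
  using AE_space[of P] by eventually_elim auto

lemma AE_P_commodity:
  assumes [measurable]: "S \<in> sets borel" and "\<And>s. s \<in> {0..tf} \<Longrightarrow> s \<in> S \<Longrightarrow> rate N i s = 0"
  shows "AE p in P. \<not> (snd (fst p) = i \<and> snd p \<in> S)"
proof -
  let ?A = "{p. fst p \<in> W \<and> snd (fst p) = i \<and> snd p \<in> S}"
  have "?A \<in> sets P" by (rule P_sets[where Q="\<lambda>wi s. snd wi = i \<and> s \<in> S"]) measurable
  moreover have "emeasure P ?A = 0"
  proof -
    have "(\<lambda>s. indicator ({0..tf} \<inter> S) s *\<^sub>R rate N i s) = (\<lambda>s. 0)"
      using assms(2) by (auto simp: indicator_def)
    then show ?thesis by (simp add: P_commodity set_lebesgue_integral_def)
  qed
  ultimately have "AE p in P. p \<notin> ?A" by (intro AE_not_in null_setsI)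
  then show ?thesis using AE_P_walk by eventually_elim auto
qed

lemma AE_P_unused:
  assumes "wi0 \<in> W" "AE s in lborel. s \<in> {0..tf} \<longrightarrow> h wi0 s \<le> 0"
  shows "AE p in P. fst p \<noteq> wi0"
proof -
  let ?A = "{p. fst p \<in> W \<and> fst p = wi0}"
  have A: "?A \<in> sets P" by (rule P_sets[where Q="\<lambda>wi s. wi = wi0"]) auto
  have "emeasure P ?A = (\<integral>\<^sup>+ p. indicator ?A p \<partial>P)" using A by simp
  also have "\<dots> = (\<integral>\<^sup>+ wi. \<integral>\<^sup>+ s. ennreal (dens wi s) * indicator ?A (wi, s) \<partial>lborel \<partial>count_space W)"
    by (rule nn_integral_P(1)) (auto simp: indicator_def)
  also have "\<dots> = (\<integral>\<^sup>+ wi. 0 \<partial>count_space W)"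
  proof (rule nn_integral_cong)
    fix wi assume "wi \<in> space (count_space W)"
    have "AE s in lborel. ennreal (dens wi s) * indicator ?A (wi, s) = 0"
      using assms(2) by eventually_elim (auto simp: indicator_def dens_def ennreal_neg)
    then have "(\<integral>\<^sup>+ s. ennreal (dens wi s) * indicator ?A (wi, s) \<partial>lborel) = (\<integral>\<^sup>+ (s::real). 0 \<partial>lborel)"
      by (rule nn_integral_cong_AE)
    then show "(\<integral>\<^sup>+ s. ennreal (dens wi s) * indicator ?A (wi, s) \<partial>lborel) = 0" by simp
  qed
  finally have "emeasure P ?A = 0" by simp
  then have "AE p in P. p \<notin> ?A" using A by (intro AE_not_in null_setsI)
  then show ?thesis using AE_P_walk by eventually_elim auto
qed

lemma cum_mono: "\<lbrakk>0 \<le> a; a \<le> t; t \<le> tf\<rbrakk> \<Longrightarrow> cum e a \<le> cum e t"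
proof -
  assume a: "0 \<le> a" "a \<le> t" "t \<le> tf"
  then have "set_integrable lborel {0..t} (g e)" "set_integrable lborel {0..a} (g e)"
    by (auto intro: set_integrable_subset[OF g_int])
  then show ?thesis
    unfolding cum_def set_lebesgue_integral_def set_integrable_def using a g_nonneg
    by (intro integral_mono) (auto simp: indicator_def)
qed

lemma cum_diff_ge:
  assumes "0 \<le> a" "a \<le> t" "t \<le> tf" "A \<in> sets P" "AE p in P. p \<in> A \<longrightarrow> visits e a t p \<noteq> {}"
  shows "measure P A \<le> cum e t - cum e a"
proof -
  have "emeasure P A = (\<integral>\<^sup>+ p. indicator A p \<partial>P)" using assms(4) by simp
  also have "\<dots> \<le> (\<integral>\<^sup>+ p. of_nat (card (visits e a t p)) \<partial>P)"
  proof (rule nn_integral_mono_AE)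
    show "AE p in P. indicator A p \<le> (of_nat (card (visits e a t p)) :: ennreal)"
      using assms(5)
    proof eventually_elim
      case (elim p)
      then have "p \<in> A \<Longrightarrow> 1 \<le> card (visits e a t p)"
        using finite_visits[of e a t p] by (simp add: card_gt_0_iff Suc_le_eq)
      then have "p \<in> A \<Longrightarrow> (of_nat 1 :: ennreal) \<le> of_nat (card (visits e a t p))"
        by (simp only: of_nat_le_iff)
      then show ?case by (cases "p \<in> A") auto
    qed
  qed
  also have "\<dots> = ennreal (cum e t - cum e a)" using assms by (intro cum_diff_visits)
  finally have "emeasure P A \<le> ennreal (cum e t - cum e a)" .
  then show ?thesis using cum_mono[of a t e] assms by (simp add: P.emeasure_eq_measure)
qed

lemma cum_diff_le:
  assumes "0 \<le> a" "a \<le> t" "t \<le> tf" "A \<in> sets P"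
    "AE p in P. card (visits e a t p) \<le> (if p \<in> A then K else 0)"
  shows "cum e t - cum e a \<le> K * measure P A"
proof -
  have "ennreal (cum e t - cum e a) = (\<integral>\<^sup>+ p. of_nat (card (visits e a t p)) \<partial>P)"
    using assms by (intro cum_diff_visits[symmetric])
  also have "\<dots> \<le> (\<integral>\<^sup>+ p. of_nat K * indicator A p \<partial>P)"
  proof (rule nn_integral_mono_AE)
    show "AE p in P. of_nat (card (visits e a t p)) \<le> (of_nat K * indicator A p :: ennreal)"
      using assms(5) by eventually_elim (auto simp: indicator_def split: if_splits)
  qed
  also have "\<dots> = of_nat K * emeasure P A" using assms(4) by (simp add: nn_integral_cmult)
  also have "\<dots> = ennreal (K * measure P A)"
    by (simp add: P.emeasure_eq_measure ennreal_mult ennreal_of_nat_eq_real_of_nat)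
  finally show ?thesis by (simp add: ennreal_le_iff)
qed

end

lemma is_walk_Cons:
  "is_walk N a d (e # w) \<longleftrightarrow> etail N e = a \<and> (if w = [] then ehead N e = d else is_walk N (ehead N e) d w)"
proof (cases w)
  case (Cons e' w')
  then show ?thesis
    by (auto simp: is_walk_def nth_Cons split: nat.splits)
qed (auto simp: is_walk_def)

context loaded_net
begin

lemma cum_0: "cum e 0 = 0"
proof -
  have "(\<lambda>x. indicator {0::real} x *\<^sub>R g e x) = (\<lambda>x. indicator {0} x * g e 0)" by (auto simp: indicator_def)
  then show ?thesis by (simp add: cum_def set_lebesgue_integral_def)
qed

lemma measure_P_commodity:
  assumes "S \<in> sets borel"
  shows "measure P {p. fst p \<in> W \<and> snd (fst p) = i \<and> snd p \<in> S} = (LINT s:{0..tf} \<inter> S|lborel. rate N i s)"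
proof -
  have "0 \<le> (LINT s:{0..tf} \<inter> S|lborel. rate N i s)"
    unfolding set_lebesgue_integral_def by (intro integral_nonneg_AE) (auto simp: rate_nonneg)
  then show ?thesis unfolding measure_def P_commodity[OF assms] by simp
qed

text \<open>Consecutive visits of an edge with free-flow time at least \<open>1\<close> have different integer parts.\<close>

lemma cum_crude:
  assumes "1 \<le> tau N e" "real n \<le> tf" "\<And>i s. rate N i s \<le> c" "0 \<le> c"
  shows "cum e n \<le> (real n + 1)\<^sup>2 * c * CARD('i)"
proof -
  have mass: "measure P {p. fst p \<in> W \<and> snd (fst p) = i \<and> snd p \<in> {..real n}} \<le> c * (n + 1)" for i
  proof -
    have "measure P {p. fst p \<in> W \<and> snd (fst p) = i \<and> snd p \<in> {..real n}} = (LINT s:{0..tf} \<inter> {..real n}|lborel. rate N i s)"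
      by (rule measure_P_commodity) simp
    also have "\<dots> \<le> (LINT s:{0..real n}|lborel. c)"
      unfolding set_lebesgue_integral_def
    proof (rule integral_mono)
      show "integrable lborel (\<lambda>s. indicator ({0..tf} \<inter> {..real n}) s *\<^sub>R rate N i s)"
        using set_integrable_subset[OF rate_int, of "{0..tf} \<inter> {..real n}" i] by (simp add: set_integrable_def)
      show "indicator ({0..tf} \<inter> {..real n}) s *\<^sub>R rate N i s \<le> indicator {0..real n} s *\<^sub>R c" for s
        using assms by (auto simp: indicator_def)
    qed simp
    also have "\<dots> = c * n" by (simp add: set_lebesgue_integral_def)
    also have "\<dots> \<le> c * (n + 1)" using assms by (intro mult_left_mono) auto
    finally show ?thesis .
  qed
  let ?A = "{p. fst p \<in> W \<and> snd p \<in> {..real n}}"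
  have A: "?A \<in> sets P" by (rule P_sets[where Q="\<lambda>wi s. s \<in> {..real n}"]) measurable
  have "measure P ?A \<le> measure P (\<Union>i. {p. fst p \<in> W \<and> snd (fst p) = i \<and> snd p \<in> {..real n}})"
    using P_sets[where Q="\<lambda>wi s. snd wi = i \<and> s \<in> {..real n}" for i]
    by (intro P.finite_measure_mono sets.finite_UN) auto
  also have "\<dots> \<le> (\<Sum>i\<in>UNIV. measure P {p. fst p \<in> W \<and> snd (fst p) = i \<and> snd p \<in> {..real n}})"
    using P_sets[where Q="\<lambda>wi s. snd wi = i \<and> s \<in> {..real n}" for i]
    by (intro measure_UNION_le) auto
  also have "\<dots> \<le> (\<Sum>i\<in>(UNIV::'i set). c * (n + 1))" using mass by (intro sum_mono) auto
  finally have mA: "measure P ?A \<le> c * (n + 1) * CARD('i)" by (simp add: mult.commute)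
  have "AE p in P. card (visits e 0 n p) \<le> (if p \<in> ?A then n + 1 else 0)"
    using AE_P_time AE_P_walk
  proof eventually_elim
    case (elim p)
    let ?t = "\<lambda>j. atime (fst p) j (snd p)"
    have s: "snd p \<le> ?t j" for j using atime_mono[of 0 j] by simp
    have less: "nat \<lfloor>?t j\<rfloor> < nat \<lfloor>?t k\<rfloor>" if "j \<in> visits e 0 n p" "k \<in> visits e 0 n p" "j < k" for j k
    proof -
      have "?t j + 1 \<le> ?t (Suc j)"
        using atime_Suc_ge[of "fst p" j "snd p"] that assms(1) by (auto simp: visits_def)
      also have "\<dots> \<le> ?t k" using that by (intro atime_mono) auto
      finally have "\<lfloor>?t j\<rfloor> + 1 \<le> \<lfloor>?t k\<rfloor>" by linarith
      moreover have "0 \<le> \<lfloor>?t j\<rfloor>" using that by (auto simp: visits_def)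
      ultimately show ?thesis by linarith
    qed
    have "inj_on (\<lambda>j. nat \<lfloor>?t j\<rfloor>) (visits e 0 n p)"
    proof (rule inj_onI)
      fix x y assume "x \<in> visits e 0 n p" "y \<in> visits e 0 n p" "nat \<lfloor>?t x\<rfloor> = nat \<lfloor>?t y\<rfloor>"
      then show "x = y" using less[of x y] less[of y x] by (cases x y rule: linorder_cases) auto
    qed
    moreover have "(\<lambda>j. nat \<lfloor>?t j\<rfloor>) ` visits e 0 n p \<subseteq> {..n}"
      by (auto simp: visits_def nat_le_iff floor_le_iff)
    ultimately have "card (visits e 0 n p) \<le> card {..n}" by (intro card_inj_on_le) auto
    moreover have "visits e 0 n p = {}" if "p \<notin> ?A"
    proof (rule equals0I)
      fix j assume "j \<in> visits e 0 n p"
      then show False using s[of j] that elim by (auto simp: visits_def)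
    qed
    ultimately show ?case by auto
  qed
  then have "cum e n - cum e 0 \<le> real (n + 1) * measure P ?A"
    using assms A by (intro cum_diff_le) auto
  moreover have "real (n + 1) * measure P ?A \<le> real (n + 1) * (c * (n + 1) * CARD('i))"
    using mA by (intro mult_left_mono) auto
  ultimately show ?thesis by (simp add: cum_0 power2_eq_square algebra_simps)
qed

lemma travel_cost_ge:
  assumes nu: "cap N e = ereal nu" and ab: "0 \<le> a" "a \<le> b" "b \<le> tf" and c: "\<And>t. \<lbrakk>a \<le> t; t \<le> b\<rbrakk> \<Longrightarrow> c \<le> D e t" "0 \<le> c"
  shows "c * (cum e b - cum e a) \<le> (LINT t:{0..tf}|lborel. D e t * g e t)"
    and "0 \<le> (LINT t:{0..tf}|lborel. D e t * g e t)"
proof -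
  interpret E: vickrey_edge tf "tau N e" nu "g e" "D e" using nu by (rule edge)
  have D0: "0 \<le> D e t" for t using E.D_ge_tau E.tau order_trans by blast
  have bound: "D e t \<le> tau N e + E.G tf / nu" if "t \<in> {0..tf}" for t
  proof -
    have "E.G t / nu \<le> E.G tf / nu" using that E.nu by (intro divide_right_mono E.G_mono) auto
    then show ?thesis using E.D_le[OF that] by linarith
  qed
  \<comment> \<open>Without integrability the integral would be \<open>0\<close> by default and
    bound nothing. It holds because the queue never exceeds the total inflow.\<close>
  have int: "integrable lborel (\<lambda>t. indicator {0..tf} t *\<^sub>R (D e t * g e t))"
  proof (rule Bochner_Integration.integrable_bound)
    show "integrable lborel (\<lambda>t. (tau N e + E.G tf / nu) * E.gbar t)" using E.gbar_integrable by simp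
    have "(\<lambda>t. indicator {0..tf} t *\<^sub>R (D e t * g e t)) = (\<lambda>t. D e t * E.gbar t)"
      by (auto simp: E.gbar_def)
    then show "(\<lambda>t. indicator {0..tf} t *\<^sub>R (D e t * g e t)) \<in> borel_measurable lborel" by simp
    show "AE t in lborel. norm (indicator {0..tf} t *\<^sub>R (D e t * g e t)) \<le> norm ((tau N e + E.G tf / nu) * E.gbar t)"
    proof (rule AE_I2)
      fix t
      show "norm (indicator {0..tf} t *\<^sub>R (D e t * g e t)) \<le> norm ((tau N e + E.G tf / nu) * E.gbar t)"
      proof (cases "t \<in> {0..tf}")
        case True
        then have "D e t * g e t \<le> (tau N e + E.G tf / nu) * g e t"
          using bound g_nonneg by (intro mult_right_mono) auto
        moreover have "0 \<le> D e t * g e t" using D0 g_nonneg True by simp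
        ultimately show ?thesis using True by (simp add: E.gbar_def)
      qed simp
    qed
  qed
  then show "0 \<le> (LINT t:{0..tf}|lborel. D e t * g e t)"
    unfolding set_lebesgue_integral_def using D0 g_nonneg
    by (intro integral_nonneg_AE) (auto simp: indicator_def)
  have "set_integrable lborel {0..a} (g e)" "set_integrable lborel {0..b} (g e)"
    using ab by (auto intro: set_integrable_subset[OF g_int])
  then have i: "integrable lborel (\<lambda>t. indicator {0..a} t * g e t)" "integrable lborel (\<lambda>t. indicator {0..b} t * g e t)"
    by (auto simp: set_integrable_def)
  have "c * (cum e b - cum e a) = (LINT t|lborel. c * (indicator {0..b} t * g e t - indicator {0..a} t * g e t))"
    using i by (simp add: cum_def set_lebesgue_integral_def)
  also have "\<dots> \<le> (LINT t|lborel. indicator {0..tf} t *\<^sub>R (D e t * g e t))"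
  proof (rule integral_mono[OF _ int])
    show "integrable lborel (\<lambda>t. c * (indicator {0..b} t * g e t - indicator {0..a} t * g e t))" using i by simp
    fix t
    show "c * (indicator {0..b} t * g e t - indicator {0..a} t * g e t) \<le> indicator {0..tf} t *\<^sub>R (D e t * g e t)"
      using ab c D0[of t] g_nonneg[of t e] by (auto simp: indicator_def intro!: mult_right_mono)
  qed
  finally show "c * (cum e b - cum e a) \<le> (LINT t:{0..tf}|lborel. D e t * g e t)"
    by (simp add: set_lebesgue_integral_def)
qed

end

section \<open>Lower bound for flows without detour of the first commodity\<close>

lemma ex_walk_step:
  assumes "is_walk (ex_net \<epsilon> M) a d w"
  obtains e v where "w = e # v" "ex_tail e = a" "v = [] \<and> ex_head e = d \<or> is_walk (ex_net \<epsilon> M) (ex_head e) d v"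
proof (cases w)
  case (Cons e v)
  then show ?thesis using that assms by (auto simp: is_walk_Cons ex_net_def split: if_splits)
qed (use assms in \<open>auto simp: is_walk_def\<close>)

lemma ex_walk_from:
  "is_walk (ex_net \<epsilon> M) Na d w \<Longrightarrow> \<exists>v. w = E1 # v \<and> (v = [] \<and> d = Nb \<or> is_walk (ex_net \<epsilon> M) Nb d v)"
  "is_walk (ex_net \<epsilon> M) Nb d w \<Longrightarrow> \<exists>v. w = E2 # v \<and> (v = [] \<and> d = Nc \<or> is_walk (ex_net \<epsilon> M) Nc d v) \<or>
            w = E6 # v \<and> (v = [] \<and> d = Nz \<or> is_walk (ex_net \<epsilon> M) Nz d v)"
  "is_walk (ex_net \<epsilon> M) Nc d w \<Longrightarrow> \<exists>v. w = E3 # v \<and> (v = [] \<and> d = Nx \<or> is_walk (ex_net \<epsilon> M) Nx d v)"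
  "\<not> is_walk (ex_net \<epsilon> M) Nx d w"
  "is_walk (ex_net \<epsilon> M) Ny d w \<Longrightarrow> \<exists>v. w = E7 # v \<and> (v = [] \<and> d = Nz \<or> is_walk (ex_net \<epsilon> M) Nz d v)"
  "is_walk (ex_net \<epsilon> M) Nz d w \<Longrightarrow> \<exists>v. w = E5 # v \<and> (v = [] \<and> d = Nq \<or> is_walk (ex_net \<epsilon> M) Nq d v)"
  "is_walk (ex_net \<epsilon> M) Nq d w \<Longrightarrow> \<exists>v. w = E4 # v \<and> (v = [] \<and> d = Nb \<or> is_walk (ex_net \<epsilon> M) Nb d v)"
proof -
  have tail: "ex_tail e = Na \<Longrightarrow> e = E1" "ex_tail e = Nb \<Longrightarrow> e = E2 \<or> e = E6" "ex_tail e = Nc \<Longrightarrow> e = E3"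
    "ex_tail e \<noteq> Nx" "ex_tail e = Ny \<Longrightarrow> e = E7" "ex_tail e = Nz \<Longrightarrow> e = E5" "ex_tail e = Nq \<Longrightarrow> e = E4" for e
    by (cases e; simp)+
  show "is_walk (ex_net \<epsilon> M) Na d w \<Longrightarrow> \<exists>v. w = E1 # v \<and> (v = [] \<and> d = Nb \<or> is_walk (ex_net \<epsilon> M) Nb d v)"
    by (erule ex_walk_step, drule tail) auto
  show "is_walk (ex_net \<epsilon> M) Nb d w \<Longrightarrow> \<exists>v. w = E2 # v \<and> (v = [] \<and> d = Nc \<or> is_walk (ex_net \<epsilon> M) Nc d v) \<or>
            w = E6 # v \<and> (v = [] \<and> d = Nz \<or> is_walk (ex_net \<epsilon> M) Nz d v)"
    by (erule ex_walk_step, drule tail) auto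
  show "is_walk (ex_net \<epsilon> M) Nc d w \<Longrightarrow> \<exists>v. w = E3 # v \<and> (v = [] \<and> d = Nx \<or> is_walk (ex_net \<epsilon> M) Nx d v)"
    by (erule ex_walk_step, drule tail) auto
  show "\<not> is_walk (ex_net \<epsilon> M) Nx d w" using tail(4) by (metis ex_walk_step)
  show "is_walk (ex_net \<epsilon> M) Ny d w \<Longrightarrow> \<exists>v. w = E7 # v \<and> (v = [] \<and> d = Nz \<or> is_walk (ex_net \<epsilon> M) Nz d v)"
    by (erule ex_walk_step, drule tail) auto
  show "is_walk (ex_net \<epsilon> M) Nz d w \<Longrightarrow> \<exists>v. w = E5 # v \<and> (v = [] \<and> d = Nq \<or> is_walk (ex_net \<epsilon> M) Nq d v)"
    by (erule ex_walk_step, drule tail) auto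
  show "is_walk (ex_net \<epsilon> M) Nq d w \<Longrightarrow> \<exists>v. w = E4 # v \<and> (v = [] \<and> d = Nb \<or> is_walk (ex_net \<epsilon> M) Nb d v)"
    by (erule ex_walk_step, drule tail) auto
qed

lemma ex_net_simps [simp]:
  "etail (ex_net \<epsilon> M) = ex_tail" "ehead (ex_net \<epsilon> M) = ex_head" "tau (ex_net \<epsilon> M) = ex_tau \<epsilon>"
  "cap (ex_net \<epsilon> M) = ex_cap" "src (ex_net \<epsilon> M) = ex_src" "dst (ex_net \<epsilon> M) = ex_dst"
  "rate (ex_net \<epsilon> M) = ex_rate M" "vot (ex_net \<epsilon> M) i = 1"
  by (simp_all add: ex_net_def)

text \<open>Only \<open>Nb\<close> offers a choice, between \<open>E2\<close> and \<open>E6\<close>,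
  and \<open>Nx\<close> is a dead end. A walk to \<open>Nc\<close> or \<open>Nx\<close> that takes
  \<open>E6\<close> has to return through \<open>E5\<close> and \<open>E4\<close>; nothing after
  that matters.\<close>

lemma
  shows K2_walks: "(w, K2) \<in> walks (ex_net \<epsilon> M) \<Longrightarrow> w = [E5, E4, E2] \<or> (\<exists>v. w = E5 # E4 # E6 # E5 # E4 # v)"
    and K3_walks: "(w, K3) \<in> walks (ex_net \<epsilon> M) \<Longrightarrow> w = [E3]"
    and K4_walks: "(w, K4) \<in> walks (ex_net \<epsilon> M) \<Longrightarrow> w = [E1, E2, E3] \<or> (\<exists>v. w = E1 # E6 # E5 # E4 # v)"
    and K5_walks: "(w, K5) \<in> walks (ex_net \<epsilon> M) \<Longrightarrow> \<exists>v. w = E4 # v"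
    and K1_walks: "(w, K1) \<in> walks (ex_net \<epsilon> M) \<Longrightarrow> \<exists>v. w = E7 # v"
proof -
  have loop: "(\<exists>v. w = E6 # E5 # E4 # v) \<or> (w = [E2] \<and> d = Nc) \<or> (w = [E2, E3] \<and> d = Nx)"
    if w: "is_walk (ex_net \<epsilon> M) Nb d w" and d: "d = Nc \<or> d = Nx" for d w
  proof -
    obtain v where "w = E2 # v \<and> (v = [] \<and> d = Nc \<or> is_walk (ex_net \<epsilon> M) Nc d v) \<or>
        w = E6 # v \<and> (v = [] \<and> d = Nz \<or> is_walk (ex_net \<epsilon> M) Nz d v)"
      using ex_walk_from(2)[OF w] by blast
    then show ?thesis
    proof (elim disjE conjE)
      assume v: "w = E2 # v" "is_walk (ex_net \<epsilon> M) Nc d v"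
      then show ?thesis using ex_walk_from(3)[OF v(2)] ex_walk_from(4) by blast
    next
      assume v: "w = E6 # v" "is_walk (ex_net \<epsilon> M) Nz d v"
      then obtain v' where v': "v = E5 # v'" "is_walk (ex_net \<epsilon> M) Nq d v'"
        using ex_walk_from(6)[OF v(2)] d by auto
      then show ?thesis using ex_walk_from(7)[OF v'(2)] v by blast
    qed (use d in auto)
  qed
  show "w = [E5, E4, E2] \<or> (\<exists>v. w = E5 # E4 # E6 # E5 # E4 # v)" if "(w, K2) \<in> walks (ex_net \<epsilon> M)"
  proof -
    have w: "is_walk (ex_net \<epsilon> M) Nz Nc w" using that by (simp add: walks_def)
    then obtain v where v: "w = E5 # v" "is_walk (ex_net \<epsilon> M) Nq Nc v"
      using ex_walk_from(6)[OF w] by auto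
    then obtain v' where v': "v = E4 # v'" "is_walk (ex_net \<epsilon> M) Nb Nc v'"
      using ex_walk_from(7)[OF v(2)] by auto
    then show ?thesis using loop[OF v'(2)] v by auto
  qed
  show "(w, K3) \<in> walks (ex_net \<epsilon> M) \<Longrightarrow> w = [E3]"
    by (auto simp: walks_def dest!: ex_walk_from(3) simp: ex_walk_from(4))
  show "w = [E1, E2, E3] \<or> (\<exists>v. w = E1 # E6 # E5 # E4 # v)" if "(w, K4) \<in> walks (ex_net \<epsilon> M)"
  proof -
    have w: "is_walk (ex_net \<epsilon> M) Na Nx w" using that by (simp add: walks_def)
    then obtain v where v: "w = E1 # v" "is_walk (ex_net \<epsilon> M) Nb Nx v"
      using ex_walk_from(1)[OF w] by auto
    then show ?thesis using loop[OF v(2)] by auto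
  qed
  show "(w, K5) \<in> walks (ex_net \<epsilon> M) \<Longrightarrow> \<exists>v. w = E4 # v"
    by (auto simp: walks_def dest!: ex_walk_from(7))
  show "(w, K1) \<in> walks (ex_net \<epsilon> M) \<Longrightarrow> \<exists>v. w = E7 # v"
    by (auto simp: walks_def dest!: ex_walk_from(5))
qed

lemma LINT_interval: "a \<le> b \<Longrightarrow> (LINT s|lborel. indicator {a<..b} s * (c::real)) = c * (b - a)"
  by simp

lemma UNIV_com: "(UNIV :: com set) = {K1, K2, K3, K4, K5}"
  using com.exhaust by auto

instance com :: finite
  by standard (simp add: UNIV_com)

lemma ex_rate_integrable: "set_integrable lborel A (ex_rate M i)" if "A \<in> sets borel" for A :: "real set"
proof (rule set_integrable_subset[of lborel UNIV])
  show "set_integrable lborel UNIV (ex_rate M i)"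
    by (cases i) (auto simp: set_integrable_def emeasure_lborel_Icc_eq)
qed (use that in auto)

lemma ex_rate_bounds: "0 \<le> ex_rate M i s" "ex_rate M i s \<le> 6"
  "ex_rate M K2 s \<le> 2" "ex_rate M K4 s \<le> 1"
  by (cases i; auto simp: indicator_def)+

text \<open>All that is kept of implementability is \<open>K1_direct\<close>. With
  \<open>2000 \<le> M\<close> the time \<open>2000\<close>, by which the relevant particles have
  arrived, precedes the end of \<open>K3\<close> and \<open>K5\<close>.\<close>

locale ex_flow = 
  fixes \<epsilon> M tf tf' :: real and h :: "edge list \<times> com \<Rightarrow> real \<Rightarrow> real" and g :: "edge \<Rightarrow> real \<Rightarrow> real"
  assumes eps: "0 < \<epsilon>" "\<epsilon> \<le> 1" and M: "2000 \<le> M" and tf: "M + 100 \<le> tf"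
    and ind: "induces (ex_net \<epsilon> M) tf tf' h g" and wf: "walk_flow (ex_net \<epsilon> M) tf h"
    and K1_direct: "\<And>w. (w, K1) \<in> walks (ex_net \<epsilon> M) \<Longrightarrow> w \<noteq> [E7] \<Longrightarrow>
      AE s in lborel. s \<in> {0..tf} \<longrightarrow> h (w, K1) s \<le> 0"
begin

sublocale loaded_net "ex_net \<epsilon> M" tf tf' h g
proof
  fix e
  show "0 \<le> tau (ex_net \<epsilon> M) e" "0 < cap (ex_net \<epsilon> M) e"
    using eps by (cases e; simp)+
qed (use ind wf ex_rate_integrable ex_rate_bounds(1) in auto)

text \<open>Departures of \<open>K2\<close> at time \<open>2\<close> itself form a null set. They
  are left out so that a detouring \<open>K2\<close> particle enters \<open>E4\<close> strictly
  after time \<open>9\<close> even if \<open>\<epsilon> = 1\<close>, as the half-open counting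
  requires.\<close>

definition start_ok :: "edge list \<Rightarrow> com \<Rightarrow> real \<Rightarrow> bool" where
  "start_ok w i s \<longleftrightarrow> (case i of
      K1 \<Rightarrow> w = [E7] \<and> 0 \<le> s
    | K2 \<Rightarrow> (w = [E5, E4, E2] \<or> (\<exists>v. w = E5 # E4 # E6 # E5 # E4 # v)) \<and> 2 < s \<and> s \<le> 3
    | K3 \<Rightarrow> w = [E3] \<and> 7 \<le> s \<and> s \<le> 10 + M
    | K4 \<Rightarrow> (w = [E1, E2, E3] \<or> (\<exists>v. w = E1 # E6 # E5 # E4 # v)) \<and> 4 \<le> s \<and> s \<le> 5
    | K5 \<Rightarrow> (\<exists>v. w = E4 # v) \<and> 9 \<le> s \<and> s \<le> 13 + M)"

lemma AE_start: "AE p in P. fst p \<in> W \<and> snd p \<in> {0..tf} \<and> start_ok (fst (fst p)) (snd (fst p)) (snd p)"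
proof -
  have K1: "AE p in P. snd (fst p) = K1 \<longrightarrow> fst (fst p) = [E7]"
  proof -
    have "AE p in P. \<forall>w\<in>{w. (w, K1) \<in> W \<and> w \<noteq> [E7]}. fst p \<noteq> (w, K1)"
    proof (subst AE_ball_countable)
      show "countable {w. (w, K1) \<in> W \<and> w \<noteq> [E7]}"
        by (rule countable_subset[of _ "lists UNIV"]) (auto intro!: countable_lists countable_finite)
      show "\<forall>w\<in>{w. (w, K1) \<in> W \<and> w \<noteq> [E7]}. AE p in P. fst p \<noteq> (w, K1)"
        using K1_direct by (auto intro!: AE_P_unused)
    qed
    then show ?thesis using AE_P_walk by eventually_elim auto
  qed
  have "AE p in P. \<not> (snd (fst p) = K2 \<and> snd p \<in> - {2<..3})"
  proof -
    have "AE p in P. \<not> (snd (fst p) = K2 \<and> snd p \<in> - {2..3})"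
      by (rule AE_P_commodity) auto
    moreover have "AE p in P. \<not> (snd (fst p) = K2 \<and> snd p \<in> {2})"
    proof -
      let ?A = "{p. fst p \<in> W \<and> snd (fst p) = K2 \<and> snd p \<in> {2}}"
      have "(\<lambda>s. indicator ({0..tf} \<inter> {2}) s *\<^sub>R rate (ex_net \<epsilon> M) K2 s) = (\<lambda>s. 2 * indicator {2} s)"
        using tf M by (auto simp: indicator_def)
      then have "emeasure P ?A = 0" by (subst P_commodity) (simp_all add: set_lebesgue_integral_def)
      moreover have "?A \<in> sets P" by (rule P_sets[where Q="\<lambda>wi s. snd wi = K2 \<and> s \<in> {2}"]) measurable
      ultimately have "AE p in P. p \<notin> ?A" by (intro AE_not_in null_setsI)
      then show ?thesis using AE_P_walk by eventually_elim auto
    qed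
    ultimately show ?thesis by eventually_elim auto
  qed
  moreover have "AE p in P. \<not> (snd (fst p) = K3 \<and> snd p \<in> - {7..10+M})"
    by (rule AE_P_commodity) auto
  moreover have "AE p in P. \<not> (snd (fst p) = K4 \<and> snd p \<in> - {4..5})"
    by (rule AE_P_commodity) auto
  moreover have "AE p in P. \<not> (snd (fst p) = K5 \<and> snd p \<in> - {9..13+M})"
    by (rule AE_P_commodity) auto
  ultimately show ?thesis using K1 AE_P_walk AE_P_time
  proof eventually_elim
    case (elim p)
    obtain w i s where p: "p = ((w, i), s)" by (metis prod.exhaust)
    show ?case using elim K2_walks[of w \<epsilon> M] K3_walks[of w \<epsilon> M] K4_walks[of w \<epsilon> M] K5_walks[of w \<epsilon> M]
      by (cases i) (auto simp: p start_ok_def)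
  qed
qed

definition ev :: "(edge list \<Rightarrow> com \<Rightarrow> real \<Rightarrow> bool) \<Rightarrow> ((edge list \<times> com) \<times> real) set" where
  "ev Q = {p. fst p \<in> W \<and> Q (fst (fst p)) (snd (fst p)) (snd p)}"

lemma ev_sets: "(\<And>w i. Measurable.pred borel (Q w i)) \<Longrightarrow> ev Q \<in> sets P"
  unfolding ev_def using P_sets[where Q="\<lambda>wi. Q (fst wi) (snd wi)"] by simp

lemma ev_commodity_le:
  assumes "\<And>s. ex_rate M i s \<le> c" "0 \<le> c" "a \<le> b"
  shows "measure P (ev (\<lambda>w j s. j = i \<and> a < s \<and> s \<le> b)) \<le> c * (b - a)"
proof -
  have "measure P (ev (\<lambda>w j s. j = i \<and> a < s \<and> s \<le> b)) = (LINT s:{0..tf} \<inter> {a<..b}|lborel. ex_rate M i s)"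
    using measure_P_commodity[of "{a<..b}" i] by (simp add: ev_def)
  also have "\<dots> \<le> (LINT s|lborel. indicator {a<..b} s * c)"
    unfolding set_lebesgue_integral_def
  proof (rule integral_mono)
    show "integrable lborel (\<lambda>s. indicator ({0..tf} \<inter> {a<..b}) s *\<^sub>R ex_rate M i s)"
      using ex_rate_integrable[of "{0..tf} \<inter> {a<..b}"] by (simp add: set_integrable_def)
    show "integrable lborel (\<lambda>s. indicator {a<..b} s * c)"
      by (intro integrable_mult_left integrable_real_indicator) (auto simp: emeasure_lborel_Ioc[OF assms(3)])
    show "indicator ({0..tf} \<inter> {a<..b}) s *\<^sub>R ex_rate M i s \<le> indicator {a<..b} s * c" for s
      using assms by (auto simp: indicator_def)
  qed
  finally show ?thesis by (simp only: LINT_interval[OF assms(3)])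
qed

lemma ev_commodity_eq:
  assumes "\<And>s. \<lbrakk>a < s; s \<le> b\<rbrakk> \<Longrightarrow> ex_rate M i s = c" "0 \<le> a" "a \<le> b" "b \<le> tf"
  shows "measure P (ev (\<lambda>w j s. j = i \<and> a < s \<and> s \<le> b)) = c * (b - a)"
proof -
  have "measure P (ev (\<lambda>w j s. j = i \<and> a < s \<and> s \<le> b)) = (LINT s:{0..tf} \<inter> {a<..b}|lborel. ex_rate M i s)"
    using measure_P_commodity[of "{a<..b}" i] by (simp add: ev_def)
  also have "\<dots> = (LINT s|lborel. indicator {a<..b} s * c)"
    unfolding set_lebesgue_integral_def
    by (intro Bochner_Integration.integral_cong) (use assms in \<open>auto simp: indicator_def\<close>)
  finally show ?thesis by (simp only: LINT_interval[OF assms(3)])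
qed

lemma card_visits_le_1:
  assumes "\<And>j. j \<in> visits e a t p \<Longrightarrow> j = k \<and> p \<in> A"
  shows "card (visits e a t p) \<le> (if p \<in> A then 1 else 0)"
proof -
  have "visits e a t p \<subseteq> (if p \<in> A then {k} else {})" using assms by auto
  then have "card (visits e a t p) \<le> card (if p \<in> A then {k} else {})" by (intro card_mono) auto
  then show ?thesis by (auto split: if_splits)
qed

lemma edge_E1: "vickrey_edge tf 1 1 (g E1) (D E1)" "vickrey_edge.G (g E1) = cum E1"
  and edge_E2: "vickrey_edge tf 1 1 (g E2) (D E2)" "vickrey_edge.G (g E2) = cum E2"
  and edge_E3: "vickrey_edge tf \<epsilon> 1 (g E3) (D E3)" "vickrey_edge.G (g E3) = cum E3"
  and edge_E4: "vickrey_edge tf \<epsilon> 2 (g E4) (D E4)" "vickrey_edge.G (g E4) = cum E4"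
  and edge_E5: "vickrey_edge tf (2 - \<epsilon>) 2 (g E5) (D E5)" "vickrey_edge.G (g E5) = cum E5"
  using edge[of E1 1] edge[of E2 1] edge[of E3 1] edge[of E4 2] edge[of E5 2]
    edge_G[of E1 1] edge_G[of E2 1] edge_G[of E3 1] edge_G[of E4 2] edge_G[of E5 2] by simp_all

lemma D_E6 [simp]: "D E6 t = 4"
  by (simp add: D_inf)

lemma atime_ge_tau:
  assumes "fst wi = us @ v"
  shows "s + (\<Sum>e\<leftarrow>us. ex_tau \<epsilon> e) \<le> atime wi (length us) s"
  using assms
proof (induction us arbitrary: v rule: rev_induct)
  case (snoc e us)
  then have "s + (\<Sum>e\<leftarrow>us. ex_tau \<epsilon> e) \<le> atime wi (length us) s" by simp
  then show ?case using atime_Suc_ge[of wi "length us" s] snoc.prems by (simp add: nth_append)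
qed simp

lemma atime_late: "s \<le> atime wi j s"
  using atime_mono[of 0 j wi s] by simp

lemma K2_atime:
  assumes "w = E5 # E4 # w'" "j \<ge> 2"
  shows "s + 2 \<le> atime (w, i) j s"
  using atime_ge_tau[of "(w, i)" "[E5, E4]" w' s] assms atime_mono[of 2 j "(w, i)" s] by (simp add: numeral_2_eq_2)

lemma K4_atime:
  assumes "w = E1 # w'" "j \<ge> 1"
  shows "s + 1 \<le> atime (w, i) j s"
  using atime_ge_tau[of "(w, i)" "[E1]" w' s] assms atime_mono[of 1 j "(w, i)" s] by simp

lemma loop_atime:
  assumes "w = us @ E6 # v" "j > length us" "0 \<le> (\<Sum>e\<leftarrow>us. ex_tau \<epsilon> e)"
  shows "s + (\<Sum>e\<leftarrow>us. ex_tau \<epsilon> e) + 4 \<le> atime (w, i) j s"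
  using atime_ge_tau[of "(w, i)" "us @ [E6]" v s] assms atime_mono[of "Suc (length us)" j "(w, i)" s] by simp

section \<open>Undisturbed arrival of \<open>K2\<close> and \<open>K4\<close> at node
  \<open>b\<close>\<close>

text \<open>Until time \<open>3\<close> only \<open>K2\<close> uses \<open>E5\<close>, as first edge
  and at most at capacity: \<open>K1\<close> ends after \<open>E7\<close>, and the other commodities
  start later. A detour of \<open>K1\<close> would break exactly this.\<close>

lemma no_queue_E5:
  assumes "0 \<le> t" "t \<le> 3"
  shows "D E5 t = 2 - \<epsilon>"
proof -
  have inc: "cum E5 b - cum E5 a \<le> 2 * (b - a)" if ab: "0 \<le> a" "a \<le> b" "b \<le> 3" for a b
  proof -
    let ?A = "ev (\<lambda>w j s. j = K2 \<and> a < s \<and> s \<le> b)"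
    have "AE p in P. card (visits E5 a b p) \<le> (if p \<in> ?A then 1 else 0)"
      using AE_start
    proof eventually_elim
      case (elim p)
      obtain w i s where p: "p = ((w, i), s)" by (metis prod.exhaust)
      show ?case
      proof (rule card_visits_le_1)
        fix j assume "j \<in> visits E5 a b p"
        then have j: "j < length w" "w ! j = E5" "a < atime (w, i) j s" "atime (w, i) j s \<le> b"
          by (auto simp: visits_def p)
        have s: "s \<le> 3" using j(4) atime_late[of s "(w, i)" j] ab by linarith
        have st: "start_ok w i s" "(w, i) \<in> W" using elim by (auto simp: p)
        show "j = 0 \<and> p \<in> ?A"
        proof (cases i)
          case K2
          then obtain w' where w: "w = E5 # E4 # w'" using st by (auto simp: start_ok_def)
          have "\<not> 2 \<le> j" using K2_atime[OF w, of j s i] j ab st K2 by (auto simp: start_ok_def)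
          moreover have "j \<noteq> 1" using j w by auto
          ultimately have "j = 0" by linarith
          then show ?thesis using j K2 st by (simp add: ev_def p)
        qed (use st s j in \<open>auto simp: start_ok_def\<close>)
      qed
    qed
    then have "cum E5 b - cum E5 a \<le> real 1 * measure P ?A"
      using ab tf M by (intro cum_diff_le ev_sets) auto
    also have "measure P ?A \<le> 2 * (b - a)" using ab by (intro ev_commodity_le ex_rate_bounds) auto
    finally show ?thesis by simp
  qed
  interpret E: vickrey_edge tf "2 - \<epsilon>" 2 "g E5" "D E5" by (rule edge_E5)
  show ?thesis
    using inc[of _ t] inc[of 0 t] assms tf M eps by (intro E.D_eq_tau) (auto simp: edge_E5(2) cum_0)
qed

lemma K2_atime_1: "\<lbrakk>w = E5 # w'; 0 \<le> s; s \<le> 3\<rbrakk> \<Longrightarrow> atime (w, i) 1 s = s + 2 - \<epsilon>"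
  by (simp add: atime_Suc[of _ 0, simplified] no_queue_E5)

text \<open>\<open>K2\<close> arrives from \<open>E5\<close> until \<open>5 - \<epsilon>\<close>. By
  then no \<open>K4\<close> particle can be on \<open>E4\<close>, since it is not at
  \<open>b\<close> before time \<open>5\<close>, and no \<open>K2\<close> particle can have
  completed a detour.\<close>

lemma no_queue_E4:
  assumes "0 \<le> t" "t \<le> 5 - \<epsilon>"
  shows "D E4 t = \<epsilon>"
proof -
  have inc: "cum E4 b - cum E4 a \<le> 2 * (b - a)" if ab: "0 \<le> a" "a \<le> b" "b \<le> 5 - \<epsilon>" for a b
  proof -
    let ?A = "ev (\<lambda>w j s. j = K2 \<and> a - (2 - \<epsilon>) < s \<and> s \<le> b - (2 - \<epsilon>))"
    have "AE p in P. card (visits E4 a b p) \<le> (if p \<in> ?A then 1 else 0)"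
      using AE_start
    proof eventually_elim
      case (elim p)
      obtain w i s where p: "p = ((w, i), s)" by (metis prod.exhaust)
      show ?case
      proof (rule card_visits_le_1)
        fix j assume "j \<in> visits E4 a b p"
        then have j: "j < length w" "w ! j = E4" "a < atime (w, i) j s" "atime (w, i) j s \<le> b"
          by (auto simp: visits_def p)
        have s: "s \<le> 5 - \<epsilon>" using j(4) atime_late[of s "(w, i)" j] ab by linarith
        have st: "start_ok w i s" "(w, i) \<in> W" "0 \<le> s" using elim by (auto simp: p)
        show "j = 1 \<and> p \<in> ?A"
        proof (cases i)
          case K2
          then have s23: "2 < s" "s \<le> 3" and w: "w = [E5, E4, E2] \<or> (\<exists>v. w = E5 # E4 # E6 # E5 # E4 # v)"
            using st by (auto simp: start_ok_def)
          have j1: "j = 1"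
            using w
          proof
            assume "w = [E5, E4, E2]"
            then show "j = 1" using j by (auto simp: less_Suc_eq numeral_3_eq_3)
          next
            assume "\<exists>v. w = E5 # E4 # E6 # E5 # E4 # v"
            then obtain v where v: "w = [E5, E4] @ E6 # E5 # E4 # v" by auto
            have "\<not> 2 < j"
            proof
              assume "2 < j"
              then show False using loop_atime[OF v, of j s i] j s23 ab eps by auto
            qed
            moreover have "j \<noteq> 0" "j \<noteq> 2" using j v by (intro notI, simp)+
            ultimately show "j = 1" by linarith
          qed
          obtain w' where "w = E5 # w'" using w by auto
          then have "atime (w, i) 1 s = s + 2 - \<epsilon>" using s23 by (intro K2_atime_1) auto
          then show ?thesis using j j1 K2 st by (simp add: ev_def p)
        next
          case K4
          then obtain w' where w: "w = E1 # w'" and "4 \<le> s" using st by (auto simp: start_ok_def)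
          have "\<not> 1 \<le> j" using K4_atime[OF w, of j s i] j ab eps \<open>4 \<le> s\<close> by linarith
          then have "j = 0" by linarith
          then show ?thesis using j w by simp
        qed (use st s j eps in \<open>auto simp: start_ok_def\<close>)
      qed
    qed
    then have "cum E4 b - cum E4 a \<le> real 1 * measure P ?A"
      using ab tf M eps by (intro cum_diff_le ev_sets) auto
    also have "measure P ?A \<le> 2 * ((b - (2 - \<epsilon>)) - (a - (2 - \<epsilon>)))" using ab by (intro ev_commodity_le ex_rate_bounds) auto
    finally show ?thesis by simp
  qed
  interpret E: vickrey_edge tf \<epsilon> 2 "g E4" "D E4" by (rule edge_E4)
  show ?thesis
    using inc[of _ t] inc[of 0 t] assms tf M eps by (intro E.D_eq_tau) (auto simp: edge_E4(2) cum_0)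
qed

lemma K2_atime_2: "\<lbrakk>w = E5 # E4 # w'; 0 \<le> s; s \<le> 3\<rbrakk> \<Longrightarrow> atime (w, i) 2 s = s + 2"
  using K2_atime_1[of w "E4 # w'" s i] atime_Suc[of "(w, i)" 1 s] no_queue_E4[of "s + 2 - \<epsilon>"] eps
  by (simp add: numeral_2_eq_2)

lemma no_queue_E1:
  assumes "0 \<le> t" "t \<le> 5"
  shows "D E1 t = 1"
proof -
  have inc: "cum E1 b - cum E1 a \<le> 1 * (b - a)" if ab: "0 \<le> a" "a \<le> b" "b \<le> 5" for a b
  proof -
    let ?A = "ev (\<lambda>w j s. j = K4 \<and> a < s \<and> s \<le> b)"
    have "AE p in P. card (visits E1 a b p) \<le> (if p \<in> ?A then 1 else 0)"
      using AE_start
    proof eventually_elim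
      case (elim p)
      obtain w i s where p: "p = ((w, i), s)" by (metis prod.exhaust)
      show ?case
      proof (rule card_visits_le_1)
        fix j assume "j \<in> visits E1 a b p"
        then have j: "j < length w" "w ! j = E1" "a < atime (w, i) j s" "atime (w, i) j s \<le> b"
          by (auto simp: visits_def p)
        have s: "s \<le> 5" using j(4) atime_late[of s "(w, i)" j] ab by linarith
        have st: "start_ok w i s" "(w, i) \<in> W" "0 \<le> s" using elim by (auto simp: p)
        show "j = 0 \<and> p \<in> ?A"
        proof (cases i)
          case K2
          then have s23: "2 < s" "s \<le> 3" and w: "w = [E5, E4, E2] \<or> (\<exists>v. w = E5 # E4 # E6 # E5 # E4 # v)"
            using st by (auto simp: start_ok_def)
          from w have False
          proof
            assume "w = [E5, E4, E2]"
            then show False using j by (auto simp: less_Suc_eq numeral_3_eq_3)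
          next
            assume "\<exists>v. w = E5 # E4 # E6 # E5 # E4 # v"
            then obtain v where v: "w = [E5, E4] @ E6 # E5 # E4 # v" by auto
            have "\<not> 2 < j"
            proof
              assume "2 < j"
              then show False using loop_atime[OF v, of j s i] j s23 ab eps by auto
            qed
            then have "j = 0 \<or> j = 1 \<or> j = 2" by linarith
            then show False using j v by auto
          qed
          then show ?thesis ..
        next
          case K4
          then have s45: "4 \<le> s" "s \<le> 5" and w: "w = [E1, E2, E3] \<or> (\<exists>v. w = E1 # E6 # E5 # E4 # v)"
            using st by (auto simp: start_ok_def)
          have "j = 0"
            using w
          proof
            assume "w = [E1, E2, E3]"
            then show "j = 0" using j by (auto simp: less_Suc_eq numeral_3_eq_3)
          next
            assume "\<exists>v. w = E1 # E6 # E5 # E4 # v"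
            then obtain v where v: "w = [E1] @ E6 # E5 # E4 # v" by auto
            have "\<not> 1 < j"
            proof
              assume "1 < j"
              then show False using loop_atime[OF v, of j s i] j s45 ab eps by auto
            qed
            moreover have "j \<noteq> 1" using j v by (intro notI) simp
            ultimately show "j = 0" by linarith
          qed
          then show ?thesis using j K4 st by (simp add: ev_def p)
        qed (use st s j in \<open>auto simp: start_ok_def\<close>)
      qed
    qed
    then have "cum E1 b - cum E1 a \<le> real 1 * measure P ?A"
      using ab tf M by (intro cum_diff_le ev_sets) auto
    also have "measure P ?A \<le> 1 * (b - a)" using ab by (intro ev_commodity_le ex_rate_bounds) auto
    finally show ?thesis by simp
  qed
  interpret E: vickrey_edge tf 1 1 "g E1" "D E1" by (rule edge_E1)
  show ?thesis
    using inc[of _ t] inc[of 0 t] assms tf M eps by (intro E.D_eq_tau) (auto simp: edge_E1(2) cum_0)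
qed

lemma K4_atime_1: "\<lbrakk>w = E1 # w'; 0 \<le> s; s \<le> 5\<rbrakk> \<Longrightarrow> atime (w, i) 1 s = s + 1"
  by (simp add: atime_Suc[of _ 0, simplified] no_queue_E1)

section \<open>The detouring amount and the queues on \<open>E3\<close> and
  \<open>E4\<close>\<close>

definition "loop2 = measure P (ev (\<lambda>w i s. i = K2 \<and> w \<noteq> [E5, E4, E2]))"
definition "loop4 = measure P (ev (\<lambda>w i s. i = K4 \<and> w \<noteq> [E1, E2, E3]))"
text \<open>The amount called \<open>l\<close> in the overview.\<close>

definition "loop = loop2 + loop4"

lemma loop_nonneg: "0 \<le> loop2" "0 \<le> loop4" "0 \<le> loop"
  by (auto simp: loop2_def loop4_def loop_def)

lemma ev_direct_ge:
  assumes "\<And>s. \<lbrakk>a < s; s \<le> b\<rbrakk> \<Longrightarrow> ex_rate M i s = c" "0 \<le> a" "a \<le> b" "b \<le> tf"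
  shows "c * (b - a) - measure P (ev (\<lambda>w j s. j = i \<and> w \<noteq> w0)) \<le> measure P (ev (\<lambda>w j s. j = i \<and> w = w0 \<and> a < s \<and> s \<le> b))"
proof -
  have "c * (b - a) = measure P (ev (\<lambda>w j s. j = i \<and> a < s \<and> s \<le> b))"
    using assms by (intro ev_commodity_eq[symmetric]) auto
  also have "\<dots> \<le> measure P (ev (\<lambda>w j s. j = i \<and> w \<noteq> w0) \<union> ev (\<lambda>w j s. j = i \<and> w = w0 \<and> a < s \<and> s \<le> b))"
    by (intro P.finite_measure_mono sets.Un ev_sets) (auto simp: ev_def)
  also have "\<dots> \<le> measure P (ev (\<lambda>w j s. j = i \<and> w \<noteq> w0)) + measure P (ev (\<lambda>w j s. j = i \<and> w = w0 \<and> a < s \<and> s \<le> b))"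
    by (intro measure_Un_le ev_sets) auto
  finally show ?thesis by simp
qed

text \<open>The factor \<open>30\<close> is the bound \<open>6\<close> on the inflow rates times
  five commodities.\<close>

lemma crude: "1 \<le> ex_tau \<epsilon> e \<Longrightarrow> real n \<le> 100 \<Longrightarrow> cum e n \<le> (real n + 1)\<^sup>2 * 30"
  using cum_crude[of e n 6] ex_rate_bounds(2) tf M by (simp add: UNIV_com)

text \<open>After time 4 more than two units of flow enter the edge \<open>E2\<close>, of capacity and free-flow time 1, before such a
  \<open>K4\<close> particle, which therefore exits later than \<open>4 + 1 + 2\<close>.\<close>

lemma K4_late:
  assumes s: "4 + loop < s" "s \<le> 5"
  shows "7 < (s + 1) + D E2 (s + 1)" "(s + 1) + D E2 (s + 1) \<le> 2000"
proof -
  let ?A = "ev (\<lambda>w j s. j = K2 \<and> w = [E5, E4, E2] \<and> 2 < s \<and> s \<le> 3)"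
  let ?B = "ev (\<lambda>w j s'. j = K4 \<and> w = [E1, E2, E3] \<and> 4 < s' \<and> s' \<le> s)"
  have AB: "?A \<in> sets P" "?B \<in> sets P" by (auto intro!: ev_sets)
  have s': "4 < s" using s loop_nonneg by simp
  have "measure P (?A \<union> ?B) \<le> cum E2 (s + 1) - cum E2 4"
  proof (rule cum_diff_ge)
    show "AE p in P. p \<in> ?A \<union> ?B \<longrightarrow> visits E2 4 (s + 1) p \<noteq> {}"
    proof (rule AE_I2, rule impI)
      fix p assume p': "p \<in> ?A \<union> ?B"
      obtain w i r where p: "p = ((w, i), r)" by (metis prod.exhaust)
      from p' show "visits E2 4 (s + 1) p \<noteq> {}"
      proof
        assume "p \<in> ?A"
        then have w: "w = [E5, E4, E2]" "2 < r" "r \<le> 3" by (auto simp: ev_def p)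
        then have "atime (w, i) 2 r = r + 2" by (intro K2_atime_2) auto
        then have "2 \<in> visits E2 4 (s + 1) p" using w s' by (simp add: visits_def p)
        then show ?thesis by blast
      next
        assume "p \<in> ?B"
        then have w: "w = [E1, E2, E3]" "4 < r" "r \<le> s" by (auto simp: ev_def p)
        then have "atime (w, i) 1 r = r + 1" using s by (intro K4_atime_1) auto
        then have "1 \<in> visits E2 4 (s + 1) p" using w s' by (simp add: visits_def p)
        then show ?thesis by blast
      qed
    qed
  qed (use AB s' s tf M in auto)
  moreover have "measure P (?A \<union> ?B) = measure P ?A + measure P ?B"
    using AB by (intro P.finite_measure_Union) (auto simp: ev_def)
  moreover have "2 * (3 - 2) - loop2 \<le> measure P ?A"
    unfolding loop2_def using tf M by (intro ev_direct_ge) auto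
  moreover have "1 * (s - 4) - loop4 \<le> measure P ?B"
    unfolding loop4_def using tf M s s' by (intro ev_direct_ge) auto
  \<comment> \<open>The masses add up to at least \<open>2 - loop2 + (s - 4) - loop4\<close>, which
    exceeds \<open>2\<close> by the assumption on \<open>s\<close>.\<close>
  ultimately have c: "cum E2 (s + 1) - cum E2 4 > 2" using s by (simp add: loop_def)
  interpret E: vickrey_edge tf 1 1 "g E2" "D E2" by (rule edge_E2)
  have "E.G (s + 1) - E.G 4 - 1 * (s + 1 - 4) \<le> E.q (s + 1)"
    using s s' tf M by (intro E.q_lower) auto
  then have "6 - (s + 1) < E.q (s + 1)" using c by (simp add: edge_E2(2))
  moreover have De: "D E2 (s + 1) = 1 + E.q (s + 1) / 1" using s s' tf M by (intro E.D_eq) auto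
  ultimately show "7 < (s + 1) + D E2 (s + 1)" by simp
  \<comment> \<open>A crude bound on the delay, to make sure that these particles are on
    \<open>E3\<close> by time \<open>2000\<close>.\<close>
  have "cum E2 (s + 1) \<le> cum E2 6" using s s' tf M by (intro cum_mono) auto
  also have "\<dots> \<le> 1470" using crude[of E2 6] by simp
  finally have "E.q (s + 1) \<le> 1470" using E.q_le_G[of "s + 1"] by (simp add: edge_E2(2))
  then show "(s + 1) + D E2 (s + 1) \<le> 2000" using De s by simp
qed

text \<open>From time \<open>7\<close> on \<open>K3\<close> alone takes up the capacity of
  \<open>E3\<close>, so whatever else enters after \<open>7\<close> adds to the queue as long as
  \<open>K3\<close> lasts. By \<open>K4_late\<close> this applies to direct \<open>K4\<close>
  particles that depart after \<open>4 + loop\<close>, and they amount to at least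
  \<open>5 - (4 + loop) - loop4\<close>.\<close>

lemma D_E3_ge:
  assumes t: "2000 \<le> t" "t \<le> 10 + M"
  shows "\<epsilon> + max 0 (1 - 2 * loop) \<le> D E3 t"
proof -
  let ?A = "ev (\<lambda>w j s. j = K3 \<and> 7 < s \<and> s \<le> t)"
  let ?B = "ev (\<lambda>w j s. j = K4 \<and> w = [E1, E2, E3] \<and> 4 + loop < s \<and> s \<le> 5)"
  have AB: "?A \<in> sets P" "?B \<in> sets P" by (auto intro!: ev_sets)
  have "measure P (?A \<union> ?B) \<le> cum E3 t - cum E3 7"
  proof (rule cum_diff_ge)
    show "AE p in P. p \<in> ?A \<union> ?B \<longrightarrow> visits E3 7 t p \<noteq> {}"
    proof (rule AE_mp[OF AE_start], rule AE_I2, intro impI)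
      fix p assume st: "fst p \<in> W \<and> snd p \<in> {0..tf} \<and> start_ok (fst (fst p)) (snd (fst p)) (snd p)"
        and p': "p \<in> ?A \<union> ?B"
      obtain w i r where p: "p = ((w, i), r)" by (metis prod.exhaust)
      from p' show "visits E3 7 t p \<noteq> {}"
      proof
        assume "p \<in> ?A"
        then have "i = K3" "7 < r" "r \<le> t" by (auto simp: ev_def p)
        moreover have "w = [E3]" using st \<open>i = K3\<close> by (simp add: p start_ok_def)
        ultimately have "0 \<in> visits E3 7 t p" by (simp add: visits_def p)
        then show ?thesis by blast
      next
        assume "p \<in> ?B"
        then have w: "w = [E1, E2, E3]" "4 + loop < r" "r \<le> 5" by (auto simp: ev_def p)
        then have "atime (w, i) 1 r = r + 1" using loop_nonneg by (intro K4_atime_1) auto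
        then have "atime (w, i) 2 r = (r + 1) + D E2 (r + 1)"
          using atime_Suc[of "(w, i)" 1 r] w by (simp add: numeral_2_eq_2)
        then have "2 \<in> visits E3 7 t p" using w K4_late[of r] t by (simp add: visits_def p)
        then show ?thesis by blast
      qed
    qed
  qed (use AB t tf M in auto)
  moreover have "measure P (?A \<union> ?B) = measure P ?A + measure P ?B"
    using AB by (intro P.finite_measure_Union) (auto simp: ev_def)
  moreover have "measure P ?A = 1 * (t - 7)"
    using t tf M by (intro ev_commodity_eq) auto
  moreover have "max 0 (1 - 2 * loop) \<le> measure P ?B"
  proof (cases "loop \<le> 1")
    case True
    then have "1 * (5 - (4 + loop)) - loop4 \<le> measure P ?B"
      unfolding loop4_def using tf M loop_nonneg by (intro ev_direct_ge) auto
    then show ?thesis using loop_nonneg by (auto simp: loop_def)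
  qed auto
  ultimately have B: "t - 7 + measure P ?B \<le> cum E3 t - cum E3 7" "max 0 (1 - 2 * loop) \<le> measure P ?B" by simp_all
  have c: "t - 7 + max 0 (1 - 2 * loop) \<le> cum E3 t - cum E3 7"
    by (rule order_trans[OF add_left_mono[OF B(2)] B(1)])
  interpret E: vickrey_edge tf \<epsilon> 1 "g E3" "D E3" by (rule edge_E3)
  have "E.G t - E.G 7 - 1 * (t - 7) \<le> E.q t"
    using t tf M eps by (intro E.q_lower) auto
  then have "(cum E3 t - cum E3 7) - (t - 7) \<le> E.q t" by (simp add: edge_E3(2))
  then have "max 0 (1 - 2 * loop) \<le> E.q t"
    by (rule order_trans[rotated]) (use c in \<open>simp only: le_diff_eq add.commute\<close>)
  moreover have "D E3 t = \<epsilon> + E.q t / 1" using t tf M by (intro E.D_eq) auto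
  ultimately show ?thesis by simp
qed

text \<open>The mechanism of \<open>D_E3_ge\<close>, with \<open>K5\<close> filling
  \<open>E4\<close> from time \<open>9\<close>. The free-flow times \<open>4\<close> of
  \<open>E6\<close> and \<open>2 - \<epsilon> \<ge> 1\<close> of \<open>E5\<close> bring detouring
  particles to \<open>E4\<close> after \<open>9\<close>; the crude bound for the queue on
  \<open>E5\<close> brings them there before \<open>2000\<close>. The delay is the queue divided by
  the capacity \<open>2\<close>.\<close>

lemma D_E4_ge:
  assumes t: "2000 \<le> t" "t \<le> 13 + M"
  shows "\<epsilon> + loop / 2 \<le> D E4 t"
proof -
  let ?A = "ev (\<lambda>w j s. j = K5 \<and> 9 < s \<and> s \<le> t)"
  let ?B = "ev (\<lambda>w j s. j = K2 \<and> w \<noteq> [E5, E4, E2])"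
  let ?C = "ev (\<lambda>w j s. j = K4 \<and> w \<noteq> [E1, E2, E3])"
  have ABC: "?A \<in> sets P" "?B \<in> sets P" "?C \<in> sets P" by (auto intro!: ev_sets)
  interpret E5: vickrey_edge tf "2 - \<epsilon>" 2 "g E5" "D E5" by (rule edge_E5)
  have D5: "2 - \<epsilon> \<le> D E5 u \<and> D E5 u \<le> 1900" if u: "0 \<le> u" "u \<le> 10" for u
  proof -
    have "cum E5 u \<le> cum E5 10" using u tf M by (intro cum_mono) auto
    also have "\<dots> \<le> 3630" using crude[of E5 10] eps by simp
    finally have "cum E5 u / 2 \<le> 1815" by simp
    moreover have "D E5 u \<le> 2 - \<epsilon> + E5.G u / 2" using u tf M by (intro E5.D_le) auto
    ultimately show ?thesis using E5.D_ge_tau[of u] eps by (simp add: edge_E5(2))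
  qed
  have "measure P (?A \<union> (?B \<union> ?C)) \<le> cum E4 t - cum E4 9"
  proof (rule cum_diff_ge)
    show "AE p in P. p \<in> ?A \<union> (?B \<union> ?C) \<longrightarrow> visits E4 9 t p \<noteq> {}"
    proof (rule AE_mp[OF AE_start], rule AE_I2, intro impI)
      fix p assume st: "fst p \<in> W \<and> snd p \<in> {0..tf} \<and> start_ok (fst (fst p)) (snd (fst p)) (snd p)"
        and p': "p \<in> ?A \<union> (?B \<union> ?C)"
      obtain w i r where p: "p = ((w, i), r)" by (metis prod.exhaust)
      from p' show "visits E4 9 t p \<noteq> {}"
      proof (elim UnE)
        assume "p \<in> ?A"
        then have i: "i = K5" "9 < r" "r \<le> t" by (auto simp: ev_def p)
        then obtain v where "w = E4 # v" using st by (auto simp: p start_ok_def)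
        then have "0 \<in> visits E4 9 t p" using i by (simp add: visits_def p)
        then show ?thesis by blast
      next
        assume "p \<in> ?B"
        then have i: "i = K2" "w \<noteq> [E5, E4, E2]" by (auto simp: ev_def p)
        then obtain v where w: "w = E5 # E4 # E6 # E5 # E4 # v" and r: "2 < r" "r \<le> 3"
          using st by (auto simp: p start_ok_def)
        have "atime (w, i) 2 r = r + 2" using r by (intro K2_atime_2[OF w]) auto
        then have "atime (w, i) 3 r = r + 6"
          using atime_Suc[of "(w, i)" 2 r] by (simp add: w numeral_2_eq_2 numeral_3_eq_3)
        then have "atime (w, i) 4 r = (r + 6) + D E5 (r + 6)"
          using atime_Suc[of "(w, i)" 3 r] by (simp add: w eval_nat_numeral)
        then have "4 \<in> visits E4 9 t p" using D5[of "r + 6"] r t eps w by (simp add: visits_def p)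
        then show ?thesis by blast
      next
        assume "p \<in> ?C"
        then have i: "i = K4" "w \<noteq> [E1, E2, E3]" by (auto simp: ev_def p)
        then obtain v where w: "w = E1 # E6 # E5 # E4 # v" and r: "4 \<le> r" "r \<le> 5"
          using st by (auto simp: p start_ok_def)
        have "atime (w, i) 1 r = r + 1" using r by (intro K4_atime_1[OF w]) auto
        then have "atime (w, i) 2 r = r + 5"
          using atime_Suc[of "(w, i)" 1 r] by (simp add: w numeral_2_eq_2)
        then have "atime (w, i) 3 r = (r + 5) + D E5 (r + 5)"
          using atime_Suc[of "(w, i)" 2 r] by (simp add: w eval_nat_numeral)
        then have "3 \<in> visits E4 9 t p" using D5[of "r + 5"] r t eps w by (simp add: visits_def p)
        then show ?thesis by blast
      qed
    qed
  qed (use ABC t tf M in auto)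
  moreover have "measure P (?A \<union> (?B \<union> ?C)) = measure P ?A + measure P (?B \<union> ?C)"
    using ABC by (intro P.finite_measure_Union) (auto simp: ev_def)
  moreover have "measure P (?B \<union> ?C) = measure P ?B + measure P ?C"
    using ABC by (intro P.finite_measure_Union) (auto simp: ev_def)
  moreover have "measure P ?A = 2 * (t - 9)"
    using t tf M by (intro ev_commodity_eq) auto
  ultimately have c: "2 * (t - 9) + loop \<le> cum E4 t - cum E4 9"
    by (simp add: loop_def loop2_def loop4_def)
  interpret E: vickrey_edge tf \<epsilon> 2 "g E4" "D E4" by (rule edge_E4)
  have "E.G t - E.G 9 - 2 * (t - 9) \<le> E.q t"
    using t tf M eps by (intro E.q_lower) auto
  then have "loop \<le> E.q t" using c by (simp add: edge_E4(2))
  moreover have "D E4 t = \<epsilon> + E.q t / 2" using t tf M by (intro E.D_eq) auto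
  ultimately show ?thesis by simp
qed

lemma cum_E3_ge: "10 + M - 2000 \<le> cum E3 (10 + M) - cum E3 2000"
proof -
  let ?A = "ev (\<lambda>w j s. j = K3 \<and> 2000 < s \<and> s \<le> 10 + M)"
  have "measure P ?A \<le> cum E3 (10 + M) - cum E3 2000"
  proof (rule cum_diff_ge)
    show "?A \<in> sets P" by (auto intro!: ev_sets)
    show "AE p in P. p \<in> ?A \<longrightarrow> visits E3 2000 (10 + M) p \<noteq> {}"
      using AE_start by eventually_elim (auto simp: ev_def start_ok_def visits_def)
  qed (use tf M in auto)
  moreover have "measure P ?A = 1 * (10 + M - 2000)"
    using tf M by (intro ev_commodity_eq) auto
  ultimately show ?thesis by simp
qed

lemma cum_E4_ge: "2 * (13 + M - 2000) \<le> cum E4 (13 + M) - cum E4 2000"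
proof -
  let ?A = "ev (\<lambda>w j s. j = K5 \<and> 2000 < s \<and> s \<le> 13 + M)"
  have "measure P ?A \<le> cum E4 (13 + M) - cum E4 2000"
  proof (rule cum_diff_ge)
    show "?A \<in> sets P" by (auto intro!: ev_sets)
    show "AE p in P. p \<in> ?A \<longrightarrow> visits E4 2000 (13 + M) p \<noteq> {}"
      using AE_start
    proof eventually_elim
      case (elim p)
      show ?case
      proof
        assume p: "p \<in> ?A"
        then obtain v where "fst (fst p) = E4 # v" using elim by (auto simp: ev_def start_ok_def)
        then have "0 \<in> visits E4 2000 (13 + M) p" using p by (simp add: ev_def visits_def)
        then show "visits E4 2000 (13 + M) p \<noteq> {}" by blast
      qed
    qed
  qed (use tf M in auto)
  moreover have "measure P ?A = 2 * (13 + M - 2000)"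
    using tf M by (intro ev_commodity_eq) auto
  ultimately show ?thesis by simp
qed

lemma travel_time_ge: "3 * \<epsilon> * (M - 2000) + (M - 2000) / 2 \<le> total_travel_time (ex_net \<epsilon> M) tf g"
proof -
  let ?c = "\<lambda>e. LINT t:{0..tf}|lborel. D e t * g e t"
  \<comment> \<open>The delay \<open>m\<close> on \<open>E3\<close> is suffered at rate
    \<open>1\<close>, the delay \<open>loop / 2\<close> on \<open>E4\<close> at rate
    \<open>2\<close>. Avoiding one causes the other: \<open>m + loop\<close> is at least
    \<open>1 / 2\<close>, whatever \<open>loop\<close> is.\<close>
  define m where "m = max 0 (1 - 2 * loop)"
  have m: "0 \<le> m" "1 / 2 \<le> m + loop" using loop_nonneg by (auto simp: m_def max_def)
  have c3: "(\<epsilon> + m) * (M - 2000) \<le> ?c E3"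
  proof -
    have "(\<epsilon> + m) * (cum E3 (10 + M) - cum E3 2000) \<le> ?c E3"
      using D_E3_ge tf M eps m by (intro travel_cost_ge(1)[of _ 1]) (auto simp: m_def)
    moreover have "(\<epsilon> + m) * (M - 2000) \<le> (\<epsilon> + m) * (cum E3 (10 + M) - cum E3 2000)"
      using cum_E3_ge eps m by (intro mult_left_mono) auto
    ultimately show ?thesis by linarith
  qed
  have c4: "(\<epsilon> + loop / 2) * (2 * (M - 2000)) \<le> ?c E4"
  proof -
    have "(\<epsilon> + loop / 2) * (cum E4 (13 + M) - cum E4 2000) \<le> ?c E4"
      using D_E4_ge tf M eps loop_nonneg by (intro travel_cost_ge(1)[of _ 2]) auto
    moreover have "(\<epsilon> + loop / 2) * (2 * (M - 2000)) \<le> (\<epsilon> + loop / 2) * (cum E4 (13 + M) - cum E4 2000)"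
      using cum_E4_ge eps loop_nonneg by (intro mult_left_mono) auto
    ultimately show ?thesis by linarith
  qed
  have c0: "0 \<le> ?c e" for e
  proof (cases "e = E6")
    case True
    have "0 \<le> (LINT t:{0..tf}|lborel. 4 * g E6 t)"
      unfolding set_lebesgue_integral_def using g_nonneg by (intro integral_nonneg_AE) (auto simp: indicator_def)
    then show ?thesis using True by simp
  next
    case False
    have "0 \<le> D e t" for t using D_ge[of e t] tau_nonneg[of e] by linarith
    moreover from False obtain nu where "ex_cap e = ereal nu" by (cases e) (auto intro: that[of 1] that[of 2] that[of 6])
    ultimately show ?thesis using tf M by (intro travel_cost_ge(2)[of e nu 0 0 0]) auto
  qed
  have "(M - 2000) / 2 \<le> (m + loop) * (M - 2000)"
    using mult_right_mono[OF m(2), of "M - 2000"] M by simp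
  then have "3 * \<epsilon> * (M - 2000) + (M - 2000) / 2 \<le> (\<epsilon> + m) * (M - 2000) + (\<epsilon> + loop / 2) * (2 * (M - 2000))"
    by (simp add: algebra_simps)
  also have "\<dots> \<le> ?c E3 + ?c E4" using c3 c4 by simp
  also have "\<dots> \<le> (\<Sum>e\<in>UNIV. ?c e)"
    using sum_mono2[of UNIV "{E3, E4}" ?c] c0 by simp
  finally show ?thesis by (simp add: total_travel_time_def)
qed

end

section \<open>The comparison flow\<close>

text \<open>For \<open>l \<le> u\<close> this is the length of \<open>{l..u}\<close> up to
  \<open>t\<close>, that is, the cumulative flow of rate \<open>1\<close> during
  \<open>{l..u}\<close>.\<close>

definition ramp :: "real \<Rightarrow> real \<Rightarrow> real \<Rightarrow> real" where
  "ramp l u t = max 0 (min t u - l)"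

lemma ramp_DERIV:
  assumes "t \<noteq> l" "t \<noteq> u" "l \<le> u"
  shows "(ramp l u has_real_derivative indicator {l..u} t) (at t)"
proof -
  consider "t < l" | "l < t" "t < u" | "u < t" using assms by linarith
  then show ?thesis
  proof cases
    case 1
    then have "eventually (\<lambda>x. x \<in> {..<l}) (nhds t)" by (intro eventually_nhds_in_open) auto
    then have "eventually (\<lambda>x. ramp l u x = 0) (nhds t)"
      by eventually_elim (use assms in \<open>auto simp: ramp_def\<close>)
    then show ?thesis using 1 by (subst DERIV_cong_ev[OF refl _ refl]) auto
  next
    case 2
    then have "eventually (\<lambda>x. x \<in> {l<..<u}) (nhds t)" by (intro eventually_nhds_in_open) auto
    then have "eventually (\<lambda>x. ramp l u x = x - l) (nhds t)"
      by eventually_elim (auto simp: ramp_def)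
    then show ?thesis using 2 by (subst DERIV_cong_ev[OF refl _ refl]) (auto intro!: derivative_eq_intros)
  next
    case 3
    then have "eventually (\<lambda>x. x \<in> {u<..}) (nhds t)" by (intro eventually_nhds_in_open) auto
    then have "eventually (\<lambda>x. ramp l u x = u - l) (nhds t)"
      by eventually_elim (use assms in \<open>auto simp: ramp_def\<close>)
    then show ?thesis using 3 by (subst DERIV_cong_ev[OF refl _ refl]) auto
  qed
qed

text \<open>An increasing affine exit time turns a constant rate \<open>c\<close> into the constant
  rate \<open>c / \<alpha>\<close> on the image interval.\<close>

lemma piece_integral:
  assumes \<alpha>: "\<alpha> > 0" and ab: "0 \<le> a" "a \<le> b" "b \<le> tf" "0 \<le> \<alpha> * a + \<beta>"
    and A: "\<And>s. \<lbrakk>a \<le> s; s \<le> b\<rbrakk> \<Longrightarrow> A s = \<alpha> * s + \<beta>"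
  shows "set_integrable lborel {s \<in> {0..tf}. 0 \<le> A s \<and> A s \<le> t} (\<lambda>s. c * indicator {a..b} s)"
    and "(LINT s:{s \<in> {0..tf}. 0 \<le> A s \<and> A s \<le> t}|lborel. c * indicator {a..b} s)
      = c / \<alpha> * ramp (\<alpha> * a + \<beta>) (\<alpha> * b + \<beta>) t"
proof -
  define u where "u = min b ((t - \<beta>) / \<alpha>)"
  have eq: "(\<lambda>s. indicator {s \<in> {0..tf}. 0 \<le> A s \<and> A s \<le> t} s *\<^sub>R (c * indicator {a..b} s)) = (\<lambda>s. c * indicator {a..u} s)"
  proof
    fix s
    show "indicator {s \<in> {0..tf}. 0 \<le> A s \<and> A s \<le> t} s *\<^sub>R (c * indicator {a..b} s) = c * indicator {a..u} s"
    proof (cases "s \<in> {a..b}")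
      case True
      have "\<alpha> * a \<le> \<alpha> * s" using True \<alpha> by simp
      then have "0 \<le> A s" using A[of s] True ab by simp
      moreover have "A s \<le> t \<longleftrightarrow> s \<le> (t - \<beta>) / \<alpha>" using A[of s] True \<alpha> by (auto simp: field_simps)
      ultimately show ?thesis using True ab by (auto simp: u_def indicator_def)
    qed (auto simp: u_def indicator_def)
  qed
  have i: "integrable lborel (\<lambda>s. c * indicator {a..u} s)"
    by (intro integrable_mult_right integrable_real_indicator) (auto simp: emeasure_lborel_Icc_eq)
  then show "set_integrable lborel {s \<in> {0..tf}. 0 \<le> A s \<and> A s \<le> t} (\<lambda>s. c * indicator {a..b} s)"
    unfolding set_integrable_def eq .
  have "(LINT s:{s \<in> {0..tf}. 0 \<le> A s \<and> A s \<le> t}|lborel. c * indicator {a..b} s) = c * measure lborel {a..u}"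
    unfolding set_lebesgue_integral_def eq by simp
  also have "measure lborel {a..u} = max 0 (u - a)" by (cases "a \<le> u") auto
  also have "max 0 (u - a) = ramp (\<alpha> * a + \<beta>) (\<alpha> * b + \<beta>) t / \<alpha>"
    using \<alpha> by (auto simp: ramp_def u_def max_def min_def field_simps)
  finally show "(LINT s:{s \<in> {0..tf}. 0 \<le> A s \<and> A s \<le> t}|lborel. c * indicator {a..b} s)
      = c / \<alpha> * ramp (\<alpha> * a + \<beta>) (\<alpha> * b + \<beta>) t" by simp
qed

text \<open>A piece \<open>(c, a, b, \<alpha>, \<beta>)\<close> is inflow at rate \<open>c\<close> during \<open>[a, b]\<close> that, entering at \<open>s\<close>, exits at
  \<open>\<alpha> s + \<beta>\<close>; its outflow rate is \<open>c / \<alpha>\<close>.\<close>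

type_synonym piece = "real \<times> real \<times> real \<times> real \<times> real"

definition pflow :: "piece list \<Rightarrow> real \<Rightarrow> real" where
  "pflow ps s = (\<Sum>(c, a, b, \<alpha>, \<beta>)\<leftarrow>ps. c * indicator {a..b} s)"
definition pin :: "piece list \<Rightarrow> real \<Rightarrow> real" where
  "pin ps t = (\<Sum>(c, a, b, \<alpha>, \<beta>)\<leftarrow>ps. c * ramp a b t)"
definition pout :: "piece list \<Rightarrow> real \<Rightarrow> real" where
  "pout ps t = (\<Sum>(c, a, b, \<alpha>, \<beta>)\<leftarrow>ps. c / \<alpha> * ramp (\<alpha> * a + \<beta>) (\<alpha> * b + \<beta>) t)"
definition pout_rate :: "piece list \<Rightarrow> real \<Rightarrow> real" where
  "pout_rate ps t = (\<Sum>(c, a, b, \<alpha>, \<beta>)\<leftarrow>ps. c / \<alpha> * indicator {\<alpha> * a + \<beta>..\<alpha> * b + \<beta>} t)"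
definition pends :: "piece list \<Rightarrow> real set" where
  "pends ps = (\<Union>(c, a, b, \<alpha>, \<beta>)\<in>set ps. {\<alpha> * a + \<beta>, \<alpha> * b + \<beta>})"
definition pieces_ok :: "real \<Rightarrow> (real \<Rightarrow> real) \<Rightarrow> piece list \<Rightarrow> bool" where
  "pieces_ok tf D ps \<longleftrightarrow> (\<forall>(c, a, b, \<alpha>, \<beta>)\<in>set ps. 0 \<le> c \<and> 0 < \<alpha> \<and> 0 \<le> a \<and> a \<le> b \<and> b \<le> tf \<and> 0 \<le> \<alpha> * a + \<beta> \<and>
     (\<forall>s. a \<le> s \<and> s \<le> b \<longrightarrow> s + D s = \<alpha> * s + \<beta>))"

lemma pieces_integral:
  assumes "pieces_ok tf D ps"
  shows "set_integrable lborel {s \<in> {0..tf}. 0 \<le> s + D s \<and> s + D s \<le> t} (pflow ps) \<and>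
    (LINT s:{s \<in> {0..tf}. 0 \<le> s + D s \<and> s + D s \<le> t}|lborel. pflow ps s) = pout ps t"
  using assms
proof (induction ps)
  case Nil
  then show ?case by (simp add: pflow_def[abs_def] pout_def set_integrable_def set_lebesgue_integral_def)
next
  case (Cons p ps)
  obtain c a b \<alpha> \<beta> where p: "p = (c, a, b, \<alpha>, \<beta>)" by (metis prod.exhaust)
  have "pflow (p # ps) = (\<lambda>s. c * indicator {a..b} s + pflow ps s)" by (auto simp: pflow_def p)
  moreover have "pout (p # ps) t = c / \<alpha> * ramp (\<alpha> * a + \<beta>) (\<alpha> * b + \<beta>) t + pout ps t"
    by (simp add: pout_def p)
  moreover note piece_integral[of \<alpha> a b tf \<beta> "\<lambda>s. s + D s" t c]
  ultimately show ?case using Cons by (auto simp: pieces_ok_def p)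
qed

text \<open>Inflow is outflow under the identity as exit time, so the pieces with
  \<open>\<alpha> = 1\<close> and \<open>\<beta> = 0\<close> reduce this to
  \<open>pieces_integral\<close>.\<close>

lemma pieces_cum:
  assumes "pieces_ok tf D ps" "t \<le> tf"
  shows "set_integrable lborel {0..t} (pflow ps) \<and> (LINT s:{0..t}|lborel. pflow ps s) = pin ps t"
proof -
  let ?id = "map (\<lambda>(c, a, b, \<alpha>, \<beta>). (c, a, b, 1, 0)) ps :: piece list"
  have "pieces_ok tf (\<lambda>_. 0) ?id" using assms by (auto simp: pieces_ok_def)
  from pieces_integral[OF this, of t]
  have "set_integrable lborel {s \<in> {0..tf}. 0 \<le> s \<and> s \<le> t} (pflow ?id) \<and>
    (LINT s:{s \<in> {0..tf}. 0 \<le> s \<and> s \<le> t}|lborel. pflow ?id s) = pout ?id t" by simp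
  moreover have "{s \<in> {0..tf}. 0 \<le> s \<and> s \<le> t} = {0..t}" using assms by auto
  moreover have "pflow ?id = pflow ps" by (rule ext) (simp add: pflow_def comp_def case_prod_unfold)
  moreover have "pout ?id t = pin ps t" by (simp add: pout_def pin_def comp_def case_prod_unfold)
  ultimately show ?thesis by simp
qed

lemma pout_DERIV:
  assumes "pieces_ok tf D ps" "t \<notin> pends ps"
  shows "(pout ps has_real_derivative pout_rate ps t) (at t)"
  using assms
proof (induction ps)
  case Nil
  then show ?case by (simp add: pout_def[abs_def] pout_rate_def)
next
  case (Cons p ps)
  obtain c a b \<alpha> \<beta> where p: "p = (c, a, b, \<alpha>, \<beta>)" by (metis prod.exhaust)
  have "pout (p # ps) = (\<lambda>t. c / \<alpha> * ramp (\<alpha> * a + \<beta>) (\<alpha> * b + \<beta>) t + pout ps t)"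
    by (auto simp: pout_def p)
  moreover have "pout_rate (p # ps) t = c / \<alpha> * indicator {\<alpha> * a + \<beta>..\<alpha> * b + \<beta>} t + pout_rate ps t"
    by (simp add: pout_rate_def p)
  moreover have "(ramp (\<alpha> * a + \<beta>) (\<alpha> * b + \<beta>) has_real_derivative indicator {\<alpha> * a + \<beta>..\<alpha> * b + \<beta>} t) (at t)"
    using Cons.prems by (intro ramp_DERIV) (auto simp: p pieces_ok_def pends_def)
  moreover have "(pout ps has_real_derivative pout_rate ps t) (at t)"
    using Cons.prems by (intro Cons.IH) (auto simp: pieces_ok_def pends_def)
  ultimately show ?case by (simp only:) (intro DERIV_add DERIV_cmult)
qed

text \<open>Reduces the queuing conditions to identities and inequalities between piecewise linear
  functions. The outflow is differentiable off the finite set \<open>pends ps\<close>.\<close>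

lemma vickrey_ok_pieces:
  assumes ok: "pieces_ok tf D ps" and tau: "0 \<le> ta" and nu: "0 < nu"
    and out: "\<And>t. t \<notin> {0..tf} \<Longrightarrow> D t = ta"
    and D: "\<And>t. t \<in> {0..tf} \<Longrightarrow> ta \<le> D t \<and> nu * (D t - ta) = pin ps t - pout ps (t + ta)"
    and rate: "\<And>t. t \<notin> pends ps \<Longrightarrow> pout_rate ps t \<le> nu"
  shows "vickrey_ok tf ta (ereal nu) (pflow ps) D"
proof -
  have oc: "outcum tf (pflow ps) D = pout ps"
    using pieces_integral[OF ok] by (auto simp: outcum_def)
  have q: "queue tf ta (pflow ps) D t = nu * (D t - ta)" if "t \<in> {0..tf}" for t
  proof -
    have "queue tf ta (pflow ps) D t = pin ps t - pout ps (t + ta)"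
      using pieces_integral[OF ok] pieces_cum[OF ok, of t] that by (simp add: queue_def)
    then show ?thesis using D[OF that] by simp
  qed
  have "finite (pends ps)" by (auto simp: pends_def)
  then have "AE t in lborel. t \<notin> pends ps"
    by (intro AE_not_in finite_imp_null_set_lborel)
  then have "AE t in lborel. t \<in> {0..tf} \<longrightarrow> (\<exists>d. (pout ps has_real_derivative d) (at t) \<and> ereal d \<le> ereal nu)"
    by eventually_elim (use pout_DERIV[OF ok] rate in auto)
  moreover have "0 \<le> queue tf ta (pflow ps) D t \<and> D t = ta + queue tf ta (pflow ps) D t / nu" if "t \<in> {0..tf}" for t
    unfolding q[OF that] using D[OF that, THEN conjunct1] nu by simp
  ultimately show ?thesis
    using out by (simp add: vickrey_ok_def oc)
qed

lemma vickrey_edge_pieces: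
  assumes "pieces_ok tf D ps" "0 \<le> ta" "0 < nu" "vickrey_ok tf ta (ereal nu) (pflow ps) D'"
  shows "vickrey_edge tf ta nu (pflow ps) D'"
proof
  show "set_integrable lborel {0..tf} (pflow ps)" using pieces_cum[OF assms(1), of tf] by simp
  have "0 \<le> (case p of (c, a, b, \<alpha>, \<beta>) \<Rightarrow> c * indicator {a..b} t)" if "p \<in> set ps" for p t
    using that assms(1) by (auto simp: pieces_ok_def)
  then show "0 \<le> pflow ps t" for t unfolding pflow_def by (intro sum_list_nonneg) auto
qed (use assms in auto)

text \<open>A verified solution becomes the value of the definite description by
  \<open>vickrey_unique\<close>; \<open>u\<close> is a time at which the inflow has ended and the
  queue is empty.\<close>

lemma trav_pieces:
  assumes ok: "pieces_ok tf D ps" and tau: "0 \<le> tau N e" and nu: "0 < nu" "cap N e = ereal nu" and ge: "g e = pflow ps"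
    and v: "vickrey_ok tf (tau N e) (ereal nu) (pflow ps) D"
    and u: "0 \<le> u" "u \<le> tf" "u + tau N e + pin ps u / nu \<le> tf" "pin ps tf = pin ps u" "D u = tau N e"
  shows "trav N tf g e = D"
  unfolding trav_def nu(2) ge
proof (rule the_equality)
  show "vickrey_ok tf (tau N e) (ereal nu) (pflow ps) D" by fact
  fix D' assume D': "vickrey_ok tf (tau N e) (ereal nu) (pflow ps) D'"
  note e = vickrey_edge_pieces[OF ok tau nu(1)]
  have G: "vickrey_edge.G (pflow ps) t = pin ps t" if "t \<le> tf" for t
    using vickrey_edge.G_def[OF e[OF v]] pieces_cum[OF ok that] by simp
  have "D = D'"
    using u G by (intro vickrey_unique[OF e[OF v] e[OF D'], of u]) auto
  then show "D' = D" ..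
qed

section \<open>The explicit flow with the detour\<close>

fun opt_walk :: "com \<Rightarrow> edge list" where
  "opt_walk K1 = [E7, E5, E4, E6]"
| "opt_walk K2 = [E5, E4, E2]"
| "opt_walk K3 = [E3]"
| "opt_walk K4 = [E1, E2, E3]"
| "opt_walk K5 = [E4]"

definition opt_h :: "real \<Rightarrow> edge list \<times> com \<Rightarrow> real \<Rightarrow> real" where
  "opt_h M wi t = (if fst wi = opt_walk (snd wi) then ex_rate M (snd wi) t else 0)"

text \<open>\<open>K1\<close> enters \<open>E5\<close> at three times its capacity, which stretches
  its exit by the factor \<open>3\<close> and holds back \<open>K2\<close>, right behind it, by
  \<open>2\<close>. So \<open>K2\<close> enters \<open>E2\<close> from time \<open>6\<close> on,
  just after \<open>K4\<close>, and \<open>K4\<close> enters \<open>E3\<close> during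
  \<open>{6..7}\<close>, just before \<open>K3\<close>. The short queue of \<open>K2\<close> on
  \<open>E2\<close> delays no other commodity.\<close>

fun opt_pieces :: "real \<Rightarrow> real \<Rightarrow> edge \<Rightarrow> piece list" where
  "opt_pieces \<epsilon> M E1 = [(1, 4, 5, 1, 1)]"
| "opt_pieces \<epsilon> M E2 = [(1, 5, 6, 1, 1), (2, 6, 7, 2, -5)]"
| "opt_pieces \<epsilon> M E3 = [(1, 6, 7, 1, \<epsilon>), (1, 7, 10 + M, 1, \<epsilon>)]"
| "opt_pieces \<epsilon> M E4 = [(2, 3 - \<epsilon>, 6 - \<epsilon>, 1, \<epsilon>), (2, 6 - \<epsilon>, 7 - \<epsilon>, 1, \<epsilon>), (2, 9, 13 + M, 1, \<epsilon>)]"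
| "opt_pieces \<epsilon> M E5 = [(6, 1, 2, 3, -\<epsilon>), (2, 2, 3, 1, 4 - \<epsilon>)]"
| "opt_pieces \<epsilon> M E6 = [(2, 3, 6, 1, 4)]"
| "opt_pieces \<epsilon> M E7 = [(6, 0, 1, 1, 1)]"

definition opt_g :: "real \<Rightarrow> real \<Rightarrow> edge \<Rightarrow> real \<Rightarrow> real" where
  "opt_g \<epsilon> M e = pflow (opt_pieces \<epsilon> M e)"

text \<open>Waiting times as minima of their linear phases. On \<open>E5\<close> the wait grows
  until time \<open>2\<close>, is constant until \<open>3\<close> and has drained at
  \<open>5\<close>; on \<open>E2\<close> it grows from \<open>6\<close> to \<open>7\<close> and has
  drained at \<open>8\<close>.\<close>

definition opt_D :: "real \<Rightarrow> edge \<Rightarrow> real \<Rightarrow> real" where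
  "opt_D \<epsilon> e t = ex_tau \<epsilon> e + (if e = E5 then max 0 (min (2 * (t - 1)) (min 2 (5 - t)))
     else if e = E2 then max 0 (min (t - 6) (8 - t)) else 0)"

text \<open>The room \<open>2 * M + 100\<close> is what uniqueness of travel times asks for: on
  \<open>E3\<close> and \<open>E4\<close> both the end of the inflow and the service time of its
  total amount grow like \<open>M\<close>.\<close>

locale opt =
  fixes \<epsilon> M tf tf' :: real
  assumes eps: "0 < \<epsilon>" "\<epsilon> \<le> 1" and M: "0 \<le> M" and tf: "2 * M + 100 \<le> tf'" "tf' \<le> tf"
begin

abbreviation "N \<equiv> ex_net \<epsilon> M"
abbreviation "g \<equiv> opt_g \<epsilon> M"
abbreviation "h \<equiv> opt_h M"
abbreviation "ps \<equiv> opt_pieces \<epsilon> M"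

lemma opt_pieces_ok: "pieces_ok tf (opt_D \<epsilon> e) (ps e)"
  using eps M tf
  by (cases e) (auto simp: pieces_ok_def opt_D_def max_def min_def field_simps)

lemma opt_vickrey:
  assumes "ex_cap e = ereal nu" "0 < nu"
  shows "vickrey_ok tf (ex_tau \<epsilon> e) (ereal nu) (g e) (opt_D \<epsilon> e)"
  unfolding opt_g_def
proof (rule vickrey_ok_pieces[OF opt_pieces_ok])
  show "0 \<le> ex_tau \<epsilon> e" using eps by (cases e) auto
  show "opt_D \<epsilon> e t = ex_tau \<epsilon> e" if "t \<notin> {0..tf}" for t
    using that M tf by (auto simp: opt_D_def)
  show "ex_tau \<epsilon> e \<le> opt_D \<epsilon> e t \<and> nu * (opt_D \<epsilon> e t - ex_tau \<epsilon> e) = pin (ps e) t - pout (ps e) (t + ex_tau \<epsilon> e)" for t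
    using assms eps M by (cases e) (auto simp: opt_D_def pin_def pout_def ramp_def max_def min_def field_simps)
  show "pout_rate (ps e) t \<le> nu" if "t \<notin> pends (ps e)" for t
    using that assms eps M by (cases e) (auto simp: pout_rate_def pends_def indicator_def)
qed fact

lemma opt_trav: "trav N tf g e = opt_D \<epsilon> e"
proof (cases "e = E6")
  case True
  have "(THE D. vickrey_ok tf 4 \<infinity> (g E6) D) = opt_D \<epsilon> E6"
  proof (rule the_equality)
    show "vickrey_ok tf 4 \<infinity> (g E6) (opt_D \<epsilon> E6)" by (simp add: vickrey_ok_def opt_D_def)
    fix D assume "vickrey_ok tf 4 \<infinity> (g E6) D"
    then have "D t = 4" for t by (cases "t \<in> {0..tf}") (auto simp: vickrey_ok_def)
    then show "D = opt_D \<epsilon> E6" by (auto simp: opt_D_def)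
  qed
  then show ?thesis using True by (simp add: trav_def)
next
  case False
  then obtain nu where nu: "ex_cap e = ereal nu" "0 < nu"
    by (cases e) (auto intro: that[of 1] that[of 2] that[of 6])
  \<comment> \<open>End of the inflow, except on \<open>E2\<close> and \<open>E5\<close>, where it
    is the later time at which the queue has drained.\<close>
  define t0 where "t0 = (case e of E1 \<Rightarrow> 5 | E2 \<Rightarrow> 8 | E3 \<Rightarrow> 10 + M | E4 \<Rightarrow> 13 + M | E5 \<Rightarrow> 5 | E6 \<Rightarrow> 6 | E7 \<Rightarrow> 1)"
  show ?thesis
  proof (rule trav_pieces[OF opt_pieces_ok, where N=N and nu=nu and u=t0])
    show "vickrey_ok tf (tau N e) (ereal nu) (pflow (ps e)) (opt_D \<epsilon> e)"
      using opt_vickrey[OF nu] by (simp add: opt_g_def)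
    show "0 \<le> tau N e" using eps by (cases e) auto
    show "0 < nu" "cap N e = ereal nu" "g e = pflow (ps e)" using nu by (auto simp: opt_g_def)
    show "0 \<le> t0" "t0 \<le> tf" using M tf by (cases e; simp add: t0_def)+
    show "opt_D \<epsilon> e t0 = tau N e" by (cases e) (simp_all add: t0_def opt_D_def)
    show "pin (ps e) tf = pin (ps e) t0" using False M tf eps by (cases e) (simp_all add: t0_def pin_def ramp_def)
    show "t0 + tau N e + pin (ps e) t0 / nu \<le> tf"
      using False nu M tf eps by (cases e) (auto simp: t0_def pin_def ramp_def add_divide_distrib)
  qed
qed

lemma opt_exit: "exitT N tf g e t = t + opt_D \<epsilon> e t"
  by (simp add: exitT_def opt_trav)

lemma opt_in_walks: "(opt_walk i, i) \<in> walks N"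
  by (cases i) (simp_all add: walks_def is_walk_Cons)

text \<open>The same flow seen from the departure: entry \<open>j\<close> gives the time of entering
  the \<open>j\<close>-th edge as a function of the departure time, whereas
  \<open>opt_pieces\<close> gives exit times as functions of the entrance time.\<close>

fun walk_pieces :: "com \<Rightarrow> piece list" where
  "walk_pieces K1 = [(6, 0, 1, 1, 0), (6, 0, 1, 1, 1), (6, 0, 1, 3, 3 - \<epsilon>), (6, 0, 1, 3, 3)]"
| "walk_pieces K2 = [(2, 2, 3, 1, 0), (2, 2, 3, 1, 4 - \<epsilon>), (2, 2, 3, 1, 4)]"
| "walk_pieces K3 = [(1, 7, 10 + M, 1, 0)]"
| "walk_pieces K4 = [(1, 4, 5, 1, 0), (1, 4, 5, 1, 1), (1, 4, 5, 1, 2)]"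
| "walk_pieces K5 = [(2, 9, 13 + M, 1, 0)]"

lemma opt_term:
  assumes "j < length (opt_walk i)" "walk_pieces i ! j = (c, a, b, \<alpha>, \<beta>)"
  shows "(LINT s:{s \<in> {0..tf}. 0 \<le> arr (exitT N tf g) (opt_walk i) j s \<and> arr (exitT N tf g) (opt_walk i) j s \<le> t}|lborel. h (opt_walk i, i) s)
    = c / \<alpha> * ramp (\<alpha> * a + \<beta>) (\<alpha> * b + \<beta>) t"
proof -
  have h: "h (opt_walk i, i) = (\<lambda>s. c * indicator {a..b} s)"
    using assms by (cases i) (auto simp: opt_h_def less_Suc_eq)
  have ok: "\<alpha> > 0" "0 \<le> a" "a \<le> b" "b \<le> tf" "0 \<le> \<alpha> * a + \<beta>"
    using assms eps M tf by (cases i; auto simp: less_Suc_eq)+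
  have "arr (exitT N tf g) (opt_walk i) j s = \<alpha> * s + \<beta>" if "a \<le> s" "s \<le> b" for s
    using assms eps M that by (cases i) (auto simp: less_Suc_eq opt_exit opt_D_def max_def min_def)
  from piece_integral(2)[OF ok this] show ?thesis by (simp add: h)
qed

lemma opt_loads: "loads N tf h g"
  unfolding loads_def
proof (intro allI ballI)
  fix e t assume t: "t \<in> {0..tf}"
  let ?f = "\<lambda>wi. \<Sum>j\<in>{j. j < length (fst wi) \<and> fst wi ! j = e}.
             (LINT s:{s \<in> {0..tf}. 0 \<le> arr (exitT N tf g) (fst wi) j s \<and> arr (exitT N tf g) (fst wi) j s \<le> t}|lborel. h wi s)"
  let ?B = "range (\<lambda>i. (opt_walk i, i))"
  have G: "(LINT s:{0..t}|lborel. g e s) = pin (ps e) t"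
    using pieces_cum[OF opt_pieces_ok, of t e] t by (simp add: opt_g_def)
  show "(?f has_sum (LINT s:{0..t}|lborel. g e s)) (walks N)"
    unfolding G
  proof (rule has_sum_finite_neutralI)
    show "finite ?B" "?B \<subseteq> walks N" using opt_in_walks by auto
    show "?f wi = 0" if wi: "wi \<in> walks N - ?B" for wi
    proof -
      have "fst wi \<noteq> opt_walk (snd wi)" using wi by (cases wi) auto
      then show ?thesis by (simp add: opt_h_def set_lebesgue_integral_def)
    qed
    have f: "?f (opt_walk i, i) = (\<Sum>j<length (opt_walk i). if opt_walk i ! j = e then
        (case walk_pieces i ! j of (c, a, b, \<alpha>, \<beta>) \<Rightarrow> c / \<alpha> * ramp (\<alpha> * a + \<beta>) (\<alpha> * b + \<beta>) t) else 0)" for i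
    proof -
      have "?f (opt_walk i, i) = (\<Sum>j\<in>{j\<in>{..<length (opt_walk i)}. opt_walk i ! j = e}.
          (case walk_pieces i ! j of (c, a, b, \<alpha>, \<beta>) \<Rightarrow> c / \<alpha> * ramp (\<alpha> * a + \<beta>) (\<alpha> * b + \<beta>) t))"
      proof (rule sum.cong)
        fix j assume j: "j \<in> {j\<in>{..<length (opt_walk i)}. opt_walk i ! j = e}"
        obtain c a b \<alpha> \<beta> where p: "walk_pieces i ! j = (c, a, b, \<alpha>, \<beta>)" by (metis prod.exhaust)
        have "j < length (opt_walk i)" using j by simp
        from opt_term[OF this p]
        show "(LINT s:{s \<in> {0..tf}. 0 \<le> arr (exitT N tf g) (fst (opt_walk i, i)) j s \<and>
              arr (exitT N tf g) (fst (opt_walk i, i)) j s \<le> t}|lborel. h (opt_walk i, i) s)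
            = (case walk_pieces i ! j of (c, a, b, \<alpha>, \<beta>) \<Rightarrow> c / \<alpha> * ramp (\<alpha> * a + \<beta>) (\<alpha> * b + \<beta>) t)"
          by (simp only: fst_conv p prod.case)
      qed auto
      also have "\<dots> = (\<Sum>j<length (opt_walk i). if opt_walk i ! j = e then
        (case walk_pieces i ! j of (c, a, b, \<alpha>, \<beta>) \<Rightarrow> c / \<alpha> * ramp (\<alpha> * a + \<beta>) (\<alpha> * b + \<beta>) t) else 0)"
        by (rule sum.inter_filter) simp
      finally show ?thesis .
    qed
    have "sum ?f ?B = (\<Sum>i\<in>UNIV. ?f (opt_walk i, i))"
      by (subst sum.reindex) (auto simp: inj_on_def)
    also have "\<dots> = pin (ps e) t"
      unfolding f by (cases e) (simp_all add: UNIV_com lessThan_Suc pin_def eval_nat_numeral algebra_simps)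
    finally show "pin (ps e) t = sum ?f ?B" ..
  qed
qed

lemma opt_g_nonneg: "0 \<le> g e t"
  by (cases e) (auto simp: opt_g_def pflow_def)

lemma opt_edge_flow: "edge_flow tf tf' g"
proof -
  have "set_integrable lborel {0..tf} (g e)" for e
    using pieces_cum[OF opt_pieces_ok, of tf e] by (simp add: opt_g_def)
  moreover have "g e t = 0" if "t \<notin> {0..tf'}" for e t
    using that M tf eps by (cases e) (auto simp: opt_g_def pflow_def indicator_def)
  ultimately show ?thesis by (auto simp: edge_flow_def opt_g_nonneg)
qed

lemma opt_induces: "induces N tf tf' h g"
proof -
  have "vickrey_ok tf (tau N e) (cap N e) (g e) (trav N tf g e)" for e
  proof (cases "e = E6")
    case True
    then show ?thesis by (simp add: opt_trav vickrey_ok_def opt_D_def)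
  next
    case False
    then obtain nu where "ex_cap e = ereal nu" "0 < nu"
      by (cases e) (auto intro: that[of 1] that[of 2] that[of 6])
    then show ?thesis using opt_vickrey by (simp add: opt_trav)
  qed
  then show ?thesis using opt_loads opt_edge_flow by (simp add: induces_def)
qed

lemma opt_walk_flow: "walk_flow N tf h"
proof -
  have "((\<lambda>wi. h wi t) has_sum rate N i t) (walks_of N i)" for i t
  proof (rule has_sum_finite_neutralI)
    show "{(opt_walk i, i)} \<subseteq> walks_of N i" using opt_in_walks by (auto simp: walks_of_def)
  qed (auto simp: walks_of_def opt_h_def)
  moreover have "set_integrable lborel {0..tf} (h wi)" for wi
  proof (cases "fst wi = opt_walk (snd wi)")
    case True
    then have "h wi = ex_rate M (snd wi)" by (auto simp: opt_h_def)
    then show ?thesis by (simp add: ex_rate_integrable)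
  next
    case False
    then have "h wi = (\<lambda>_. 0)" by (auto simp: opt_h_def)
    then show ?thesis by (simp add: set_integrable_def)
  qed
  moreover have "0 \<le> h wi t" for wi t by (simp add: opt_h_def ex_rate_bounds(1))
  ultimately show ?thesis by (simp add: walk_flow_def)
qed

lemma opt_induced: "g \<in> induced_flows N tf tf'"
  using opt_induces opt_walk_flow by (auto simp: induced_flows_def Lambda_def)

lemma opt_cost_le:
  assumes "\<And>s. opt_D \<epsilon> e s \<le> K" "0 \<le> K"
  shows "(LINT s:{0..tf}|lborel. opt_D \<epsilon> e s * g e s) \<le> K * pin (ps e) tf"
proof -
  have int: "set_integrable lborel {0..tf} (g e)" "(LINT s:{0..tf}|lborel. g e s) = pin (ps e) tf"
    using pieces_cum[OF opt_pieces_ok, of tf e] by (simp_all add: opt_g_def)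
  have "(LINT s:{0..tf}|lborel. opt_D \<epsilon> e s * g e s) \<le> (LINT s:{0..tf}|lborel. K * g e s)"
    unfolding set_lebesgue_integral_def
  proof (rule integral_mono')
    show "integrable lborel (\<lambda>s. indicator {0..tf} s *\<^sub>R (K * g e s))"
      using set_integrable_mult_right[of K, OF int(1)] by (simp add: set_integrable_def)
    show "indicator {0..tf} s *\<^sub>R (opt_D \<epsilon> e s * g e s) \<le> indicator {0..tf} s *\<^sub>R (K * g e s)" for s
      using assms(1)[of s] opt_g_nonneg by (auto simp: indicator_def intro: mult_right_mono)
    show "0 \<le> indicator {0..tf} s *\<^sub>R (K * g e s)" for s
      using assms(2) opt_g_nonneg by (auto simp: indicator_def)
  qed
  also have "\<dots> = K * pin (ps e) tf" using int by simp
  finally show ?thesis .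
qed

lemma opt_total: "total_travel_time N tf g \<le> 3 * \<epsilon> * M + 100"
proof -
  \<comment> \<open>Largest travel time of each edge, rounded up on \<open>E5\<close>. The values on
    \<open>E3\<close> and \<open>E4\<close> are exact, as they must be, because only there the
    inflow grows with \<open>M\<close>.\<close>
  define K where "K e = (case e of E1 \<Rightarrow> 1 | E2 \<Rightarrow> 2 | E3 \<Rightarrow> \<epsilon> | E4 \<Rightarrow> \<epsilon> | E5 \<Rightarrow> 4 | E6 \<Rightarrow> 4 | E7 \<Rightarrow> 1)" for e
  have "total_travel_time N tf g = (\<Sum>e\<in>UNIV. LINT s:{0..tf}|lborel. opt_D \<epsilon> e s * g e s)"
    by (simp add: total_travel_time_def opt_trav)
  also have "\<dots> \<le> (\<Sum>e\<in>UNIV. K e * pin (ps e) tf)"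
  proof (intro sum_mono opt_cost_le)
    show "opt_D \<epsilon> e s \<le> K e" for e s using eps by (cases e) (auto simp: opt_D_def K_def max_def min_def)
    show "0 \<le> K e" for e using eps by (cases e) (auto simp: K_def)
  qed
  also have "\<dots> = 69 + \<epsilon> * (20 + 3 * M)"
    using M tf eps by (simp add: UNIV_edge K_def pin_def ramp_def algebra_simps)
  also have "\<dots> \<le> 3 * \<epsilon> * M + 100" using eps by (simp add: algebra_simps)
  finally show ?thesis .
qed

end

text \<open>Every other walk of \<open>K1\<close> prolongs \<open>[E7]\<close>, so with nonnegative tolls it is strictly more expensive.\<close>

lemma DUE_K1_direct:
  assumes ind: "induces (ex_net \<epsilon> M) tf tf' h g" and wf: "walk_flow (ex_net \<epsilon> M) tf h"
    and eps: "0 < \<epsilon>" "\<epsilon> \<le> 1"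
    and toll: "is_toll tf p" and due: "is_DUE (ex_net \<epsilon> M) tf p h g"
    and w: "(w, K1) \<in> walks (ex_net \<epsilon> M)" "w \<noteq> [E7]"
  shows "AE s in lborel. s \<in> {0..tf} \<longrightarrow> h (w, K1) s \<le> 0"
proof -
  interpret loaded_net "ex_net \<epsilon> M" tf tf' h g
  proof
    fix e
    show "0 \<le> tau (ex_net \<epsilon> M) e" "0 < cap (ex_net \<epsilon> M) e"
      using eps by (cases e; simp)+
  qed (use ind wf ex_rate_integrable ex_rate_bounds(1) in auto)
  let ?T = "exitT (ex_net \<epsilon> M) tf g"
  obtain v where v: "w = E7 # v" using K1_walks[OF w(1)] by blast
  have p: "0 \<le> p e t" for e t using toll by (cases "t \<in> {0..tf}") (auto simp: is_toll_def)
  have E7: "([E7], K1) \<in> walks_of (ex_net \<epsilon> M) K1"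
    by (simp add: walks_of_def walks_def is_walk_Cons)
  have "AE s in lborel. s \<in> {0..tf} \<and> h (w, K1) s > 0 \<longrightarrow>
      (\<forall>wi'\<in>walks_of (ex_net \<epsilon> M) K1. Psi (ex_net \<epsilon> M) tf g (w, K1) s + Ptoll (ex_net \<epsilon> M) tf g p (w, K1) s
        \<le> Psi (ex_net \<epsilon> M) tf g wi' s + Ptoll (ex_net \<epsilon> M) tf g p wi' s)"
    using due w(1) unfolding is_DUE_def by (auto simp: walks_of_def)
  then show ?thesis
  proof eventually_elim
    case (elim s)
    show ?case
    proof (intro impI, rule ccontr)
      assume "s \<in> {0..tf}" "\<not> h (w, K1) s \<le> 0"
      then have le: "Psi (ex_net \<epsilon> M) tf g (w, K1) s + Ptoll (ex_net \<epsilon> M) tf g p (w, K1) s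
        \<le> Psi (ex_net \<epsilon> M) tf g ([E7], K1) s + Ptoll (ex_net \<epsilon> M) tf g p ([E7], K1) s"
        using elim E7 by auto
      have len: "1 < length w" using v w(2) by (cases v) auto
      \<comment> \<open>Strictness comes from the positive free-flow time of the second edge; the
        toll on \<open>E7\<close> is the same for both walks, as both enter it at time
        \<open>s\<close>.\<close>
      have "0 < ex_tau \<epsilon> (w ! 1)" using eps by (cases "w ! 1") auto
      then have "atime (w, K1) 1 s < atime (w, K1) 2 s"
        using atime_Suc_ge[of "(w, K1)" 1 s] by (simp add: numeral_2_eq_2)
      also have "\<dots> \<le> atime (w, K1) (length w) s" using len by (intro atime_mono) auto
      finally have "arr ?T [E7] 1 s < arr ?T w (length w) s" by (simp add: atime_def v)
      moreover have "p E7 s \<le> (\<Sum>j<length w. p (w ! j) (arr ?T w j s))"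
      proof -
        have "(\<Sum>j\<in>{0}. p (w ! j) (arr ?T w j s)) \<le> (\<Sum>j<length w. p (w ! j) (arr ?T w j s))"
          using len p by (intro sum_mono2) auto
        then show ?thesis by (simp add: v)
      qed
      ultimately show False using le by (simp add: Psi_def Ptoll_def)
    qed
  qed
qed

theorem theorem3p2:
  shows "\<exists>M::real. M \<ge> 0 \<and>
    (\<forall>\<epsilon>::real. 0 < \<epsilon> \<and> \<epsilon> \<le> 1 \<longrightarrow>
      (\<exists>T0::real. \<forall>tf' tf::real. T0 \<le> tf' \<and> tf' \<le> tf \<longrightarrow>
         \<not> (\<exists>g. system_optimal (ex_net \<epsilon> M) tf tf' g \<and> implementable (ex_net \<epsilon> M) tf tf' g)))"
proof (rule exI[of _ 20000], intro conjI allI impI, simp, rule exI[of _ 40100], intro allI impI notI)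
  fix \<epsilon> tf' tf :: real
  assume eps: "0 < \<epsilon> \<and> \<epsilon> \<le> 1" and tf: "40100 \<le> tf' \<and> tf' \<le> tf"
  assume "\<exists>g. system_optimal (ex_net \<epsilon> 20000) tf tf' g \<and> implementable (ex_net \<epsilon> 20000) tf tf' g"
  then obtain g where opt: "system_optimal (ex_net \<epsilon> 20000) tf tf' g" and impl: "implementable (ex_net \<epsilon> 20000) tf tf' g"
    by blast
  \<comment> \<open>The equilibrium \<open>h\<close> induces the optimal \<open>g\<close> itself and
    the total travel time depends on \<open>g\<close> alone, so the lower bound obtained from
    \<open>h\<close> applies to the optimum.\<close>
  obtain p h where ph: "is_toll tf p" "h \<in> Lambda (ex_net \<epsilon> 20000) tf tf'" "induces (ex_net \<epsilon> 20000) tf tf' h g"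
      "is_DUE (ex_net \<epsilon> 20000) tf p h g"
    using impl unfolding implementable_def by blast
  have wf: "walk_flow (ex_net \<epsilon> 20000) tf h" using ph(2) by (simp add: Lambda_def)
  interpret F: ex_flow \<epsilon> 20000 tf tf' h g
    using eps tf wf ph(3) DUE_K1_direct[OF ph(3) wf _ _ ph(1,4)] by unfold_locales auto
  interpret O: opt \<epsilon> 20000 tf tf'
    using eps tf by unfold_locales auto
  have "total_travel_time (ex_net \<epsilon> 20000) tf g \<le> total_travel_time (ex_net \<epsilon> 20000) tf (opt_g \<epsilon> 20000)"
    using opt O.opt_induced by (simp add: system_optimal_def)
  \<comment> \<open>The lower bound exceeds the upper one by
    \<open>(M - 2000) / 2 - 6000 * \<epsilon> - 100\<close>, which is positive for
    \<open>M = 20000\<close> and all \<open>\<epsilon> \<le> 1\<close>. The horizon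
    \<open>40100\<close> is \<open>2 * M + 100\<close>.\<close>
  then show False using F.travel_time_ge O.opt_total eps by simp
qed

end
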